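(* Let $\mathcal{A}$ be a simple, $\sigma$-unital, non-unital, non-elementary C*-algebra with an approximate identity $\{e_n\}$. Then the following are equivalent: (i) $\mathcal{A}_+\neq\overline{K_o(\{e_n\})}$ (norm closure); (ii) $\mathcal{A}$ has an order dense sequence; (iii) $\mathcal{A}$ has a thin sequence; (iv) $\mathcal{A}$ has a thin sequence $\{d_j\}$ such that the series $\sum_{j=1}^\infty d_j$ converges strictly to an element $D\in K_o(\{e_n\})\setminus\mathcal{A}$.
   Context: Non-elementary means not isomorphic to the algebra of compact operators on a Hilbert space. Cuntz subequivalence: for positive $a,b$ in a C*-algebra $\mathcal{B}$, $a\preceq b$ means there is a sequence $x_n\in\mathcal{B}$ with $\|x_nbx_n^*-a\|\to 0$. An approximate identity $\{e_n\}_{n\ge1}$ of $\mathcal{A}$ always means a sequential approximate identity of positive contractions, strictly increasing ($0\le e_n\lneqq e_{n+1}$), with $e_{n+1}e_n=e_n$ for all $n$. With $\mathcal{M}(\mathcal{A})$ the multiplier algebra, define $$K_o(\{e_n\}):=\{X\in\mathcal{M}(\mathcal{A})_+ : \forall\, 0\ne a\in\mathcal{A}_+\ \exists N\in\mathbb{N}\ \text{such that}\ m>n\ge N\Rightarrow (e_m-e_n)X(e_m-e_n)\preceq a\}.$$ A sequence of elements $0\ne s_i\in\mathcal{A}_+$ is order dense for $\mathcal{A}$ if for every $0\ne a\in\mathcal{A}_+$ there is an $n$ with $s_n\preceq a$. A sequence of mutually orthogonal elements $0\neq t_i\in\mathcal{A}_+$ is thin for $\mathcal{A}$ if for every $0\ne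 a\in\mathcal{A}_+$ there is an integer $N$ such that $\sum_{i=n}^m t_i\preceq a$ for all $m\ge n\ge N$. Strict convergence is convergence in the strict topology of $\mathcal{M}(\mathcal{A})$. *)

theory Defs
  imports "HOL-Analysis.Analysis"
begin

section \<open>C*-algebras\<close>

class cstar_algebra = banach + real_normed_algebra +
  fixes scaleC :: "complex \<Rightarrow> 'a \<Rightarrow> 'a" (infixr \<open>*\<^sub>C\<close> 75)
    and star :: "'a \<Rightarrow> 'a"
  assumes scaleR_scaleC: "r *\<^sub>R x = complex_of_real r *\<^sub>C x"
    and scaleC_add_right: "c *\<^sub>C (x + y) = c *\<^sub>C x + c *\<^sub>C y"
    and scaleC_add_left: "(c + d) *\<^sub>C x = c *\<^sub>C x + d *\<^sub>C x"
    and scaleC_scaleC: "c *\<^sub>C d *\<^sub>C x = (c * d) *\<^sub>C x"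
    and norm_scaleC: "norm (c *\<^sub>C x) = cmod c * norm x"
    and mult_scaleC_left: "(c *\<^sub>C x) * y = c *\<^sub>C (x * y)"
    and mult_scaleC_right: "x * (c *\<^sub>C y) = c *\<^sub>C (x * y)"
    and star_star: "star (star x) = x"
    and star_add: "star (x + y) = star x + star y"
    and star_scaleC: "star (c *\<^sub>C x) = cnj c *\<^sub>C star x"
    and star_mult: "star (x * y) = star y * star x"
    and cstar_identity: "norm (star x * x) = (norm x)\<^sup>2"

text \<open>Positivity as \<open>b* b\<close>, which needs no unitization (the algebra may lack a unit).\<close>

definition cpos :: "'a::cstar_algebra \<Rightarrow> bool"
  where "cpos a \<longleftrightarrow> (\<exists>b. a = star b * b)"

definition cle :: "'a::cstar_algebra \<Rightarrow> 'a \<Rightarrow> bool"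
  where "cle a b \<longleftrightarrow> cpos (b - a)"

definition unital :: "'a::cstar_algebra itself \<Rightarrow> bool"
  where "unital _ \<longleftrightarrow> (\<exists>u::'a. \<forall>a. u * a = a \<and> a * u = a)"

definition sigma_unital :: "'a::cstar_algebra itself \<Rightarrow> bool"
  where "sigma_unital _ \<longleftrightarrow>
    (\<exists>u :: nat \<Rightarrow> 'a. (\<forall>n. cpos (u n) \<and> norm (u n) \<le> 1 \<and> cle (u n) (u (Suc n))) \<and>
       (\<forall>a. (\<lambda>n. u n * a) \<longlonglongrightarrow> a \<and> (\<lambda>n. a * u n) \<longlonglongrightarrow> a))"

definition closed_ideal :: "'a::cstar_algebra set \<Rightarrow> bool"
  where "closed_ideal I \<longleftrightarrow> closed I \<and> 0 \<in> I \<and> (\<forall>x\<in>I. \<forall>y\<in>I. x + y \<in> I) \<and>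
    (\<forall>c. \<forall>x\<in>I. c *\<^sub>C x \<in> I) \<and> (\<forall>a. \<forall>x\<in>I. a * x \<in> I \<and> x * a \<in> I)"

definition simple_algebra :: "'a::cstar_algebra itself \<Rightarrow> bool"
  where "simple_algebra _ \<longleftrightarrow> (\<exists>a::'a. a \<noteq> 0) \<and>
    (\<forall>I :: 'a set. closed_ideal I \<longrightarrow> I = {0} \<or> I = UNIV)"

lemma scaleC_one [simp]: "1 *\<^sub>C (x::'a::cstar_algebra) = x"
  by (metis of_real_1 scaleR_one scaleR_scaleC)

lemma scaleC_zero_left [simp]: "0 *\<^sub>C (x::'a::cstar_algebra) = 0"
  by (metis of_real_0 scaleR_zero_left scaleR_scaleC)

lemma scaleC_zero_right [simp]: "c *\<^sub>C (0::'a::cstar_algebra) = 0"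
  by (metis add_cancel_right_right scaleC_add_right)

lemma scaleC_minus_right: "c *\<^sub>C (- x) = - (c *\<^sub>C (x::'a::cstar_algebra))"
  by (metis add.right_inverse add_eq_0_iff scaleC_add_right scaleC_zero_right)

lemma scaleC_diff_right: "c *\<^sub>C (x - y) = c *\<^sub>C x - c *\<^sub>C (y::'a::cstar_algebra)"
  by (metis add_diff_cancel diff_add_cancel scaleC_add_right)

lemma star_scaleR: "star (r *\<^sub>R x) = r *\<^sub>R star (x::'a::cstar_algebra)"
  by (simp add: scaleR_scaleC star_scaleC)

lemma star_zero [simp]: "star 0 = (0::'a::cstar_algebra)"
  by (metis star_scaleR scaleR_zero_left)

lemma star_diff: "star (x - y) = star x - star (y::'a::cstar_algebra)"
  by (metis add_diff_cancel diff_add_cancel star_add)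

lemma norm_star [simp]: "norm (star x) = norm (x::'a::cstar_algebra)"
proof -
  have *: "norm y \<le> norm (star y)" for y :: 'a
  proof (cases "y = 0")
    case False
    have "norm y * norm y \<le> norm (star y) * norm y"
      using norm_mult_ineq[of "star y" y] by (simp add: cstar_identity power2_eq_square)
    then show ?thesis using False by simp
  qed simp
  show ?thesis using *[of x] *[of "star x"] by (simp add: star_star)
qed

lemma norm_mult_star: "norm (x * star x) = (norm (x::'a::cstar_algebra))\<^sup>2"
  using cstar_identity[of "star x"] by (simp add: star_star)

lemma bounded_linear_star: "bounded_linear (star :: 'a::cstar_algebra \<Rightarrow> 'a)"
  by (rule bounded_linear_intro[of _ 1]) (auto simp: star_add star_scaleR)

lemma bounded_linear_scaleC: "bounded_linear (\<lambda>x::'a::cstar_algebra. c *\<^sub>C x)"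
  by (rule bounded_linear_intro[of _ "cmod c"])
     (auto simp: scaleC_add_right norm_scaleC scaleR_scaleC scaleC_scaleC mult.commute)


section \<open>Compact operators on a Hilbert space, and elementary algebras\<close>

text \<open>
  Hilbert spaces are carrier based, so that one can quantify over them inside a formula.
  The inner product is linear in its first argument.
\<close>

locale pre_hilbert_space =
  fixes H :: "'h set"
    and zero :: 'h
    and add :: "'h \<Rightarrow> 'h \<Rightarrow> 'h"
    and scale :: "complex \<Rightarrow> 'h \<Rightarrow> 'h"
    and ip :: "'h \<Rightarrow> 'h \<Rightarrow> complex"
  assumes zero_closed: "zero \<in> H"
    and add_closed: "\<lbrakk>x \<in> H; y \<in> H\<rbrakk> \<Longrightarrow> add x y \<in> H"
    and scale_closed: "x \<in> H \<Longrightarrow> scale c x \<in> H"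
    and add_assoc: "\<lbrakk>x \<in> H; y \<in> H; z \<in> H\<rbrakk> \<Longrightarrow> add (add x y) z = add x (add y z)"
    and add_commute: "\<lbrakk>x \<in> H; y \<in> H\<rbrakk> \<Longrightarrow> add x y = add y x"
    and add_zero: "x \<in> H \<Longrightarrow> add zero x = x"
    and scale_zero: "x \<in> H \<Longrightarrow> scale 0 x = zero"
    and scale_one: "x \<in> H \<Longrightarrow> scale 1 x = x"
    and scale_scale: "x \<in> H \<Longrightarrow> scale c (scale d x) = scale (c * d) x"
    and scale_add_left: "x \<in> H \<Longrightarrow> scale (c + d) x = add (scale c x) (scale d x)"
    and scale_add_right: "\<lbrakk>x \<in> H; y \<in> H\<rbrakk> \<Longrightarrow> scale c (add x y) = add (scale c x) (scale c y)"
    and ip_add_left: "\<lbrakk>x \<in> H; y \<in> H; z \<in> H\<rbrakk> \<Longrightarrow> ip (add x y) z = ip x z + ip y z"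
    and ip_scale_left: "\<lbrakk>x \<in> H; y \<in> H\<rbrakk> \<Longrightarrow> ip (scale c x) y = c * ip x y"
    and ip_cnj: "\<lbrakk>x \<in> H; y \<in> H\<rbrakk> \<Longrightarrow> ip y x = cnj (ip x y)"
    and ip_pos: "\<lbrakk>x \<in> H; x \<noteq> zero\<rbrakk> \<Longrightarrow> 0 < Re (ip x x)"
begin

definition hnorm :: "'h \<Rightarrow> real"
  where "hnorm x = sqrt (Re (ip x x))"

text \<open>The value 0 off the carrier is there because \<^locale>\<open>Metric_space\<close> requires a
  symmetric nonnegative function on the whole type.\<close>

definition hdist :: "'h \<Rightarrow> 'h \<Rightarrow> real"
  where "hdist x y = (if x \<in> H \<and> y \<in> H then hnorm (add x (scale (-1) y)) else 0)"

lemma ip_add_right: "\<lbrakk>x \<in> H; y \<in> H; z \<in> H\<rbrakk> \<Longrightarrow> ip x (add y z) = ip x y + ip x z"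
  by (metis add_closed complex_cnj_add ip_add_left ip_cnj)

lemma ip_scale_right: "\<lbrakk>x \<in> H; y \<in> H\<rbrakk> \<Longrightarrow> ip x (scale c y) = cnj c * ip x y"
  by (metis scale_closed complex_cnj_mult ip_scale_left ip_cnj)

lemma ip_zero: "x \<in> H \<Longrightarrow> ip zero x = 0" "x \<in> H \<Longrightarrow> ip x zero = 0"
  using ip_scale_left[of x x 0] ip_scale_right[of x x 0] by (simp_all add: scale_zero)

lemma ip_self: "x \<in> H \<Longrightarrow> ip x x = complex_of_real ((hnorm x)\<^sup>2)"
proof -
  assume x: "x \<in> H"
  have "Re (ip x x) \<ge> 0" using ip_pos[OF x] ip_zero[OF x] by (cases "x = zero") auto
  moreover have "Im (ip x x) = 0" using arg_cong[OF ip_cnj[OF x x], of Im] by simp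
  ultimately show ?thesis by (simp add: hnorm_def complex_eq_iff)
qed

lemma hnorm_nonneg: "x \<in> H \<Longrightarrow> 0 \<le> hnorm x"
  using ip_pos[of x] ip_zero[of x] by (cases "x = zero") (auto simp: hnorm_def)

lemma hnorm_eq_0: "x \<in> H \<Longrightarrow> hnorm x = 0 \<longleftrightarrow> x = zero"
  using ip_pos[of x] ip_zero[of x] by (cases "x = zero") (auto simp: hnorm_def)

lemma hnorm_scale: "x \<in> H \<Longrightarrow> hnorm (scale c x) = cmod c * hnorm x"
proof -
  assume x: "x \<in> H"
  have "ip (scale c x) (scale c x) = (c * cnj c) * ip x x"
    using x by (simp add: ip_scale_left ip_scale_right scale_closed)
  also have "\<dots> = complex_of_real ((cmod c * hnorm x)\<^sup>2)"
    by (simp only: ip_self[OF x] complex_norm_square[symmetric] of_real_mult[symmetric]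
        of_real_power[symmetric] power_mult_distrib)
  finally have "ip (scale c x) (scale c x) = complex_of_real ((cmod c * hnorm x)\<^sup>2)" .
  then have "(hnorm (scale c x))\<^sup>2 = (cmod c * hnorm x)\<^sup>2"
    using ip_self[OF scale_closed[OF x], of c] by (simp only: of_real_eq_iff)
  then show ?thesis
    using hnorm_nonneg x scale_closed by (simp add: power2_eq_iff_nonneg)
qed

lemma hnorm_add_sq:
  "\<lbrakk>x \<in> H; y \<in> H\<rbrakk> \<Longrightarrow> (hnorm (add x y))\<^sup>2 = (hnorm x)\<^sup>2 + (hnorm y)\<^sup>2 + 2 * Re (ip x y)"
proof -
  assume xy: "x \<in> H" "y \<in> H"
  have "complex_of_real ((hnorm (add x y))\<^sup>2) = ip (add x y) (add x y)"
    using xy by (simp add: ip_self add_closed)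
  also have "\<dots> = ip x x + ip x y + cnj (ip x y) + ip y y"
    using xy by (simp add: ip_add_left ip_add_right add_closed flip: ip_cnj)
  finally have "Re (complex_of_real ((hnorm (add x y))\<^sup>2)) = Re \<dots>" by (rule arg_cong)
  then show ?thesis using xy by (simp add: ip_self del: of_real_power)
qed

lemma cauchy_schwarz: "\<lbrakk>x \<in> H; y \<in> H\<rbrakk> \<Longrightarrow> cmod (ip x y) \<le> hnorm x * hnorm y"
proof (cases "y = zero")
  case False
  assume xy: "x \<in> H" "y \<in> H"
  define p where "p = ip x y"
  define c where "c = - p / complex_of_real ((hnorm y)\<^sup>2)"
  have n: "hnorm y > 0" using False xy hnorm_nonneg hnorm_eq_0 by (metis less_eq_real_def)
  have "0 \<le> (hnorm (add x (scale c y)))\<^sup>2" by simp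
  also have "\<dots> = (hnorm x)\<^sup>2 + (cmod c * hnorm y)\<^sup>2 + 2 * Re (cnj c * p)"
    using xy by (simp add: hnorm_add_sq scale_closed hnorm_scale ip_scale_right p_def)
  also have "cnj c * p = complex_of_real (- (cmod p)\<^sup>2 / (hnorm y)\<^sup>2)"
    by (simp add: c_def complex_norm_square mult.commute del: of_real_power)
  also have "(cmod c * hnorm y)\<^sup>2 = (cmod p)\<^sup>2 / (hnorm y)\<^sup>2"
    using n by (simp add: c_def norm_divide power_mult_distrib power_divide norm_power field_simps norm_mult power2_eq_square)
  finally have "(cmod p)\<^sup>2 / (hnorm y)\<^sup>2 \<le> (hnorm x)\<^sup>2" by simp
  then have "(cmod p)\<^sup>2 \<le> (hnorm x * hnorm y)\<^sup>2" using n by (simp add: field_simps)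
  then show ?thesis
    unfolding p_def by (rule power2_le_imp_le) (simp add: hnorm_nonneg xy)
qed (simp add: ip_zero hnorm_nonneg)

lemma hnorm_triangle: "\<lbrakk>x \<in> H; y \<in> H\<rbrakk> \<Longrightarrow> hnorm (add x y) \<le> hnorm x + hnorm y"
proof -
  assume xy: "x \<in> H" "y \<in> H"
  have "(hnorm (add x y))\<^sup>2 \<le> (hnorm x + hnorm y)\<^sup>2"
    using cauchy_schwarz[OF xy] complex_Re_le_cmod[of "ip x y"]
    by (simp add: hnorm_add_sq[OF xy] power2_sum)
  then show ?thesis
    by (rule power2_le_imp_le) (simp add: hnorm_nonneg xy)
qed

lemma add_minus: "x \<in> H \<Longrightarrow> add (scale (-1) x) x = zero"
  using scale_add_left[of x "-1" 1] by (simp add: scale_one scale_zero)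

lemma sub_add_sub:
  "\<lbrakk>x \<in> H; y \<in> H; z \<in> H\<rbrakk> \<Longrightarrow> add (add x (scale (-1) y)) (add y z) = add x z"
  by (metis add_assoc add_closed add_minus add_zero scale_closed)

sublocale hm: Metric_space H hdist
proof
  fix x y z
  have comm: "hdist u v \<le> hdist v u" for u v
  proof (cases "u \<in> H \<and> v \<in> H")
    case True
    then have "add u (scale (-1) v) = scale (-1) (add v (scale (-1) u))"
      by (simp add: scale_add_right scale_closed scale_scale scale_one add_commute)
    then show ?thesis using True by (simp add: hdist_def hnorm_scale add_closed scale_closed)
  qed (auto simp: hdist_def)
  show "hdist x y = hdist y x" by (rule antisym; rule comm)
  show "0 \<le> hdist x y" by (simp add: hdist_def hnorm_nonneg add_closed scale_closed)
  assume x: "x \<in> H" and y: "y \<in> H"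
  have "add x (scale (-1) y) = zero \<longleftrightarrow> x = y"
    using sub_add_sub[of x y zero] x y add_commute add_minus add_zero zero_closed scale_closed by metis
  then show "hdist x y = 0 \<longleftrightarrow> x = y"
    using x y by (simp add: hdist_def hnorm_eq_0 add_closed scale_closed)
  assume z: "z \<in> H"
  show "hdist x z \<le> hdist x y + hdist y z"
    using hnorm_triangle[of "add x (scale (-1) y)" "add y (scale (-1) z)"] x y z
    by (simp add: hdist_def sub_add_sub add_closed scale_closed)
qed

definition compact_operators :: "('h \<Rightarrow> 'h) set"
  where "compact_operators =
    {T \<in> H \<rightarrow>\<^sub>E H.
       (\<forall>x\<in>H. \<forall>y\<in>H. T (add x y) = add (T x) (T y)) \<and>
       (\<forall>c. \<forall>x\<in>H. T (scale c x) = scale c (T x)) \<and>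
       compactin hm.mtopology (hm.mtopology closure_of (T ` {x\<in>H. hnorm x \<le> 1}))}"

text \<open>The last clause says that \<open>\<pi>\<close> sends \<open>star\<close> to the Hilbert space adjoint.\<close>

definition iso_to_compact_operators :: "('a::cstar_algebra \<Rightarrow> 'h \<Rightarrow> 'h) \<Rightarrow> bool"
  where "iso_to_compact_operators \<pi> \<longleftrightarrow>
    bij_betw \<pi> UNIV compact_operators \<and>
    (\<forall>a b. \<forall>x\<in>H. \<pi> (a + b) x = add (\<pi> a x) (\<pi> b x)) \<and>
    (\<forall>c a. \<forall>x\<in>H. \<pi> (c *\<^sub>C a) x = scale c (\<pi> a x)) \<and>
    (\<forall>a b. \<forall>x\<in>H. \<pi> (a * b) x = \<pi> a (\<pi> b x)) \<and>
    (\<forall>a. \<forall>x\<in>H. \<forall>y\<in>H. ip (\<pi> a x) y = ip x (\<pi> (star a) y))"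

end

locale hilbert_space = pre_hilbert_space +
  assumes complete: "hm.mcomplete"

text \<open>
  In the next definition the carrier of the Hilbert space is a subset of the type \<open>'a\<close> of the
  algebra (with arbitrary operations). This is no restriction, because \<open>H\<close> embeds into the
  compact operators on \<open>H\<close> through rank-one operators: lemma \<open>elementaryI\<close> below covers
  Hilbert spaces over an arbitrary type.
\<close>

definition elementary :: "'a::cstar_algebra itself \<Rightarrow> bool"
  where "elementary _ \<longleftrightarrow>
    (\<exists>(H :: 'a set) zero add scale ip. hilbert_space H zero add scale ip \<and>
       (\<exists>\<pi> :: 'a \<Rightarrow> 'a \<Rightarrow> 'a.
          pre_hilbert_space.iso_to_compact_operators H add scale ip \<pi>))"

context pre_hilbert_space
begin

lemma rank_one_compact_operator:
  assumes "x \<in> H" "\<xi> \<in> H"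
  shows "restrict (\<lambda>y. scale (ip y \<xi>) x) H \<in> compact_operators"
proof -
  let ?T = "restrict (\<lambda>y. scale (ip y \<xi>) x) H"
  let ?K = "(\<lambda>c. scale c x) ` cball 0 (hnorm \<xi>)"
  have "continuous_map euclidean hm.mtopology (\<lambda>c. scale c x)"
    unfolding hm.continuous_map_to_metric
  proof (intro ballI allI impI)
    fix c :: complex and e :: real assume "e > 0"
    have d: "hdist (scale c x) (scale d x) = cmod (c - d) * hnorm x" for c d
      using assms(1) scale_add_left[of x c "- d"]
      by (simp add: hdist_def scale_closed scale_scale flip: hnorm_scale)
    have pos: "hnorm x + 1 > 0" using hnorm_nonneg[OF assms(1)] by simp
    have "hdist (scale c x) (scale d x) < e" if "d \<in> ball c (e / (hnorm x + 1))" for d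
    proof -
      have "cmod (c - d) * hnorm x \<le> cmod (c - d) * (hnorm x + 1)" by (simp add: algebra_simps)
      also have "\<dots> < e" using that pos by (simp add: dist_norm field_simps)
      finally show ?thesis by (simp add: d)
    qed
    then show "\<exists>U. openin euclidean U \<and> c \<in> U \<and> (\<forall>d\<in>U. scale d x \<in> hm.mball (scale c x) e)"
      using assms(1) pos \<open>e > 0\<close>
      by (intro exI[of _ "ball c (e / (hnorm x + 1))"]) (auto simp: scale_closed)
  qed
  then have K: "compactin hm.mtopology ?K"
    by (rule image_compactin[rotated]) simp
  have "cmod (ip y \<xi>) \<le> hnorm \<xi>" if "y \<in> H" "hnorm y \<le> 1" for y
    using cauchy_schwarz[of y \<xi>] that assms mult_right_mono[of "hnorm y" 1 "hnorm \<xi>"] hnorm_nonneg[of \<xi>]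
    by auto
  then have sub: "?T ` {y\<in>H. hnorm y \<le> 1} \<subseteq> ?K" by auto
  have "closedin hm.mtopology ?K"
    by (rule compactin_imp_closedin[OF hm.Hausdorff_space_mtopology K])
  with sub have "hm.mtopology closure_of (?T ` {y\<in>H. hnorm y \<le> 1}) \<subseteq> ?K"
    by (rule closure_of_minimal)
  then have "compactin hm.mtopology (hm.mtopology closure_of (?T ` {y\<in>H. hnorm y \<le> 1}))"
    by (rule closed_compactin[OF K]) simp
  then show ?thesis
    using assms unfolding compact_operators_def
    by (auto simp: scale_closed add_closed ip_add_left scale_add_left ip_scale_left scale_scale)
qed

end

lemma elementaryI:
  fixes H :: "'h set" and zero add scale ip and \<pi> :: "'a::cstar_algebra \<Rightarrow> 'h \<Rightarrow> 'h"
  assumes "hilbert_space H zero add scale ip"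
    and iso: "pre_hilbert_space.iso_to_compact_operators H add scale ip \<pi>"
  shows "elementary TYPE('a)"
proof -
  interpret hilbert_space H zero add scale ip by fact
  have bij: "bij_betw \<pi> UNIV compact_operators"
    using iso by (simp add: iso_to_compact_operators_def)
  obtain f :: "'h \<Rightarrow> 'a" where f: "inj_on f H"
  proof (cases "H = {zero}")
    case True
    then show ?thesis by (intro that[of "\<lambda>_. 0"]) auto
  next
    case False
    then obtain \<xi> where \<xi>: "\<xi> \<in> H" "\<xi> \<noteq> zero" using zero_closed by blast
    let ?T = "\<lambda>x. restrict (\<lambda>y. scale (ip y \<xi>) x) H"
    have "inj_on ?T H"
    proof (rule inj_onI)
      fix x y assume xy: "x \<in> H" "y \<in> H" and "?T x = ?T y"
      then have "scale (inverse (ip \<xi> \<xi>)) (?T x \<xi>) = scale (inverse (ip \<xi> \<xi>)) (?T y \<xi>)" by simp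
      moreover have "ip \<xi> \<xi> \<noteq> 0" using ip_pos[OF \<xi>] by auto
      ultimately show "x = y" using xy \<xi> by (simp add: scale_scale scale_one)
    qed
    moreover have "inj_on (inv_into UNIV \<pi>) (?T ` H)"
      by (rule inj_on_subset[OF inj_on_inv_into[of _ \<pi> UNIV]])
         (use bij \<xi> rank_one_compact_operator in \<open>auto simp: bij_betw_def\<close>)
    ultimately have "inj_on (inv_into UNIV \<pi> \<circ> ?T) H" by (rule comp_inj_on)
    then show ?thesis by (rule that)
  qed
  define g where "g = inv_into H f"
  define H' where "H' = f ` H"
  have gf [simp]: "g (f x) = x" if "x \<in> H" for x using f that by (simp add: g_def)
  have fg [simp]: "f (g u) = u" and gH [simp]: "g u \<in> H" if "u \<in> H'" for u
    using that by (auto simp: H'_def)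
  have fH [simp]: "f x \<in> H'" if "x \<in> H" for x using that by (simp add: H'_def)
  define add' where "add' u v = f (add (g u) (g v))" for u v
  define scale' where "scale' c u = f (scale c (g u))" for c u
  define ip' where "ip' u v = ip (g u) (g v)" for u v
  note defs = add'_def scale'_def ip'_def
  note closed = zero_closed add_closed scale_closed
  interpret K: pre_hilbert_space H' "f zero" add' scale' ip'
  proof
    show "0 < Re (ip' u u)" if "u \<in> H'" "u \<noteq> f zero" for u
      using that ip_pos[of "g u"] by (metis fg gH ip'_def)
    show "add' u v = add' v u" if "u \<in> H'" "v \<in> H'" for u v
      using that by (simp add: add'_def add_commute)
  qed (auto simp: defs closed add_assoc add_zero scale_zero scale_one scale_scale scale_add_left
      scale_add_right ip_add_left ip_scale_left intro: ip_cnj)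
  have hnorm': "K.hnorm (f x) = hnorm x" if "x \<in> H" for x
    using that by (simp add: K.hnorm_def hnorm_def ip'_def)
  have hdist': "K.hdist (f x) (f y) = hdist x y" if "x \<in> H" "y \<in> H" for x y
    using that by (simp add: K.hdist_def hdist_def hnorm' defs closed)
  interpret M12: Metric_space12 H hdist H' K.hdist ..
  have hom: "homeomorphic_map hm.mtopology K.hm.mtopology f"
    by (rule M12.isometry_imp_homeomorphic_map) (use hdist' in \<open>auto simp: H'_def\<close>)
  have "K.hm.mcomplete"
    unfolding K.hm.mcomplete_def
  proof (intro allI impI)
    fix \<sigma> assume \<sigma>: "K.hm.MCauchy \<sigma>"
    then have r: "\<sigma> n \<in> H'" for n by (auto simp: K.hm.MCauchy_def)
    have "hdist (g u) (g v) = K.hdist u v" if "u \<in> H'" "v \<in> H'" for u v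
      using that hdist'[of "g u" "g v"] by simp
    then have "hm.MCauchy (g \<circ> \<sigma>)"
      using \<sigma> r by (auto simp: hm.MCauchy_def K.hm.MCauchy_def)
    then obtain x where "limitin hm.mtopology (g \<circ> \<sigma>) x sequentially"
      using complete by (auto simp: hm.mcomplete_def)
    then have "limitin K.hm.mtopology (f \<circ> (g \<circ> \<sigma>)) (f x) sequentially"
      by (rule continuous_map_limit[OF homeomorphic_imp_continuous_map[OF hom]])
    moreover have "f \<circ> (g \<circ> \<sigma>) = \<sigma>" using r by auto
    ultimately show "\<exists>x. limitin K.hm.mtopology \<sigma> x sequentially" by auto
  qed
  then have hs: "hilbert_space H' (f zero) add' scale' ip'"
    by unfold_locales
  define \<Phi> where "\<Phi> T = restrict (\<lambda>u. f (T (g u))) H'" for T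
  have \<Phi>: "\<Phi> T \<in> K.compact_operators" if T: "T \<in> compact_operators" for T
  proof -
    have TH: "T x \<in> H" if "x \<in> H" for x using T that by (auto simp: compact_operators_def)
    have ball: "{u \<in> H'. K.hnorm u \<le> 1} = f ` {x \<in> H. hnorm x \<le> 1}"
      by (auto simp: H'_def hnorm')
    have im: "\<Phi> T ` {u \<in> H'. K.hnorm u \<le> 1} = f ` (T ` {x \<in> H. hnorm x \<le> 1})"
      unfolding ball image_image by (intro image_cong refl) (simp add: \<Phi>_def)
    have "compactin K.hm.mtopology (K.hm.mtopology closure_of (\<Phi> T ` {u \<in> H'. K.hnorm u \<le> 1}))"
      unfolding im using T TH
      by (subst homeomorphic_map_closure_of[OF hom])
         (auto simp: compact_operators_def closure_of_subset_topspace
            intro!: image_compactin[OF _ homeomorphic_imp_continuous_map[OF hom]])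
    then show ?thesis
      using T TH unfolding K.compact_operators_def compact_operators_def
      by (auto simp: \<Phi>_def defs closed)
  qed
  have surj: "S \<in> \<Phi> ` compact_operators" if S: "S \<in> K.compact_operators" for S
  proof -
    define T where "T = restrict (\<lambda>x. g (S (f x))) H"
    have SH: "S u \<in> H'" if "u \<in> H'" for u using S that by (auto simp: K.compact_operators_def)
    have add: "S (add' u v) = add' (S u) (S v)" and sc: "S (scale' c u) = scale' c (S u)"
      if "u \<in> H'" "v \<in> H'" for u v c using S that by (auto simp: K.compact_operators_def)
    have ball: "{u \<in> H'. K.hnorm u \<le> 1} = f ` {x \<in> H. hnorm x \<le> 1}"
      by (auto simp: H'_def hnorm')
    have im: "f ` (T ` {x \<in> H. hnorm x \<le> 1}) = S ` {u \<in> H'. K.hnorm u \<le> 1}"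
      unfolding ball image_image using SH by (intro image_cong refl) (simp add: T_def)
    have TH: "T ` {x \<in> H. hnorm x \<le> 1} \<subseteq> H" using SH by (auto simp: T_def)
    let ?C = "hm.mtopology closure_of (T ` {x \<in> H. hnorm x \<le> 1})"
    have "f ` ?C = K.hm.mtopology closure_of (S ` {u \<in> H'. K.hnorm u \<le> 1})"
      using homeomorphic_map_closure_of[OF hom, of "T ` {x \<in> H. hnorm x \<le> 1}"] TH im by simp
    then have "compactin K.hm.mtopology (f ` ?C)" using S by (simp add: K.compact_operators_def)
    then have "compactin hm.mtopology ?C"
      using homeomorphic_map_compactness[OF hom closure_of_subset_topspace] by blast
    moreover have "T (add x y) = add (T x) (T y)" "T (scale c x) = scale c (T x)"
      if "x \<in> H" "y \<in> H" for x y c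
      using that add[of "f x" "f y"] sc[of "f x" "f x" c] SH
      by (auto simp: T_def defs closed)
    ultimately have "T \<in> compact_operators"
      using SH unfolding compact_operators_def by (auto simp: T_def)
    moreover have "\<Phi> T = S"
      using S SH by (auto simp: \<Phi>_def T_def K.compact_operators_def fun_eq_iff PiE_def extensional_def)
    ultimately show ?thesis by blast
  qed
  have inj: "inj_on \<Phi> compact_operators"
  proof (rule inj_onI, rule ext)
    fix S T x assume S: "S \<in> compact_operators" and T: "T \<in> compact_operators" and eq: "\<Phi> S = \<Phi> T"
    show "S x = T x"
    proof (cases "x \<in> H")
      case True
      then have "S x \<in> H" "T x \<in> H" using S T by (auto simp: compact_operators_def)
      then show ?thesis using fun_cong[OF eq, of "f x"] True f by (auto simp: \<Phi>_def inj_on_def)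
    next
      case False
      then show ?thesis using S T by (auto simp: compact_operators_def PiE_def extensional_def)
    qed
  qed
  have "bij_betw \<Phi> compact_operators K.compact_operators"
    using inj \<Phi> surj by (auto simp: bij_betw_def)
  then have "bij_betw (\<Phi> \<circ> \<pi>) UNIV K.compact_operators"
    by (rule bij_betw_trans[OF bij])
  moreover have "\<pi> a x \<in> H" if "x \<in> H" for a x
    using that bij by (auto simp: bij_betw_def compact_operators_def)
  ultimately have "K.iso_to_compact_operators (\<Phi> \<circ> \<pi>)"
    using iso unfolding iso_to_compact_operators_def K.iso_to_compact_operators_def
    by (auto simp: \<Phi>_def defs closed)
  with hs show ?thesis unfolding elementary_def by blast
qed


section \<open>The multiplier algebra\<close>

text \<open>Double centralizers, as pairs of (left action, right action).\<close>

typedef (overloaded) 'a multiplier =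
  "{(L :: 'a::cstar_algebra \<Rightarrow>\<^sub>L 'a, R :: 'a \<Rightarrow>\<^sub>L 'a).
      (\<forall>c a. L (c *\<^sub>C a) = c *\<^sub>C L a \<and> R (c *\<^sub>C a) = c *\<^sub>C R a) \<and>
      (\<forall>a b. L (a * b) = L a * b \<and> R (a * b) = a * R b \<and> R a * b = a * L b)}"
  by (rule exI[of _ "(0, 0)"]) simp

setup_lifting type_definition_multiplier

text \<open>\<open>lact X a\<close> and \<open>ract X a\<close> are the elements \<open>X a\<close> and \<open>a X\<close> of the algebra.\<close>

definition lact :: "'a::cstar_algebra multiplier \<Rightarrow> 'a \<Rightarrow>\<^sub>L 'a"
  where "lact X = fst (Rep_multiplier X)"

definition ract :: "'a::cstar_algebra multiplier \<Rightarrow> 'a \<Rightarrow>\<^sub>L 'a"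
  where "ract X = snd (Rep_multiplier X)"

lemma multiplier_eqI: "\<lbrakk>\<And>a. lact X a = lact Y a; \<And>a. ract X a = ract Y a\<rbrakk> \<Longrightarrow> X = Y"
  by (auto simp: lact_def ract_def Rep_multiplier_inject[symmetric] prod_eq_iff intro: blinfun_eqI)

lemma
  shows lact_scaleC: "lact X (c *\<^sub>C a) = c *\<^sub>C lact X a"
    and ract_scaleC: "ract X (c *\<^sub>C a) = c *\<^sub>C ract X a"
    and lact_mult: "lact X (a * b) = lact X a * b"
    and ract_mult: "ract X (a * b) = a * ract X b"
    and ract_lact: "ract X a * b = a * lact X b"
  using Rep_multiplier[of X] by (auto simp: lact_def ract_def)

lift_definition scaleC_blinfun :: "complex \<Rightarrow> ('a::cstar_algebra \<Rightarrow>\<^sub>L 'a) \<Rightarrow> ('a \<Rightarrow>\<^sub>L 'a)"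
  is "\<lambda>c T a. c *\<^sub>C T a"
  by (rule bounded_linear_compose[OF bounded_linear_scaleC])

lift_definition star_blinfun :: "('a::cstar_algebra \<Rightarrow>\<^sub>L 'a) \<Rightarrow> ('a \<Rightarrow>\<^sub>L 'a)"
  is "\<lambda>T a. star (T (star a))"
  by (intro bounded_linear_compose[OF bounded_linear_star] bounded_linear_compose[OF _ bounded_linear_star])

declare scaleC_blinfun.rep_eq [simp] star_blinfun.rep_eq [simp]

text \<open>A multiplier is determined by its left action, with the same norm.\<close>

lemma norm_ract_eq_norm_lact: "norm (ract X) = norm (lact X)"
proof (rule antisym)
  show "norm (ract X) \<le> norm (lact X)"
  proof (rule norm_blinfun_bound)
    fix a :: 'a
    let ?y = "ract X a"
    have "norm ?y * norm ?y = norm (?y * star ?y)"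
      by (simp add: norm_mult_star power2_eq_square)
    also have "\<dots> = norm (a * lact X (star ?y))" by (simp add: ract_lact)
    also have "\<dots> \<le> norm a * norm (lact X (star ?y))" by (rule norm_mult_ineq)
    also have "\<dots> \<le> norm a * (norm (lact X) * norm ?y)"
      using norm_blinfun[of "lact X" "star ?y"] by (intro mult_left_mono) auto
    finally have "norm ?y * norm ?y \<le> (norm (lact X) * norm a) * norm ?y" by (simp add: ac_simps)
    then show "norm ?y \<le> norm (lact X) * norm a"
      by (cases "?y = 0") auto
  qed simp
  show "norm (lact X) \<le> norm (ract X)"
  proof (rule norm_blinfun_bound)
    fix a :: 'a
    let ?y = "lact X a"
    have "norm ?y * norm ?y = norm (star ?y * ?y)"
      by (simp add: cstar_identity power2_eq_square)
    also have "\<dots> = norm (ract X (star ?y) * a)" by (simp add: ract_lact)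
    also have "\<dots> \<le> norm (ract X (star ?y)) * norm a" by (rule norm_mult_ineq)
    also have "\<dots> \<le> (norm (ract X) * norm ?y) * norm a"
      using norm_blinfun[of "ract X" "star ?y"] by (intro mult_right_mono) auto
    finally have "norm ?y * norm ?y \<le> (norm (ract X) * norm a) * norm ?y" by (simp add: ac_simps)
    then show "norm ?y \<le> norm (ract X) * norm a"
      by (cases "?y = 0") auto
  qed simp
qed

instantiation multiplier :: (cstar_algebra) real_normed_algebra
begin

lift_definition zero_multiplier :: "'a multiplier" is "(0, 0)"
  by simp

lift_definition plus_multiplier :: "'a multiplier \<Rightarrow> 'a multiplier \<Rightarrow> 'a multiplier"
  is "\<lambda>X Y. (fst X + fst Y, snd X + snd Y)"
  by (auto simp: blinfun.add_left scaleC_add_right algebra_simps)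

lift_definition uminus_multiplier :: "'a multiplier \<Rightarrow> 'a multiplier"
  is "\<lambda>X. (- fst X, - snd X)"
  by (auto simp: blinfun.minus_left scaleC_minus_right)

lift_definition minus_multiplier :: "'a multiplier \<Rightarrow> 'a multiplier \<Rightarrow> 'a multiplier"
  is "\<lambda>X Y. (fst X - fst Y, snd X - snd Y)"
  by (auto simp: blinfun.diff_left scaleC_diff_right algebra_simps)

lift_definition scaleR_multiplier :: "real \<Rightarrow> 'a multiplier \<Rightarrow> 'a multiplier"
  is "\<lambda>r X. (r *\<^sub>R fst X, r *\<^sub>R snd X)"
  by (auto simp: blinfun.scaleR_left scaleR_scaleC scaleC_scaleC mult.commute mult_scaleC_left mult_scaleC_right)

lift_definition times_multiplier :: "'a multiplier \<Rightarrow> 'a multiplier \<Rightarrow> 'a multiplier"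
  is "\<lambda>X Y. (fst X o\<^sub>L fst Y, snd Y o\<^sub>L snd X)"
  by auto

definition norm_multiplier :: "'a multiplier \<Rightarrow> real"
  where "norm_multiplier X = norm (lact X)"

definition dist_multiplier :: "'a multiplier \<Rightarrow> 'a multiplier \<Rightarrow> real"
  where "dist_multiplier X Y = norm (X - Y)"

definition sgn_multiplier :: "'a multiplier \<Rightarrow> 'a multiplier"
  where "sgn_multiplier X = inverse (norm X) *\<^sub>R X"

definition uniformity_multiplier :: "('a multiplier \<times> 'a multiplier) filter"
  where "uniformity_multiplier = (INF e\<in>{0 <..}. principal {(X, Y). dist X Y < e})"

definition open_multiplier :: "'a multiplier set \<Rightarrow> bool"
  where "open_multiplier U = (\<forall>x\<in>U. eventually (\<lambda>(x', y). x' = x \<longrightarrow> y \<in> U) uniformity)"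

lemma lact_simps:
  "lact 0 = (0 :: 'a \<Rightarrow>\<^sub>L 'a)" "lact (X + Y) = lact X + lact (Y :: 'a multiplier)"
  "lact (X - Y) = lact X - lact Y" "lact (- X) = - lact X"
  "lact (r *\<^sub>R X) = r *\<^sub>R lact X"
  "lact (X * Y) = lact X o\<^sub>L lact Y"
  by (simp_all add: lact_def ract_def zero_multiplier.rep_eq plus_multiplier.rep_eq minus_multiplier.rep_eq
    uminus_multiplier.rep_eq scaleR_multiplier.rep_eq times_multiplier.rep_eq)

lemma ract_simps:
  "ract 0 = (0 :: 'a \<Rightarrow>\<^sub>L 'a)" "ract (X + Y) = ract X + ract (Y :: 'a multiplier)"
  "ract (X - Y) = ract X - ract Y" "ract (- X) = - ract X"
  "ract (r *\<^sub>R X) = r *\<^sub>R ract X"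
  "ract (X * Y) = ract Y o\<^sub>L ract X"
  by (simp_all add: lact_def ract_def zero_multiplier.rep_eq plus_multiplier.rep_eq minus_multiplier.rep_eq
    uminus_multiplier.rep_eq scaleR_multiplier.rep_eq times_multiplier.rep_eq)

lemma lact_inject: "lact X = lact Y \<Longrightarrow> X = (Y :: 'a multiplier)"
proof -
  assume "lact X = lact Y"
  then have "norm (ract (X - Y)) = 0"
    by (simp add: norm_ract_eq_norm_lact lact_simps)
  then show ?thesis using \<open>lact X = lact Y\<close>
    by (intro multiplier_eqI) (auto simp: ract_simps)
qed

instance
proof
  fix X Y Z :: "'a multiplier" and r s :: real
  note S = lact_simps blinfun.bilinear_simps algebra_simps
  show "X + Y + Z = X + (Y + Z)" "X + Y = Y + X" "0 + X = X" "- X + X = 0" "X - Y = X + - Y"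
    by (rule lact_inject; simp add: lact_simps)+
  show "r *\<^sub>R (X + Y) = r *\<^sub>R X + r *\<^sub>R Y" "(r + s) *\<^sub>R X = r *\<^sub>R X + s *\<^sub>R X"
    "r *\<^sub>R s *\<^sub>R X = (r * s) *\<^sub>R X" "1 *\<^sub>R X = X"
    by (rule lact_inject; simp add: lact_simps algebra_simps)+
  show "dist X Y = norm (X - Y)" "sgn X = inverse (norm X) *\<^sub>R X"
    by (simp_all add: dist_multiplier_def sgn_multiplier_def)
  show "uniformity = (INF e\<in>{0 <..}. principal {(X :: 'a multiplier, Y). dist X Y < e})"
    by (rule uniformity_multiplier_def)
  show "open U = (\<forall>x\<in>U. eventually (\<lambda>(x', y). x' = x \<longrightarrow> y \<in> U) uniformity)"
    for U :: "'a multiplier set" by (rule open_multiplier_def)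
  show "(norm X = 0) = (X = 0)"
    using lact_inject[of X 0] by (auto simp: norm_multiplier_def lact_simps)
  show "norm (X + Y) \<le> norm X + norm Y"
    by (simp add: norm_multiplier_def lact_simps norm_triangle_ineq)
  show "norm (r *\<^sub>R X) = \<bar>r\<bar> * norm X"
    by (simp add: norm_multiplier_def lact_simps)
  show "X * Y * Z = X * (Y * Z)" "(X + Y) * Z = X * Z + Y * Z" "X * (Y + Z) = X * Y + X * Z"
    "(r *\<^sub>R X) * Y = r *\<^sub>R (X * Y)" "X * (r *\<^sub>R Y) = r *\<^sub>R (X * Y)"
    by (rule lact_inject; rule blinfun_eqI; simp add: S)+
  show "norm (X * Y) \<le> norm X * norm Y"
    by (simp add: norm_multiplier_def lact_simps norm_blinfun_compose)
qed

end

instantiation multiplier :: (cstar_algebra) cstar_algebra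
begin

lift_definition scaleC_multiplier :: "complex \<Rightarrow> 'a multiplier \<Rightarrow> 'a multiplier"
  is "\<lambda>c X. (scaleC_blinfun c (fst X), scaleC_blinfun c (snd X))"
  by (auto simp: scaleC_scaleC mult.commute mult_scaleC_left mult_scaleC_right)

lift_definition star_multiplier :: "'a multiplier \<Rightarrow> 'a multiplier"
  is "\<lambda>X. (star_blinfun (snd X), star_blinfun (fst X))"
  by (auto simp: star_scaleC star_mult star_star) (metis star_mult star_star)

lemma lact_simps':
  "lact (c *\<^sub>C X) = scaleC_blinfun c (lact (X :: 'a multiplier))"
  "lact (star X) = star_blinfun (ract X)"
  by (simp_all add: lact_def ract_def scaleC_multiplier.rep_eq star_multiplier.rep_eq)

lemma ract_simps':
  "ract (c *\<^sub>C X) = scaleC_blinfun c (ract (X :: 'a multiplier))"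
  "ract (star X) = star_blinfun (lact X)"
  by (simp_all add: lact_def ract_def scaleC_multiplier.rep_eq star_multiplier.rep_eq)

instance
proof
  fix X Y Z :: "'a multiplier" and r s :: real and c d :: complex
  note S = lact_simps lact_simps' blinfun.bilinear_simps algebra_simps
  have norm_le: "norm (X * Y) \<le> norm X * norm Y" for X Y :: "'a multiplier"
    by (rule norm_mult_ineq)
  show "r *\<^sub>R X = complex_of_real r *\<^sub>C X"
    by (rule lact_inject; rule blinfun_eqI; simp add: S scaleR_scaleC)
  show "c *\<^sub>C (X + Y) = c *\<^sub>C X + c *\<^sub>C Y" "(c + d) *\<^sub>C X = c *\<^sub>C X + d *\<^sub>C X"
    "c *\<^sub>C d *\<^sub>C X = (c * d) *\<^sub>C X"
    "(c *\<^sub>C X) * Y = c *\<^sub>C (X * Y)" "X * (c *\<^sub>C Y) = c *\<^sub>C (X * Y)"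
    by (rule lact_inject; rule blinfun_eqI;
        simp add: S scaleC_add_right scaleC_add_left scaleC_scaleC lact_scaleC)+
  show "norm (c *\<^sub>C X) = cmod c * norm X"
  proof -
    have le: "norm (c *\<^sub>C X) \<le> cmod c * norm X" for c and X :: "'a multiplier"
      unfolding norm_multiplier_def lact_simps'
    proof (rule norm_blinfun_bound)
      fix a
      show "norm (scaleC_blinfun c (lact X) a) \<le> cmod c * norm (lact X) * norm a"
        using mult_left_mono[OF norm_blinfun[of "lact X" a], of "cmod c"]
        by (simp add: norm_scaleC mult.assoc)
    qed simp
    have *: "inverse c *\<^sub>C c *\<^sub>C X = X" if "c \<noteq> 0"
      using that by (intro lact_inject blinfun_eqI) (simp add: lact_simps' scaleC_scaleC)
    show ?thesis
    proof (cases "c = 0")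
      case True
      then show ?thesis using le[of 0 X] by (simp add: norm_multiplier_def)
    next
      case False
      from le[of "inverse c" "c *\<^sub>C X"] * False
      have "norm X \<le> inverse (cmod c) * norm (c *\<^sub>C X)" by (simp add: norm_inverse)
      then have "cmod c * norm X \<le> norm (c *\<^sub>C X)" using False by (simp add: field_simps)
      with le[of c X] show ?thesis by simp
    qed
  qed
  show "star (star X) = X" "star (X + Y) = star X + star Y"
    "star (c *\<^sub>C X) = cnj c *\<^sub>C star X" "star (X * Y) = star Y * star X"
    by (rule lact_inject; rule blinfun_eqI;
        simp add: lact_simps' ract_simps' lact_simps ract_simps blinfun.bilinear_simps star_star star_add star_scaleC)+
  show "norm (star X * X) = (norm X)\<^sup>2"
  proof (rule antisym)
    have "norm (star X) \<le> norm X"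
      unfolding norm_multiplier_def lact_simps'
    proof (rule norm_blinfun_bound)
      fix a show "norm (star_blinfun (ract X) a) \<le> norm (lact X) * norm a"
        using norm_blinfun[of "ract X" "star a"] by (simp add: norm_ract_eq_norm_lact)
    qed simp
    then have "norm (star X) * norm X \<le> norm X * norm X"
      by (intro mult_right_mono) (auto simp: norm_multiplier_def)
    with norm_le[of "star X" X] show "norm (star X * X) \<le> (norm X)\<^sup>2"
      by (simp add: power2_eq_square)
    have "norm (lact X) \<le> sqrt (norm (star X * X))"
    proof (rule norm_blinfun_bound)
      fix a :: 'a
      have "(norm (lact X a))\<^sup>2 = norm (star (lact X a) * lact X a)"
        by (simp add: cstar_identity)
      also have "star (lact X a) = ract (star X) (star a)"
        by (simp add: ract_simps' star_star)
      also have "norm (\<dots> * lact X a) = norm (star a * lact (star X * X) a)"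
        by (simp only: ract_lact) (simp add: lact_simps lact_simps')
      also have "\<dots> \<le> norm a * (norm (star X * X) * norm a)"
        unfolding norm_multiplier_def
        by (rule order_trans[OF norm_mult_ineq]) (auto intro!: mult_left_mono norm_blinfun)
      also have "\<dots> = (sqrt (norm (star X * X)) * norm a)\<^sup>2"
        by (simp add: power_mult_distrib norm_multiplier_def power2_eq_square)
      finally show "norm (lact X a) \<le> sqrt (norm (star X * X)) * norm a"
        by (rule power2_le_imp_le) (auto simp: norm_multiplier_def)
    qed (simp add: norm_multiplier_def)
    then have "(norm X)\<^sup>2 \<le> (sqrt (norm (star X * X)))\<^sup>2"
      unfolding norm_multiplier_def[of X] by (rule power_mono) simp
    then show "(norm X)\<^sup>2 \<le> norm (star X * X)"
      by (simp add: norm_multiplier_def)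
  qed
next
  fix X :: "nat \<Rightarrow> 'a multiplier"
  assume C: "Cauchy X"
  have dl: "dist (lact U) (lact V) = dist U V" and dr: "dist (ract U) (ract V) = dist U V"
    for U V :: "'a multiplier"
    by (simp_all add: dist_norm dist_multiplier_def norm_multiplier_def norm_ract_eq_norm_lact
          flip: lact_simps ract_simps)
  have "Cauchy (\<lambda>n. lact (X n))" "Cauchy (\<lambda>n. ract (X n))"
    using C unfolding Cauchy_def dl dr by auto
  then obtain L R where L: "(\<lambda>n. lact (X n)) \<longlonglongrightarrow> L" and R: "(\<lambda>n. ract (X n)) \<longlonglongrightarrow> R"
    by (meson Cauchy_convergent_iff convergent_def)
  have La: "(\<lambda>n. lact (X n) a) \<longlonglongrightarrow> L a" and Ra: "(\<lambda>n. ract (X n) a) \<longlonglongrightarrow> R a" for a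
    by (intro tendsto_intros L R)+
  note sc = bounded_linear.tendsto[OF bounded_linear_scaleC]
  have lims: "L (c *\<^sub>C a) = c *\<^sub>C L a" "R (c *\<^sub>C a) = c *\<^sub>C R a" "L (a * b) = L a * b"
    "R (a * b) = a * R b" "R a * b = a * L b" for a b c
    using La[of "c *\<^sub>C a"] Ra[of "c *\<^sub>C a"] La[of "a * b"] Ra[of "a * b"]
      sc[OF La[of a], of c] sc[OF Ra[of a], of c]
      tendsto_mult[OF La[of a] tendsto_const[of b]] tendsto_mult[OF tendsto_const[of a] Ra[of b]]
      tendsto_mult[OF Ra[of a] tendsto_const[of b]] tendsto_mult[OF tendsto_const[of a] La[of b]]
    by (auto simp: lact_scaleC ract_scaleC lact_mult ract_mult ract_lact intro: LIMSEQ_unique)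
  define Z where "Z = Abs_multiplier (L, R)"
  have "lact Z = L"
    unfolding Z_def lact_def by (subst Abs_multiplier_inverse) (auto simp: lims)
  then have "(\<lambda>n. dist (X n) Z) \<longlonglongrightarrow> 0"
    using L by (simp add: tendsto_dist_iff[of _ L] flip: dl)
  then have "X \<longlonglongrightarrow> Z" by (simp add: tendsto_dist_iff[of X])
  then show "convergent X" by (auto simp: convergent_def)
qed

end


lift_definition mult_embed :: "'a::cstar_algebra \<Rightarrow> 'a multiplier"
  is "\<lambda>a. (blinfun_mult_right a, blinfun_mult_left a)"
  by (auto simp: mult_scaleC_left mult_scaleC_right mult.assoc)

lemma mult_embed_apply [simp]: "lact (mult_embed a) b = a * b" "ract (mult_embed a) b = b * a"
  by (simp_all add: lact_def ract_def mult_embed.rep_eq)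

lemma mult_embed_sandwich: "mult_embed a * X * mult_embed b = mult_embed (a * lact X b)"
  by (rule lact_inject; rule blinfun_eqI) (simp add: lact_simps lact_mult mult.assoc)

text \<open>The strict topology is generated by the seminorms \<open>X \<mapsto> norm (X a)\<close> and
  \<open>X \<mapsto> norm (a X)\<close> for \<open>a\<close> in the algebra.\<close>

definition strict_topology :: "'a::cstar_algebra multiplier topology"
  where "strict_topology = topology_generated_by
    ({{X. norm (lact (X - Y) a) < e} | Y a e. 0 < e} \<union>
     {{X. norm (ract (X - Y) a) < e} | Y a e. 0 < e})"

lemma limitin_strict_topology:
  "limitin strict_topology X Y F \<longleftrightarrow>
     (\<forall>a. ((\<lambda>n. lact (X n) a) \<longlongrightarrow> lact Y a) F \<and> ((\<lambda>n. ract (X n) a) \<longlongrightarrow> ract Y a) F)"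
proof -
  let ?B = "{{X. norm (lact (X - Y) a) < e} | Y a e. 0 < e} \<union>
     {{X. norm (ract (X - Y) a) < e} | Y a e. 0 < e} :: 'a multiplier set set"
  have top: "topspace (strict_topology :: 'a multiplier topology) = UNIV"
  proof -
    have "{X. norm (lact (X - 0) 0) < (1::real)} \<in> ?B"
      by (rule UnI1, rule CollectI, rule exI[of _ 0], rule exI[of _ 0], rule exI[of _ 1]) simp
    moreover have "X \<in> {X. norm (lact (X - 0) 0) < (1::real)}" for X :: "'a multiplier" by simp
    ultimately have "\<Union>?B = UNIV" by blast
    then show ?thesis
      unfolding strict_topology_def topology_generated_by_topspace .
  qed
  show ?thesis
  proof
    assume lim: "limitin strict_topology X Y F"
    have ev: "eventually (\<lambda>n. X n \<in> U) F" if "U \<in> ?B" "Y \<in> U" for U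
      using lim topology_generated_by_Basis[OF that(1)] that(2)
      unfolding limitin_def strict_topology_def by blast
    show "\<forall>a. ((\<lambda>n. lact (X n) a) \<longlongrightarrow> lact Y a) F \<and> ((\<lambda>n. ract (X n) a) \<longlongrightarrow> ract Y a) F"
    proof (intro allI conjI tendstoI)
      fix a and e :: real assume "e > 0"
      have "{X. norm (lact (X - Y) a) < e} \<in> ?B"
        by (rule UnI1, rule CollectI, rule exI[of _ Y], rule exI[of _ a], rule exI[of _ e])
          (simp add: \<open>e > 0\<close>)
      from ev[OF this] \<open>e > 0\<close> show "\<forall>\<^sub>F n in F. dist (lact (X n) a) (lact Y a) < e"
        by (simp add: dist_norm lact_simps blinfun.diff_left)
      have "{X. norm (ract (X - Y) a) < e} \<in> ?B"
        by (rule UnI2, rule CollectI, rule exI[of _ Y], rule exI[of _ a], rule exI[of _ e])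
          (simp add: \<open>e > 0\<close>)
      from ev[OF this] \<open>e > 0\<close> show "\<forall>\<^sub>F n in F. dist (ract (X n) a) (ract Y a) < e"
        by (simp add: dist_norm ract_simps blinfun.diff_left)
    qed
  next
    assume R: "\<forall>a. ((\<lambda>n. lact (X n) a) \<longlongrightarrow> lact Y a) F \<and> ((\<lambda>n. ract (X n) a) \<longlongrightarrow> ract Y a) F"
    have "eventually (\<lambda>n. X n \<in> U) F" if "generate_topology_on ?B U" "Y \<in> U" for U
      using that
    proof (induction rule: generate_topology_on.induct)
      case (UN K)
      then obtain k where "k \<in> K" "Y \<in> k" by auto
      with UN.IH have "eventually (\<lambda>n. X n \<in> k) F" by blast
      then show ?case by (rule eventually_mono) (use \<open>k \<in> K\<close> in blast)
    next
      case (Basis U)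
      then consider Z a e where "U = {X. norm (lact (X - Z) a) < e}"
        | Z a e where "U = {X. norm (ract (X - Z) a) < e}" by blast
      then show ?case
      proof cases
        case 1
        then have "((\<lambda>n. norm (lact (X n) a - lact Z a)) \<longlongrightarrow> norm (lact Y a - lact Z a)) F"
          using R by (intro tendsto_norm tendsto_diff tendsto_const) auto
        from order_tendstoD(2)[OF this, of e] 1 Basis(2) show ?thesis
          by (auto simp: lact_simps blinfun.diff_left)
      next
        case 2
        then have "((\<lambda>n. norm (ract (X n) a - ract Z a)) \<longlongrightarrow> norm (ract Y a - ract Z a)) F"
          using R by (intro tendsto_norm tendsto_diff tendsto_const) auto
        from order_tendstoD(2)[OF this, of e] 2 Basis(2) show ?thesis
          by (auto simp: ract_simps blinfun.diff_left)
      qed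
    qed (auto simp: eventually_conj_iff)
    then show "limitin strict_topology X Y F"
      unfolding limitin_def top unfolding strict_topology_def openin_topology_generated_by_iff by simp
  qed
qed


section \<open>Cuntz subequivalence, thin and order dense sequences\<close>

text \<open>Meaningful for positive elements; positivity is imposed wherever it is used.\<close>

definition cuntz_le :: "'a::cstar_algebra \<Rightarrow> 'a \<Rightarrow> bool" (infix \<open>\<preceq>\<close> 50)
  where "a \<preceq> b \<longleftrightarrow> (\<exists>x :: nat \<Rightarrow> 'a. (\<lambda>n. norm (x n * b * star (x n) - a)) \<longlonglongrightarrow> 0)"

text \<open>All sequences are indexed from 0, also where the index conventionally starts at 1.\<close>

definition approximate_identity :: "(nat \<Rightarrow> 'a::cstar_algebra) \<Rightarrow> bool"
  where "approximate_identity e \<longleftrightarrow>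
    (\<forall>n. cpos (e n) \<and> norm (e n) \<le> 1) \<and>
    (\<forall>n. cle (e n) (e (Suc n)) \<and> e n \<noteq> e (Suc n)) \<and>
    (\<forall>n. e (Suc n) * e n = e n) \<and>
    (\<forall>a. (\<lambda>n. e n * a) \<longlonglongrightarrow> a \<and> (\<lambda>n. a * e n) \<longlonglongrightarrow> a)"

text \<open>The product \<open>(e m - e n) X (e m - e n)\<close> lies in the algebra and is formed there,
  see lemma \<open>mult_embed_sandwich\<close>.\<close>

definition K\<^sub>o :: "(nat \<Rightarrow> 'a::cstar_algebra) \<Rightarrow> 'a multiplier set"
  where "K\<^sub>o e = {X. cpos X \<and>
    (\<forall>a. cpos a \<and> a \<noteq> 0 \<longrightarrow>
       (\<exists>N. \<forall>m n. m > n \<and> n \<ge> N \<longrightarrow> (e m - e n) * lact X (e m - e n) \<preceq> a))}"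

definition order_dense :: "(nat \<Rightarrow> 'a::cstar_algebra) \<Rightarrow> bool"
  where "order_dense s \<longleftrightarrow> (\<forall>i. cpos (s i) \<and> s i \<noteq> 0) \<and>
    (\<forall>a. cpos a \<and> a \<noteq> 0 \<longrightarrow> (\<exists>n. s n \<preceq> a))"

definition thin :: "(nat \<Rightarrow> 'a::cstar_algebra) \<Rightarrow> bool"
  where "thin t \<longleftrightarrow> (\<forall>i. cpos (t i) \<and> t i \<noteq> 0) \<and> (\<forall>i j. i \<noteq> j \<longrightarrow> t i * t j = 0) \<and>
    (\<forall>a. cpos a \<and> a \<noteq> 0 \<longrightarrow> (\<exists>N. \<forall>m n. m \<ge> n \<and> n \<ge> N \<longrightarrow> (\<Sum>i=n..m. t i) \<preceq> a))"

end

theory Submission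
  imports Defs
begin

text \<open>
  Write \<open>X = Z* Z\<close> for an element of \<open>K\<^sub>o e\<close>. If \<open>(e m - e n) X (e m - e n) = 0\<close> whenever
  \<open>m > n \<ge> N\<close>, then \<open>Z = Z (e N)\<close>, so \<open>X\<close> is a positive element of the algebra; otherwise the nonzero ones among
  these compressions form an order dense sequence.

  Conversely, let \<open>s\<close> be order dense. By simplicity two nonzero positive elements always dominate a common
  nonzero one, and every nonzero positive \<open>b\<close> can be halved: there is \<open>c \<noteq> 0\<close> such that \<open>d \<preceq> c\<close> and \<open>d' \<preceq> c\<close>
  imply \<open>d + d' \<preceq> b\<close>. This gives \<open>c n\<close> below \<open>s 0, \<dots>, s n\<close> with \<open>c (n+1)\<close> halving \<open>c n\<close>.
  Elements \<open>d n \<preceq> c (n+1)\<close> of norm 1, cut out by the pairwise orthogonal \<open>e (2n+1) - e (2n)\<close>, are then thin, and their strict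
  sum \<open>D\<close> lies in \<open>K\<^sub>o e\<close> since a compression of \<open>D\<close> only sees finitely many \<open>d n\<close>.

  An element \<open>b\<close> can be halved as soon as \<open>x b y = 0\<close> for some \<open>x, y\<close> with \<open>x b \<noteq> 0 \<noteq> b y\<close>. If there are none,
  the functional calculus produces from \<open>b\<close> a projection \<open>p\<close> with \<open>p A p = \<complex> p\<close>, and \<open>A\<close> acts on the
  Hilbert space \<open>A p\<close> as the compact operators, i.e. \<open>A\<close> is elementary.
\<close>

text \<open>The algebra has no unit, so the functional calculus is built for C*-algebras with a unit
  and used in the multiplier algebra, which serves as the unitization. No spectrum is ever formed.
  Everything rests on one bound: the norm of p(a) is at most the supremum of |p| on the interval
  from -norm a to norm a. Facts about a spectrum become identities or estimates between functions on
  that interval, and \<open>fc abs a = a\<close> takes the place of a nonnegative spectrum. Since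
  positivity means star b * b, it is a theorem that the positive elements are closed; the norm
  closure in the first of the equivalent statements calls for it. Subequivalence is kept exact as
  long as possible: comparisons are equalities c = x * b * star x, at the price of passing from
  elements to their squares. The same device gives the positivity of \<open>D\<close>, which is the
  square of a self-adjoint multiplier.\<close>

section \<open>The involution and self-adjoint elements\<close>

lemma star_minus: "star (- x) = - star (x::'a::cstar_algebra)"
  using star_diff[of 0 x] by simp

lemma star_sum: "star (sum f A) = (\<Sum>x\<in>A. star (f x :: 'a::cstar_algebra))"
  by (induction A rule: infinite_finite_induct) (auto simp: star_add)

lemma scaleC_minus_left: "(- c) *\<^sub>C x = - (c *\<^sub>C (x::'a::cstar_algebra))"
  by (metis add.right_inverse add_eq_0_iff scaleC_add_left scaleC_zero_left)

lemma tendsto_star: "(f \<longlongrightarrow> l) F \<Longrightarrow> ((\<lambda>x. star (f x :: 'a::cstar_algebra)) \<longlongrightarrow> star l) F"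
  by (rule bounded_linear.tendsto[OF bounded_linear_star])

lemma tendsto_scaleC: "(f \<longlongrightarrow> l) F \<Longrightarrow> ((\<lambda>x. c *\<^sub>C (f x :: 'a::cstar_algebra)) \<longlongrightarrow> c *\<^sub>C l) F"
  by (rule bounded_linear.tendsto[OF bounded_linear_scaleC])

lemma star_mult_self_eq_0: "star x * x = 0 \<longleftrightarrow> (x::'a::cstar_algebra) = 0"
  using cstar_identity[of x] by auto

lemma mult_star_self_eq_0: "x * star x = 0 \<longleftrightarrow> (x::'a::cstar_algebra) = 0"
  using norm_mult_star[of x] by auto

definition sa :: "'a::cstar_algebra \<Rightarrow> bool"
  where "sa a \<longleftrightarrow> star a = a"

lemma sa_star: "sa a \<Longrightarrow> star a = a"
  by (simp add: sa_def)

lemma sa_intros: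
  "sa (0::'a::cstar_algebra)"
  "sa a \<Longrightarrow> sa b \<Longrightarrow> sa (a + b)"
  "sa a \<Longrightarrow> sa b \<Longrightarrow> sa (a - b)"
  "sa a \<Longrightarrow> sa (- a)"
  "sa a \<Longrightarrow> sa (r *\<^sub>R a)"
  "sa a \<Longrightarrow> sa (a * a)"
  "sa (star b * b)"
  "sa (b * star b)"
  by (simp_all add: sa_def star_add star_diff star_minus star_scaleR star_mult star_star)

lemma sa_cpos: "cpos a \<Longrightarrow> sa a"
  by (auto simp: cpos_def sa_intros)

lemma sa_square_eq_0: "sa x \<Longrightarrow> x * x = 0 \<longleftrightarrow> x = 0"
  using star_mult_self_eq_0[of x] by (simp add: sa_def)

lemma norm_sa_square: "sa x \<Longrightarrow> norm (x * x) = (norm x)\<^sup>2"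
  using cstar_identity[of x] by (simp add: sa_def)

lemma star_one [simp]: "star (1 :: 'b::{cstar_algebra,monoid_mult}) = 1"
  by (metis mult_1_left mult_1_right star_mult star_star)

lemma sa_one: "sa (1 :: 'b::{cstar_algebra,monoid_mult})"
  by (simp add: sa_def)

lemma norm_one_le: "norm (1 :: 'b::{cstar_algebra,monoid_mult}) \<le> 1"
  using cstar_identity[of "1::'b"] by (auto simp: power2_eq_square)

lemma star_power: "star (x ^ n) = star x ^ n" for x :: "'b::{cstar_algebra,monoid_mult}"
  by (induction n) (auto simp: star_mult power_commutes)

lemma norm_power_le: "norm x \<le> 1 \<Longrightarrow> norm (x ^ n) \<le> 1" for x :: "'b::{cstar_algebra,monoid_mult}"
proof (induction n)
  case (Suc n)
  then show ?case
    using norm_mult_ineq[of x "x ^ n"] mult_le_one[of "norm x" "norm (x ^ n)"] by simp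
qed (simp add: norm_one_le)

text \<open>The C*-identity iterated along squarings. It stands in for the spectral radius formula:
  estimates that are only good up to a slowly growing factor become sharp on taking roots of order
  2^n.\<close>

lemma norm_sa_power:
  fixes x :: "'b::{cstar_algebra,monoid_mult}"
  assumes "sa x"
  shows "norm (x ^ (2 ^ n)) = norm x ^ (2 ^ n)"
proof (induction n)
  case (Suc n)
  have "sa (x ^ (2 ^ n))" using assms by (simp add: sa_def star_power)
  from norm_sa_square[OF this] Suc show ?case
    by (simp add: power_add mult_2 power2_eq_square)
qed simp

section \<open>Polynomials in an element\<close>

text \<open>Horner's scheme, with complex coefficients acting as multiples of the unit and the
  argument in a noncommutative algebra.\<close>

definition ceval :: "complex poly \<Rightarrow> 'b::{cstar_algebra,monoid_mult} \<Rightarrow> 'b"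
  where "ceval p a = fold_coeffs (\<lambda>c x. c *\<^sub>C 1 + a * x) p 0"

lemma ceval_0 [simp]: "ceval 0 a = 0"
  by (simp add: ceval_def)

lemma ceval_pCons [simp]: "ceval (pCons c p) a = c *\<^sub>C 1 + a * ceval p a"
  by (cases "p = 0 \<and> c = 0") (auto simp: ceval_def)

lemma ceval_add: "ceval (p + q) a = ceval p a + ceval q a"
  by (induction p q rule: poly_induct2) (auto simp: scaleC_add_left algebra_simps)

lemma ceval_smult: "ceval (smult c p) a = c *\<^sub>C ceval p a"
  by (induction p) (auto simp: scaleC_add_right scaleC_scaleC mult_scaleC_right)

lemma ceval_diff: "ceval (p - q) a = ceval p a - ceval q a"
  using ceval_add[of "p - q" q a] by simp

lemma ceval_mult: "ceval (p * q) a = ceval p a * ceval q a"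
  by (induction p) (auto simp: ceval_add ceval_smult algebra_simps mult_scaleC_left)

lemma ceval_1 [simp]: "ceval 1 a = 1"
  by (simp add: one_pCons)

lemma ceval_power: "ceval (p ^ n) a = ceval p a ^ n"
  by (induction n) (auto simp: ceval_mult)

lemma ceval_monom: "ceval (monom c n) a = c *\<^sub>C a ^ n"
  by (induction n) (auto simp: monom_0 monom_Suc mult_scaleC_right)

lemma ceval_sum: "ceval (sum f A) a = (\<Sum>x\<in>A. ceval (f x) a)"
  by (induction A rule: infinite_finite_induct) (auto simp: ceval_add)

lemma ceval_altdef: "ceval p a = (\<Sum>i\<le>degree p. coeff p i *\<^sub>C a ^ i)"
  by (subst (1) poly_as_sum_of_monoms[symmetric]) (simp add: ceval_sum ceval_monom)

lemma ceval_pcompose: "ceval (pcompose p q) a = ceval p (ceval q a)"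
  by (induction p) (auto simp: pcompose_pCons ceval_add ceval_mult)

text \<open>Two uses: x = y gives commutation, and x = c * star c, y = star c * c carries the
  calculus from one of these products to the other.\<close>

lemma ceval_intertwine: "x * c = c * y \<Longrightarrow> ceval p x * c = c * ceval p y"
proof (induction p)
  case (pCons k p)
  have "x * (ceval p x * c) = c * (y * ceval p y)"
    using pCons by (simp flip: mult.assoc)
  then show ?case
    by (simp add: algebra_simps mult_scaleC_left mult_scaleC_right)
qed simp

lemma tendsto_ceval: "(f \<longlongrightarrow> l) F \<Longrightarrow> ((\<lambda>x. ceval p (f x)) \<longlongrightarrow> ceval p l) F"
  by (induction p) (auto intro!: tendsto_intros)

definition realpoly :: "complex poly \<Rightarrow> bool"
  where "realpoly p \<longleftrightarrow> (\<forall>i. coeff p i \<in> \<real>)"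

lemma realpoly_pCons [simp]: "realpoly (pCons c p) \<longleftrightarrow> c \<in> \<real> \<and> realpoly p"
  by (auto simp: realpoly_def coeff_pCons split: nat.splits)

lemma realpoly_0 [simp]: "realpoly 0"
  by (simp add: realpoly_def)

lemma realpoly_add: "realpoly p \<Longrightarrow> realpoly q \<Longrightarrow> realpoly (p + q)"
  and realpoly_diff: "realpoly p \<Longrightarrow> realpoly q \<Longrightarrow> realpoly (p - q)"
  by (auto simp: realpoly_def)

lemma realpoly_mult: "realpoly p \<Longrightarrow> realpoly q \<Longrightarrow> realpoly (p * q)"
  by (auto simp: realpoly_def coeff_mult)

lemma realpoly_pcompose: "realpoly p \<Longrightarrow> realpoly q \<Longrightarrow> realpoly (pcompose p q)"
  by (induction p) (auto simp: pcompose_pCons intro!: realpoly_add realpoly_mult)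

lemma star_ceval: "realpoly p \<Longrightarrow> sa a \<Longrightarrow> star (ceval p a) = ceval p a"
proof (induction p)
  case (pCons c p)
  then show ?case
    using ceval_intertwine[of a a a p]
    by (simp add: star_add star_mult star_scaleC sa_star Reals_cnj_iff)
qed simp

text \<open>Cauchy's estimate, with the contour integral replaced by the average over the M-th roots
  of unity. As M exceeds the degree, two exponents in range never differ by a nonzero multiple of M,
  so the average isolates a single coefficient.\<close>

lemma coeff_le_sup_circle:
  fixes p :: "complex poly"
  assumes B: "\<And>z. cmod z = 1 \<Longrightarrow> cmod (poly p z) \<le> B"
  shows "cmod (coeff p k) \<le> B"
proof (cases "k \<le> degree p")
  case True
  define M where "M = Suc (degree p)"
  define w where "w j = cis (2 * pi * real j / real M)" for j
  have M: "M > 0" by (simp add: M_def)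
  have w1: "cmod (w j) = 1" for j by (simp add: w_def)
  have orth: "(\<Sum>j<M. w j ^ i * cnj (w j) ^ k) = (if i = k then of_nat M else 0)" if "i \<le> degree p" for i
  proof (cases "i = k")
    case True
    have "w j ^ k * cnj (w j) ^ k = 1" for j
      using w1[of j] by (simp flip: power_mult_distrib complex_norm_square)
    then show ?thesis using True by simp
  next
    case False
    define z where "z = cis (2 * pi * (real i - real k) / real M)"
    have wz: "w j ^ i * cnj (w j) ^ k = z ^ j" for j
      unfolding w_def z_def cis_cnj Complex.DeMoivre cis_mult
      by (rule arg_cong[of _ _ cis]) (simp add: algebra_simps diff_divide_distrib)
    have "z ^ M = cis (2 * pi * (real i - real k))"
      using M unfolding z_def Complex.DeMoivre by simp
    also have "\<dots> = cis (2 * pi * of_int (int i - int k))" by simp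
    also have "\<dots> = 1" by (rule cis_multiple_2pi) simp
    finally have zM: "z ^ M = 1" .
    have "z \<noteq> 1"
    proof
      assume "z = 1"
      then have "cos (2 * pi * (real i - real k) / real M) = 1"
        unfolding z_def by (metis cis.sel(1) one_complex.sel(1))
      then obtain n :: int where "2 * pi * (real i - real k) / real M = of_int n * (2 * pi)"
        by (auto simp: cos_one_2pi_int)
      then have "real i - real k = of_int n * real M" using M by (simp add: nonzero_divide_eq_eq)
      then have "of_int (int i - int k) = (of_int (n * int M) :: real)" by simp
      then have *: "int i - int k = n * int M" by (simp only: of_int_eq_iff)
      have "\<bar>int i - int k\<bar> < int M" using that \<open>k \<le> degree p\<close> by (auto simp: M_def)
      then have "\<bar>n\<bar> * int M < 1 * int M" unfolding * by (simp add: abs_mult)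
      then have "\<bar>n\<bar> < 1" by (rule mult_right_less_imp_less) simp
      then have "n = 0" by simp
      with * False show False by simp
    qed
    then show ?thesis using False zM by (simp add: wz sum_gp_strict)
  qed
  have "(\<Sum>j<M. poly p (w j) * cnj (w j) ^ k)
      = (\<Sum>j<M. \<Sum>i\<le>degree p. coeff p i * (w j ^ i * cnj (w j) ^ k))"
    by (simp add: poly_altdef sum_distrib_right mult.assoc)
  also have "\<dots> = (\<Sum>i\<le>degree p. coeff p i * (\<Sum>j<M. w j ^ i * cnj (w j) ^ k))"
    by (subst sum.swap) (simp add: sum_distrib_left)
  also have "\<dots> = (\<Sum>i\<le>degree p. if i = k then coeff p i * of_nat M else 0)"
    by (intro sum.cong refl) (auto simp: orth)
  also have "\<dots> = coeff p k * of_nat M" using True by simp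
  finally have "cmod (coeff p k) * real M = cmod (\<Sum>j<M. poly p (w j) * cnj (w j) ^ k)"
    by (metis norm_mult norm_of_nat)
  also have "\<dots> \<le> (\<Sum>j<M. B)"
    by (rule order_trans[OF norm_sum], rule sum_mono) (use B w1 in \<open>simp add: norm_mult norm_power\<close>)
  finally show ?thesis using M by (simp add: mult.commute)
next
  case False
  have "0 \<le> B" using order_trans[OF norm_ge_zero B[of 1]] by simp
  with False show ?thesis by (simp add: coeff_eq_0)
qed

text \<open>A crude form of von Neumann's inequality: the triangle inequality over the coefficients
  loses a factor that is linear in the degree.\<close>

lemma norm_ceval_le_sup_circle:
  fixes u :: "'b::{cstar_algebra,monoid_mult}"
  assumes u: "norm u \<le> 1" and B: "\<And>z. cmod z = 1 \<Longrightarrow> cmod (poly p z) \<le> B" and N: "degree p \<le> N"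
  shows "norm (ceval p u) \<le> (real N + 1) * B"
proof -
  have B0: "0 \<le> B" using order_trans[OF norm_ge_zero B[of 1]] by simp
  have "norm (ceval p u) \<le> (\<Sum>i\<le>degree p. norm (coeff p i *\<^sub>C u ^ i))"
    unfolding ceval_altdef by (rule norm_sum)
  also have "\<dots> \<le> (\<Sum>i\<le>degree p. B)"
  proof (rule sum_mono)
    fix i
    show "norm (coeff p i *\<^sub>C u ^ i) \<le> B"
      using mult_mono[OF coeff_le_sup_circle[of p B i] norm_power_le[OF u, of i]] B B0
      by (simp add: norm_scaleC)
  qed
  also have "\<dots> \<le> (real N + 1) * B" using N B0 by (simp add: mult_right_mono)
  finally show ?thesis .
qed

section \<open>The continuous functional calculus of a self-adjoint element\<close>

text \<open>The binomial series of (1 - x)^(1/2) at x = a * a converges absolutely because norm x <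
  1, and Vandermonde's convolution for 1/2 + 1/2 = 1 leaves only the terms 1 and -x in its square.
  The purpose is the unitary a + i s, whose real part is a.\<close>

lemma ex_sqrt_one_minus_square:
  fixes a :: "'b::{cstar_algebra,monoid_mult}"
  assumes a: "sa a" "norm a < 1"
  obtains s where "sa s" "a * s = s * a" "a * a + s * s = 1"
proof -
  define x where "x = a * a"
  define c :: "nat \<Rightarrow> real" where "c n = (1/2 gchoose n) * (-1) ^ n" for n
  have nx: "norm x < 1"
    using norm_sa_square[OF a(1)] a(2) by (simp add: x_def power_less_one_iff)
  have nxn: "norm (x ^ n) \<le> norm x ^ n" for n
  proof (induction n)
    case (Suc n)
    then show ?case
      using norm_mult_ineq[of x "x ^ n"] mult_left_mono[of "norm (x ^ n)" "norm x ^ n" "norm x"] by simp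
  qed (simp add: norm_one_le)
  have "summable (\<lambda>n. norm (((1/2::real) gchoose n) * norm x ^ n))"
    using nx conv_radius_gchoose[of "1/2::real"]
    by (intro abs_summable_in_conv_radius) (auto split: if_splits simp: one_ereal_def)
  then have sum: "summable (\<lambda>n. norm (c n *\<^sub>R x ^ n))"
  proof (rule summable_comparison_test')
    fix n
    show "norm (norm (c n *\<^sub>R x ^ n)) \<le> norm (((1/2::real) gchoose n) * norm x ^ n)"
      using mult_left_mono[OF nxn[of n], of "\<bar>1/2 gchoose n :: real\<bar>"]
      by (simp add: c_def abs_mult power_abs)
  qed
  define s where "s = (\<Sum>n. c n *\<^sub>R x ^ n)"
  have sums: "(\<lambda>n. c n *\<^sub>R x ^ n) sums s"
    unfolding s_def by (rule summable_sums[OF summable_norm_cancel[OF sum]])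
  have ax: "a * x ^ n = x ^ n * a" for n
    by (rule power_commuting_commutes[symmetric]) (simp add: x_def mult.assoc)
  show thesis
  proof
    have "(\<lambda>n. star (c n *\<^sub>R x ^ n)) sums star s"
      by (rule bounded_linear.sums[OF bounded_linear_star sums])
    moreover have "star (c n *\<^sub>R x ^ n) = c n *\<^sub>R x ^ n" for n
      using a(1) by (simp add: star_scaleR star_power x_def star_mult sa_star)
    ultimately show "sa s" using sums sums_unique2 by (fastforce simp: sa_def)
    show "a * s = s * a"
      using sums_mult[OF sums, of a] sums_mult2[OF sums, of a] sums_unique2 by (simp add: ax)
    have "(\<lambda>k. \<Sum>i\<le>k. (c i *\<^sub>R x ^ i) * (c (k - i) *\<^sub>R x ^ (k - i))) sums (s * s)"
      unfolding s_def by (rule Cauchy_product_sums[OF sum sum])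
    moreover have "(\<Sum>i\<le>k. (c i *\<^sub>R x ^ i) * (c (k - i) *\<^sub>R x ^ (k - i)))
        = (if k = 0 then 1 else 0) + (if k = 1 then - x else 0)" for k
    proof -
      have "(\<Sum>i\<le>k. (c i *\<^sub>R x ^ i) * (c (k - i) *\<^sub>R x ^ (k - i))) = (\<Sum>i\<le>k. (c i * c (k - i)) *\<^sub>R x ^ k)"
        by (intro sum.cong refl) (simp flip: power_add)
      also have "\<dots> = (\<Sum>i\<le>k. c i * c (k - i)) *\<^sub>R x ^ k"
        by (simp add: scaleR_sum_left)
      also have "(\<Sum>i\<le>k. c i * c (k - i)) = (-1) ^ k * (\<Sum>i=0..k. (1/2 gchoose i) * (1/2 gchoose (k - i)))"
        unfolding sum_distrib_left atLeast0AtMost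
        by (intro sum.cong refl) (auto simp: c_def simp flip: power_add)
      also have "\<dots> = (-1) ^ k * (1 gchoose k)"
        by (simp add: gbinomial_Vandermonde)
      also have "(1 gchoose k :: real) = of_nat (1 choose k)"
        by (metis binomial_gbinomial of_nat_1)
      finally show ?thesis by (cases k; cases "k - 1") (auto simp: binomial_eq_0)
    qed
    moreover have "(\<lambda>k. (if k = 0 then 1 else 0) + (if k = 1 then - x else 0)) sums (1 + (- x))"
      by (intro sums_add sums_single[of _ "\<lambda>_. 1"] sums_single[of _ "\<lambda>_. - x"])
    ultimately have "s * s = 1 + (- x)" using sums_unique2 by force
    then show "a * a + s * s = 1" by (simp add: x_def)
  qed
qed

text \<open>If x = 1 + d with d > 0, Bernoulli's inequality gives growth that is only linear in 2^n;
  squaring it once more makes the growth quadratic, which beats the linear bound.\<close>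

lemma bounded_root_growth:
  fixes x D :: real
  assumes "0 \<le> x" "\<And>n. x ^ (2 ^ n) \<le> D * 2 ^ n + 1"
  shows "x \<le> 1"
proof (rule ccontr)
  assume "\<not> x \<le> 1"
  then have "x > 1" by simp
  define d where "d = x - 1"
  have d: "d > 0" "x = 1 + d" using \<open>x > 1\<close> by (auto simp: d_def)
  obtain n where n: "2 * D / d\<^sup>2 < 2 ^ n"
    using real_arch_pow[of 2 "2 * D / d\<^sup>2"] by auto
  have "1 + 2 ^ n * d \<le> x ^ (2 ^ n)"
    using Bernoulli_inequality[of d "2 ^ n"] d by simp
  then have "(1 + 2 ^ n * d)\<^sup>2 \<le> (x ^ (2 ^ n))\<^sup>2"
    using d by (intro power_mono) auto
  also have "\<dots> = x ^ (2 ^ Suc n)" by (simp add: mult.commute flip: power_mult)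
  also have "\<dots> \<le> D * 2 ^ Suc n + 1" by (rule assms(2))
  finally have "2 * (2 ^ n * d) + 2 ^ n * (2 ^ n * d\<^sup>2) \<le> 2 ^ n * (2 * D)"
    by (simp add: power2_eq_square algebra_simps)
  moreover have "2 ^ n * (2 * D) < 2 ^ n * (2 ^ n * d\<^sup>2)"
    using n d by (simp add: field_simps)
  moreover have "0 < 2 * (2 ^ n * d)" using d by simp
  ultimately have False by linarith
  then show False .
qed

text \<open>Substituting \<open>t = (z + 1/z)/2\<close> turns a polynomial in a self-adjoint contraction into one in a
  unitary, whose norm is at most the degree times the supremum. Since
  \<open>norm (h ^ 2 ^ n) = norm h ^ 2 ^ n\<close> for self-adjoint \<open>h\<close>, the factor disappears on passing
  to high powers.\<close>

lemma norm_ceval_le_strict: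
  fixes a :: "'b::{cstar_algebra,monoid_mult}"
  assumes a: "sa a" "norm a < 1" and p: "realpoly p"
    and B: "\<And>t. \<bar>t\<bar> \<le> 1 \<Longrightarrow> cmod (poly p (complex_of_real t)) \<le> B"
  shows "norm (ceval p a) \<le> B"
proof -
  obtain s where s: "sa s" "a * s = s * a" "a * a + s * s = 1"
    using ex_sqrt_one_minus_square[OF a] .
  define u where "u = a + \<i> *\<^sub>C s"
  have su: "star u = a - \<i> *\<^sub>C s"
    using s(1) a(1) by (simp add: u_def star_add star_scaleC sa_star scaleC_minus_left)
  have uu: "star u * u = 1"
    unfolding su unfolding u_def using s
    by (simp add: algebra_simps mult_scaleC_left mult_scaleC_right scaleC_scaleC scaleC_minus_left scaleC_diff_right scaleC_add_right)
  have uu': "u * star u = 1"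
    unfolding su unfolding u_def using s
    by (simp add: algebra_simps mult_scaleC_left mult_scaleC_right scaleC_scaleC scaleC_minus_left scaleC_diff_right scaleC_add_right)
  have two: "u + star u = 2 *\<^sub>R a" unfolding su by (simp add: u_def scaleR_2)
  have ua: "u * a = (1/2) *\<^sub>R (u * u + 1)"
  proof -
    have "2 *\<^sub>R (u * a) = u * u + 1"
      using arg_cong[OF two, of "\<lambda>x. u * x"] by (simp add: distrib_left uu')
    then have "(1/2) *\<^sub>R (2 *\<^sub>R (u * a)) = (1/2) *\<^sub>R (u * u + 1)" by simp
    then show ?thesis by simp
  qed
  have "norm u \<le> 1"
    using cstar_identity[of u] norm_one_le[where 'b='b] abs_square_le_1[of "norm u"] by (simp add: uu)
  then have nu: "norm u \<le> 1" "norm (star u) \<le> 1" by simp_all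
  \<comment> \<open>\<open>P\<close> is z^N q((z + 1/z)/2). The factor z^N clears the negative
    powers and has modulus 1 on the circle, where (z + 1/z)/2 is the real part of z.\<close>
  have lift: "\<exists>P. degree P \<le> 2 * N \<and> ceval P u = u ^ N * ceval q a \<and>
      (\<forall>z. cmod z = 1 \<longrightarrow> poly P z = z ^ N * poly q (complex_of_real (Re z)))" if "degree q \<le> N" for q N
    using that
  proof (induction q arbitrary: N)
    case 0
    then show ?case by (intro exI[of _ 0]) simp
  next
    case (pCons c q)
    show ?case
    proof (cases "q = 0")
      case True
      then show ?thesis
        by (intro exI[of _ "monom c N"])
           (auto simp: ceval_monom poly_monom mult_scaleC_right degree_monom_eq intro: order_trans[OF degree_monom_le])
    next
      case False
      with pCons.prems obtain M where M: "N = Suc M" "degree q \<le> M"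
        by (metis Suc_le_D degree_pCons_eq Suc_le_mono)
      from pCons.IH[OF M(2)] obtain P where P: "degree P \<le> 2 * M" "ceval P u = u ^ M * ceval q a"
        "\<And>z. cmod z = 1 \<Longrightarrow> poly P z = z ^ M * poly q (complex_of_real (Re z))" by blast
      \<comment> \<open>The factor (z^2 + 1)/2 is z times (z + 1/z)/2: multiplication by t together
        with one more power of z.\<close>
      let ?Q = "monom c N + [:1/2, 0, 1/2:] * P"
      have "degree ([:1/2, 0, 1/2:] * P) \<le> 2 * N"
        by (rule order_trans[OF degree_mult_le]) (use P(1) M in simp)
      then have "degree ?Q \<le> 2 * N"
        by (intro degree_add_le order_trans[OF degree_monom_le]) simp_all
      moreover have "ceval ?Q u = u ^ N * ceval (pCons c q) a"
      proof -
        have "ceval [:1/2, 0, 1/2:] u = u * a"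
          unfolding ua by (simp add: scaleR_scaleC scaleC_add_right mult_scaleC_right)
        then have "ceval ?Q u = c *\<^sub>C u ^ N + (u * a) * (u ^ M * ceval q a)"
          by (simp only: ceval_add ceval_mult ceval_monom P(2))
        also have "a * u = u * a" by (simp add: u_def algebra_simps mult_scaleC_left mult_scaleC_right s(2))
        then have "a * u ^ M = u ^ M * a" by (metis power_commuting_commutes)
        then have "(u * a) * (u ^ M * ceval q a) = u ^ N * (a * ceval q a)"
          by (simp add: M(1) mult.assoc) (simp flip: mult.assoc)
        finally show ?thesis by (simp add: distrib_left mult_scaleC_right)
      qed
      moreover have "poly ?Q z = z ^ N * poly (pCons c q) (complex_of_real (Re z))" if "cmod z = 1" for z
      proof -
        have "z * cnj z = 1" using that by (simp flip: complex_norm_square)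
        moreover have "2 * complex_of_real (Re z) = z + cnj z" by (simp add: complex_add_cnj)
        ultimately have "1/2 + z * (z * (1/2)) = z * complex_of_real (Re z)"
          by (simp add: field_simps)
        then have "poly [:1/2, 0, 1/2:] z = z * complex_of_real (Re z)" by simp
        then have "poly ?Q z = c * z ^ N + (z * complex_of_real (Re z)) * (z ^ M * poly q (complex_of_real (Re z)))"
          by (simp only: poly_add poly_mult poly_monom P(3)[OF that])
        then show ?thesis by (simp add: M(1) algebra_simps)
      qed
      ultimately show ?thesis by blast
    qed
  qed
  have step: "norm (ceval q a) \<le> (2 * real (degree q) + 1) * K"
    if K: "\<And>t. \<bar>t\<bar> \<le> 1 \<Longrightarrow> cmod (poly q (complex_of_real t)) \<le> K" for q K
  proof -
    let ?N = "degree q"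
    obtain P where P: "degree P \<le> 2 * ?N" "ceval P u = u ^ ?N * ceval q a"
        "\<And>z. cmod z = 1 \<Longrightarrow> poly P z = z ^ ?N * poly q (complex_of_real (Re z))"
      using lift[OF order_refl] by blast
    have uN: "star u ^ n * u ^ n = 1" for n
    proof (induction n)
      case (Suc n)
      have "star u ^ Suc n * u ^ Suc n = (star u ^ n * star u) * (u * u ^ n)"
        by (simp only: power_Suc2[of "star u"] power_Suc[of u])
      also have "\<dots> = star u ^ n * (star u * u) * u ^ n" by (simp only: mult.assoc)
      finally have "star u ^ Suc n * u ^ Suc n = star u ^ n * (star u * u) * u ^ n" .
      then show ?case using Suc uu by simp
    qed simp
    have "ceval q a = star u ^ ?N * ceval P u" by (simp add: P(2) uN flip: mult.assoc)
    then have "norm (ceval q a) \<le> norm (star u ^ ?N) * norm (ceval P u)"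
      by (simp add: norm_mult_ineq)
    also have "\<dots> \<le> 1 * norm (ceval P u)"
      by (rule mult_right_mono[OF norm_power_le[OF nu(2)]]) simp
    also have "norm (ceval P u) \<le> (real (2 * ?N) + 1) * K"
    proof (rule norm_ceval_le_sup_circle[OF nu(1) _ P(1)])
      fix z :: complex assume z: "cmod z = 1"
      have "\<bar>Re z\<bar> \<le> 1" using abs_Re_le_cmod[of z] z by simp
      then show "cmod (poly P z) \<le> K" using K[of "Re z"] z by (simp add: P(3) norm_mult norm_power)
    qed
    finally show ?thesis by simp
  qed
  have B0: "0 \<le> B" using order_trans[OF norm_ge_zero B[of 0]] by simp
  have *: "norm (ceval p a) ^ (2 ^ n) \<le> (2 * real (degree p) * 2 ^ n + 1) * K ^ (2 ^ n)" if "B \<le> K" for n K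
  proof -
    have "sa (ceval p a)" using star_ceval[OF p a(1)] by (simp add: sa_def)
    then have "norm (ceval p a) ^ (2 ^ n) = norm (ceval (p ^ (2 ^ n)) a)"
      by (simp add: ceval_power norm_sa_power)
    also have "\<dots> \<le> (2 * real (degree (p ^ (2 ^ n))) + 1) * K ^ (2 ^ n)"
      by (rule step) (use B that in \<open>auto simp: poly_power norm_power intro!: power_mono order_trans[OF B that]\<close>)
    also have "\<dots> \<le> (2 * real (degree p) * 2 ^ n + 1) * K ^ (2 ^ n)"
    proof (rule mult_right_mono)
      have "real (degree (p ^ (2 ^ n))) \<le> real (degree p * 2 ^ n)"
        using degree_power_le[of p "2 ^ n"] by (simp only: of_nat_le_iff)
      then show "2 * real (degree (p ^ (2 ^ n))) + 1 \<le> 2 * real (degree p) * 2 ^ n + 1" by simp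
    qed (use B0 that in simp)
    finally show ?thesis .
  qed
  \<comment> \<open>\<open>B\<close> may be 0, so the normalization divides by an arbitrary
    \<open>K\<close> above it.\<close>
  have "norm (ceval p a) \<le> K" if "B < K" for K
  proof -
    have K: "K > 0" using B0 that by simp
    have "norm (ceval p a) / K \<le> 1"
    proof (rule bounded_root_growth)
      fix n :: nat
      show "(norm (ceval p a) / K) ^ (2 ^ n) \<le> 2 * real (degree p) * 2 ^ n + 1"
        using *[of K n] that K by (simp add: power_divide divide_le_eq)
    qed (use K in simp)
    then show ?thesis using K by simp
  qed
  then show ?thesis by (rule dense_ge)
qed

text \<open>Substituting R t for t reduces to norm at most 1, and approximation by r b with r < 1
  reduces further to norm below 1. \<open>R = 0\<close> forces a = 0 and stands apart because of the
  division by R.\<close>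

lemma norm_ceval_le:
  fixes a :: "'b::{cstar_algebra,monoid_mult}"
  assumes a: "sa a" "norm a \<le> R" and p: "realpoly p"
    and B: "\<And>t. \<bar>t\<bar> \<le> R \<Longrightarrow> cmod (poly p (complex_of_real t)) \<le> B"
  shows "norm (ceval p a) \<le> B"
proof (cases "R = 0")
  case True
  then have "ceval p a = poly p 0 *\<^sub>C 1"
    using a(2) by (cases p) simp
  then show ?thesis
    using B[of 0] True norm_one_le[where 'b='b] mult_left_le[of "norm (1::'b)" "cmod (poly p 0)"]
    by (simp add: norm_scaleC)
next
  case False
  then have R: "R > 0" using a(2) norm_ge_zero[of a] by linarith
  define q where "q = pcompose p [:0, of_real R:]"
  have q: "realpoly q" using p by (auto simp: q_def intro!: realpoly_pcompose)
  have qB: "cmod (poly q (complex_of_real t)) \<le> B" if "\<bar>t\<bar> \<le> 1" for t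
    using B[of "t * R"] that R by (simp add: q_def poly_pcompose abs_mult)
  define b where "b = (1 / R) *\<^sub>R a"
  have nb: "norm b \<le> 1" using a(2) R by (simp add: b_def field_simps)
  have sb: "sa b" using a(1) by (simp add: b_def sa_intros)
  have "(\<lambda>n. (1 - inverse (real (Suc n))) *\<^sub>R b) \<longlonglongrightarrow> (1 - 0) *\<^sub>R b"
    by (intro tendsto_intros LIMSEQ_inverse_real_of_nat)
  then have "(\<lambda>n. ceval q ((1 - inverse (real (Suc n))) *\<^sub>R b)) \<longlonglongrightarrow> ceval q b"
    by (auto dest: tendsto_ceval)
  then have lim: "(\<lambda>n. norm (ceval q ((1 - inverse (real (Suc n))) *\<^sub>R b))) \<longlonglongrightarrow> norm (ceval q b)"
    by (rule tendsto_norm)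
  have "norm (ceval q b) \<le> B"
  proof (rule LIMSEQ_le_const2[OF lim], intro exI allI impI)
    fix n
    define r where "r = 1 - inverse (real (Suc n))"
    have r: "0 \<le> r" "r < 1" by (auto simp: r_def field_simps)
    have "norm (r *\<^sub>R b) < 1"
      using r nb mult_left_mono[OF nb r(1)] by simp
    then have "norm (ceval q (r *\<^sub>R b)) \<le> B"
      using sb q qB by (intro norm_ceval_le_strict) (auto simp: sa_intros)
    then show "norm (ceval q ((1 - inverse (real (Suc n))) *\<^sub>R b)) \<le> B" by (simp add: r_def)
  qed
  moreover have "ceval q b = ceval p a"
    using R by (simp add: q_def ceval_pcompose b_def mult_scaleC_right flip: scaleR_scaleC)
  ultimately show ?thesis by simp
qed

lemma ex_realpoly_near:
  fixes f :: "real \<Rightarrow> real"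
  assumes "continuous_on UNIV f" "e > 0"
  shows "\<exists>p. realpoly p \<and> (\<forall>t. \<bar>t\<bar> \<le> R \<longrightarrow> cmod (poly p (complex_of_real t) - complex_of_real (f t)) < e)"
proof -
  have "continuous_on {-R..R} f" using assms(1) continuous_on_subset by blast
  then obtain g where g: "real_polynomial_function g" "\<And>x. x \<in> {-R..R} \<Longrightarrow> \<bar>f x - g x\<bar> < e"
    using Stone_Weierstrass_real_polynomial_function[of "{-R..R}" f e] assms(2) by auto
  from g(1) obtain c n where c: "g = (\<lambda>x. \<Sum>i\<le>n::nat. c i * x ^ i)"
    by (auto simp: real_polynomial_function_iff_sum)
  let ?p = "\<Sum>i\<le>n. monom (complex_of_real (c i)) i"
  have "realpoly ?p" by (auto simp: realpoly_def coeff_sum intro!: sum_in_Reals)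
  moreover have "poly ?p (complex_of_real t) = complex_of_real (g t)" for t
    by (simp add: c poly_sum poly_monom)
  then have "cmod (poly ?p (complex_of_real t) - complex_of_real (f t)) < e" if "\<bar>t\<bar> \<le> R" for t
    using g(2)[of t] that by (simp add: abs_minus_commute abs_le_iff flip: of_real_diff)
  ultimately show ?thesis by blast
qed

text \<open>One sequence serves all elements at once: the interval [-n, n] and the precision 1/(n +
  1) improve together, so the convergence is uniform on every bounded interval.\<close>

definition approx_poly :: "(real \<Rightarrow> real) \<Rightarrow> nat \<Rightarrow> complex poly"
  where "approx_poly f n = (SOME p. realpoly p \<and>
    (\<forall>t. \<bar>t\<bar> \<le> real n \<longrightarrow> cmod (poly p (complex_of_real t) - complex_of_real (f t)) < inverse (real (Suc n))))"

definition fc :: "(real \<Rightarrow> real) \<Rightarrow> 'b::{cstar_algebra,monoid_mult} \<Rightarrow> 'b"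
  where "fc f a = lim (\<lambda>n. ceval (approx_poly f n) a)"

text \<open>The sequence \<open>p\<close> is left free because the sum or product of the chosen
  approximants of two functions need not be the chosen approximant of the sum or product.\<close>

definition papprox :: "real \<Rightarrow> (nat \<Rightarrow> complex poly) \<Rightarrow> (real \<Rightarrow> real) \<Rightarrow> bool"
  where "papprox R p f \<longleftrightarrow> (\<forall>n. realpoly (p n)) \<and>
    uniform_limit {-R..R} (\<lambda>n t. poly (p n) (complex_of_real t)) (\<lambda>t. complex_of_real (f t)) sequentially"

lemma papprox_approx_poly:
  assumes "continuous_on UNIV f"
  shows "papprox R (approx_poly f) f"
proof -
  have *: "realpoly (approx_poly f n) \<and> (\<forall>t. \<bar>t\<bar> \<le> real n \<longrightarrow>
      cmod (poly (approx_poly f n) (complex_of_real t) - complex_of_real (f t)) < inverse (real (Suc n)))" for n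
    unfolding approx_poly_def by (rule someI_ex[OF ex_realpoly_near[OF assms]]) simp
  show ?thesis
    unfolding papprox_def uniform_limit_iff
  proof (intro conjI allI impI)
    fix e :: real assume "e > 0"
    then obtain n0 where n0: "inverse (real (Suc n0)) < e" using reals_Archimedean by blast
    obtain n1 where n1: "R \<le> real n1" using real_arch_simple by blast
    show "\<forall>\<^sub>F n in sequentially. \<forall>t\<in>{-R..R}.
        dist (poly (approx_poly f n) (complex_of_real t)) (complex_of_real (f t)) < e"
      unfolding eventually_sequentially
    proof (intro exI allI impI ballI)
      fix n t assume n: "max n0 n1 \<le> n" and t: "t \<in> {-R..R}"
      have "inverse (real (Suc n)) \<le> inverse (real (Suc n0))" using n by (intro le_imp_inverse_le) auto
      moreover have "\<bar>t\<bar> \<le> real n" using t n n1 by auto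
      then have "cmod (poly (approx_poly f n) (complex_of_real t) - complex_of_real (f t)) < inverse (real (Suc n))"
        using *[of n] by blast
      ultimately show "dist (poly (approx_poly f n) (complex_of_real t)) (complex_of_real (f t)) < e"
        using n0 unfolding dist_norm by linarith
    qed
  qed (use * in blast)
qed

lemma papproxD:
  assumes "papprox R p f" "e > 0"
  shows "\<exists>N. \<forall>n\<ge>N. \<forall>t. \<bar>t\<bar> \<le> R \<longrightarrow> cmod (poly (p n) (complex_of_real t) - complex_of_real (f t)) < e"
proof -
  have "\<forall>\<^sub>F n in sequentially. \<forall>t\<in>{-R..R}. dist (poly (p n) (complex_of_real t)) (complex_of_real (f t)) < e"
    using assms unfolding papprox_def uniform_limit_iff by blast
  then obtain N where N: "\<And>n. n \<ge> N \<Longrightarrow> \<forall>t\<in>{-R..R}. dist (poly (p n) (complex_of_real t)) (complex_of_real (f t)) < e"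
    unfolding eventually_sequentially by blast
  show ?thesis
  proof (intro exI allI impI)
    fix n t assume n: "N \<le> n" and "\<bar>t\<bar> \<le> R"
    then have "t \<in> {-R..R}" by (simp add: abs_le_iff)
    then show "cmod (poly (p n) (complex_of_real t) - complex_of_real (f t)) < e"
      using N[OF n] by (simp add: dist_norm)
  qed
qed

text \<open>With p = q this is the Cauchy property behind \<open>fc\<close>; with p \<noteq> q it
  shows that the limit does not depend on the approximating sequence.\<close>

lemma papprox_ceval_close:
  fixes a :: "'b::{cstar_algebra,monoid_mult}"
  assumes "papprox R p f" "papprox R q f" "e > 0"
  shows "\<exists>N. \<forall>m\<ge>N. \<forall>n\<ge>N. \<forall>a::'b. sa a \<and> norm a \<le> R \<longrightarrow> norm (ceval (p m) a - ceval (q n) a) \<le> e"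
proof -
  obtain N1 N2 where N12: "\<And>n t. n \<ge> N1 \<Longrightarrow> \<bar>t\<bar> \<le> R \<Longrightarrow> cmod (poly (p n) (complex_of_real t) - complex_of_real (f t)) < e/2"
      "\<And>n t. n \<ge> N2 \<Longrightarrow> \<bar>t\<bar> \<le> R \<Longrightarrow> cmod (poly (q n) (complex_of_real t) - complex_of_real (f t)) < e/2"
    using papproxD[OF assms(1) half_gt_zero[OF assms(3)]] papproxD[OF assms(2) half_gt_zero[OF assms(3)]] by blast
  define N where "N = max N1 N2"
  have N: "cmod (poly (p n) (complex_of_real t) - complex_of_real (f t)) < e/2 \<and>
      cmod (poly (q n) (complex_of_real t) - complex_of_real (f t)) < e/2" if "n \<ge> N" "\<bar>t\<bar> \<le> R" for n t
    using N12 that by (simp add: N_def)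
  have "norm (ceval (p m) a - ceval (q n) a) \<le> e" if "m \<ge> N" "n \<ge> N" "sa a" "norm a \<le> R" for m n and a :: 'b
  proof -
    have "norm (ceval (p m - q n) a) \<le> e"
    proof (rule norm_ceval_le[OF that(3,4)])
      show "realpoly (p m - q n)" using assms by (auto simp: papprox_def realpoly_diff)
      fix t :: real assume t: "\<bar>t\<bar> \<le> R"
      show "cmod (poly (p m - q n) (complex_of_real t)) \<le> e"
        using N[OF that(1) t] N[OF that(2) t] norm_triangle_ineq4[of "poly (p m) (complex_of_real t) - complex_of_real (f t)"
            "poly (q n) (complex_of_real t) - complex_of_real (f t)"] by simp
    qed
    then show ?thesis by (simp add: ceval_diff)
  qed
  then show ?thesis by blast
qed

lemma tendsto_fc:
  fixes a :: "'b::{cstar_algebra,monoid_mult}"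
  assumes f: "continuous_on UNIV f" and p: "papprox R p f" and a: "sa a" "norm a \<le> R"
  shows "(\<lambda>n. ceval (p n) a) \<longlonglongrightarrow> fc f a"
proof -
  note q = papprox_approx_poly[OF f, of R]
  have "Cauchy (\<lambda>n. ceval (approx_poly f n) a)"
  proof (rule metric_CauchyI)
    fix e :: real assume "e > 0"
    then obtain N where "\<forall>m\<ge>N. \<forall>n\<ge>N. \<forall>a::'b. sa a \<and> norm a \<le> R \<longrightarrow>
        norm (ceval (approx_poly f m) a - ceval (approx_poly f n) a) \<le> e/2"
      using papprox_ceval_close[OF q q, of "e/2"] by auto
    then show "\<exists>M. \<forall>m\<ge>M. \<forall>n\<ge>M. dist (ceval (approx_poly f m) a) (ceval (approx_poly f n) a) < e"
      using a \<open>e > 0\<close> by (intro exI[of _ N]) (force simp: dist_norm)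
  qed
  then have L: "(\<lambda>n. ceval (approx_poly f n) a) \<longlonglongrightarrow> fc f a"
    unfolding fc_def by (simp add: Cauchy_convergent convergent_LIMSEQ_iff[symmetric])
  have "(\<lambda>n. ceval (p n) a - ceval (approx_poly f n) a) \<longlonglongrightarrow> 0"
  proof (rule LIMSEQ_I)
    fix e :: real assume "e > 0"
    then obtain N where "\<forall>m\<ge>N. \<forall>n\<ge>N. \<forall>a::'b. sa a \<and> norm a \<le> R \<longrightarrow>
        norm (ceval (p m) a - ceval (approx_poly f n) a) \<le> e/2"
      using papprox_ceval_close[OF p q, of "e/2"] by auto
    then show "\<exists>no. \<forall>n\<ge>no. norm (ceval (p n) a - ceval (approx_poly f n) a - 0) < e"
      using a \<open>e > 0\<close> by (intro exI[of _ N]) force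
  qed
  from tendsto_add[OF this L] show ?thesis by simp
qed

lemma norm_fc_le:
  fixes a :: "'b::{cstar_algebra,monoid_mult}"
  assumes f: "continuous_on UNIV f" and a: "sa a" "norm a \<le> R"
    and B: "\<And>t. \<bar>t\<bar> \<le> R \<Longrightarrow> \<bar>f t\<bar> \<le> B"
  shows "norm (fc f a) \<le> B"
proof (rule field_le_epsilon)
  fix e :: real assume e: "e > 0"
  note p = papprox_approx_poly[OF f, of R]
  obtain N where N: "\<And>n t. n \<ge> N \<Longrightarrow> \<bar>t\<bar> \<le> R \<Longrightarrow>
      cmod (poly (approx_poly f n) (complex_of_real t) - complex_of_real (f t)) < e"
    using papproxD[OF p e] by blast
  have "norm (ceval (approx_poly f n) a) \<le> B + e" if n: "n \<ge> N" for n
  proof (rule norm_ceval_le[OF a])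
    show "realpoly (approx_poly f n)" using p by (simp add: papprox_def)
    fix t assume t: "\<bar>t\<bar> \<le> R"
    have "cmod (complex_of_real (f t)) \<le> B" using B[OF t] by simp
    then show "cmod (poly (approx_poly f n) (complex_of_real t)) \<le> B + e"
      using N[OF n t] norm_triangle_sub[of "poly (approx_poly f n) (complex_of_real t)" "complex_of_real (f t)"]
      by linarith
  qed
  then have "\<forall>\<^sub>F n in sequentially. norm (ceval (approx_poly f n) a) \<le> B + e"
    by (auto simp: eventually_sequentially)
  then show "norm (fc f a) \<le> B + e"
    using tendsto_norm[OF tendsto_fc[OF f p a]] by (intro tendsto_upperbound) auto
qed

lemma fc_poly:
  fixes a :: "'b::{cstar_algebra,monoid_mult}"
  assumes a: "sa a" and p: "realpoly p" and f: "\<And>t. poly p (complex_of_real t) = complex_of_real (f t)"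
  shows "fc f a = ceval p a"
proof -
  have "f = (\<lambda>t. Re (poly p (complex_of_real t)))" using f by (auto simp: fun_eq_iff)
  then have c: "continuous_on UNIV f" by (auto intro!: continuous_intros)
  have "papprox (norm a) (\<lambda>_. p) f"
    using p by (simp add: papprox_def f uniform_limit_iff)
  from tendsto_fc[OF c this a] show ?thesis by (simp add: LIMSEQ_const_iff)
qed

lemma fc_ident: "sa a \<Longrightarrow> fc (\<lambda>t. t) a = (a :: 'b::{cstar_algebra,monoid_mult})"
  by (subst fc_poly[of a "[:0, 1:]"]) auto

lemma fc_const: "sa a \<Longrightarrow> fc (\<lambda>t. c) a = c *\<^sub>R (1 :: 'b::{cstar_algebra,monoid_mult})"
  by (subst fc_poly[of a "[:of_real c:]"]) (auto simp: scaleR_scaleC)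

lemma fc_add:
  fixes a :: "'b::{cstar_algebra,monoid_mult}"
  assumes f: "continuous_on UNIV f" and g: "continuous_on UNIV g" and a: "sa a"
  shows "fc (\<lambda>t. f t + g t) a = fc f a + fc g a"
proof -
  have c: "continuous_on UNIV (\<lambda>t. f t + g t)" using f g by (intro continuous_intros)
  note pf = papprox_approx_poly[OF f, of "norm a"] and pg = papprox_approx_poly[OF g, of "norm a"]
  have "papprox (norm a) (\<lambda>n. approx_poly f n + approx_poly g n) (\<lambda>t. f t + g t)"
    using pf pg by (auto simp: papprox_def realpoly_add intro!: uniform_limit_add)
  from tendsto_fc[OF c this a]
  have "(\<lambda>n. ceval (approx_poly f n) a + ceval (approx_poly g n) a) \<longlonglongrightarrow> fc (\<lambda>t. f t + g t) a"
    by (simp add: ceval_add)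
  moreover have "(\<lambda>n. ceval (approx_poly f n) a + ceval (approx_poly g n) a) \<longlonglongrightarrow> fc f a + fc g a"
    by (intro tendsto_add tendsto_fc[OF f pf a] tendsto_fc[OF g pg a]) simp_all
  ultimately show ?thesis by (rule LIMSEQ_unique)
qed

lemma fc_mult:
  fixes a :: "'b::{cstar_algebra,monoid_mult}"
  assumes f: "continuous_on UNIV f" and g: "continuous_on UNIV g" and a: "sa a"
  shows "fc (\<lambda>t. f t * g t) a = fc f a * fc g a"
proof -
  have c: "continuous_on UNIV (\<lambda>t. f t * g t)" using f g by (intro continuous_intros)
  note pf = papprox_approx_poly[OF f, of "norm a"] and pg = papprox_approx_poly[OF g, of "norm a"]
  have bdd: "bounded ((\<lambda>t. complex_of_real (h t)) ` {- norm a..norm a})" if "continuous_on UNIV h" for h :: "real \<Rightarrow> real"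
    using that by (intro compact_imp_bounded compact_continuous_image continuous_intros)
      (auto intro: continuous_on_subset)
  have "papprox (norm a) (\<lambda>n. approx_poly f n * approx_poly g n) (\<lambda>t. f t * g t)"
    using pf pg by (auto simp: papprox_def realpoly_mult intro!: uniform_lim_mult bdd f g)
  from tendsto_fc[OF c this a]
  have "(\<lambda>n. ceval (approx_poly f n) a * ceval (approx_poly g n) a) \<longlonglongrightarrow> fc (\<lambda>t. f t * g t) a"
    by (simp add: ceval_mult)
  moreover have "(\<lambda>n. ceval (approx_poly f n) a * ceval (approx_poly g n) a) \<longlonglongrightarrow> fc f a * fc g a"
    by (intro tendsto_mult tendsto_fc[OF f pf a] tendsto_fc[OF g pg a]) simp_all
  ultimately show ?thesis by (rule LIMSEQ_unique)
qed

lemma fc_scale: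
  fixes a :: "'b::{cstar_algebra,monoid_mult}"
  assumes "continuous_on UNIV f" "sa a"
  shows "fc (\<lambda>t. c * f t) a = c *\<^sub>R fc f a"
  using fc_mult[of "\<lambda>_. c" f a] assms by (simp add: fc_const)

lemma fc_diff:
  fixes a :: "'b::{cstar_algebra,monoid_mult}"
  assumes "continuous_on UNIV f" "continuous_on UNIV g" "sa a"
  shows "fc (\<lambda>t. f t - g t) a = fc f a - fc g a"
  using fc_add[of f "\<lambda>t. (-1) * g t" a] fc_scale[of g a "-1"] assms
  by (simp add: continuous_on_minus)

lemma fc_cong:
  fixes a :: "'b::{cstar_algebra,monoid_mult}"
  assumes "continuous_on UNIV f" "continuous_on UNIV g" "sa a"
    and "\<And>t. \<bar>t\<bar> \<le> norm a \<Longrightarrow> f t = g t"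
  shows "fc f a = fc g a"
proof -
  have "norm (fc (\<lambda>t. f t - g t) a) \<le> 0"
    using assms by (intro norm_fc_le[OF _ assms(3) order_refl] continuous_intros) auto
  then show ?thesis using fc_diff[OF assms(1-3)] by simp
qed

lemma sa_fc:
  fixes a :: "'b::{cstar_algebra,monoid_mult}"
  assumes f: "continuous_on UNIV f" and a: "sa a"
  shows "sa (fc f a)"
proof -
  note p = papprox_approx_poly[OF f, of "norm a"]
  have L: "(\<lambda>n. ceval (approx_poly f n) a) \<longlonglongrightarrow> fc f a" by (rule tendsto_fc[OF f p a order_refl])
  moreover have "star (ceval (approx_poly f n) a) = ceval (approx_poly f n) a" for n
    using p a by (intro star_ceval) (simp_all add: papprox_def)
  ultimately show ?thesis using tendsto_star[OF L] LIMSEQ_unique by (simp add: sa_def)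
qed

lemma fc_intertwine:
  fixes x y c :: "'b::{cstar_algebra,monoid_mult}"
  assumes f: "continuous_on UNIV f" and "sa x" "sa y" "x * c = c * y"
  shows "fc f x * c = c * fc f y"
proof -
  have "(\<lambda>n. ceval (approx_poly f n) x * c) \<longlonglongrightarrow> fc f x * c"
    by (intro tendsto_mult tendsto_const tendsto_fc[OF f papprox_approx_poly[OF f]]) (use assms in auto)
  moreover have "(\<lambda>n. c * ceval (approx_poly f n) y) \<longlonglongrightarrow> c * fc f y"
    by (intro tendsto_mult tendsto_const tendsto_fc[OF f papprox_approx_poly[OF f]]) (use assms in auto)
  ultimately show ?thesis
    using ceval_intertwine[OF assms(4)] by (simp add: LIMSEQ_unique)
qed

text \<open>For polynomial f this is an induction using the sum and product rules. For general f, a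
  polynomial close to f on [-S, S] suffices, where S bounds g on the interval of \<open>a\<close>
  and hence also the norm of \<open>fc g a\<close>.\<close>

lemma fc_compose:
  fixes a :: "'b::{cstar_algebra,monoid_mult}"
  assumes f: "continuous_on UNIV f" and g: "continuous_on UNIV g" and a: "sa a"
  shows "fc f (fc g a) = fc (\<lambda>t. f (g t)) a"
proof -
  have "compact (g ` {- norm a..norm a})"
    using g by (intro compact_continuous_image) (auto intro: continuous_on_subset)
  then have "bounded (g ` {- norm a..norm a})" by (rule compact_imp_bounded)
  then obtain S where "\<forall>y\<in>g ` {- norm a..norm a}. norm y \<le> S" unfolding bounded_iff by blast
  then have S: "\<bar>g t\<bar> \<le> S" if "t \<in> {- norm a..norm a}" for t using that by auto
  have nS: "norm (fc g a) \<le> S" by (rule norm_fc_le[OF g a order_refl], rule S) (auto simp: abs_le_iff)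
  define p where "p = approx_poly f"
  have p: "papprox S p f" unfolding p_def by (rule papprox_approx_poly[OF f])
  then have rp: "realpoly (p n)" for n by (simp add: papprox_def)
  have polyc: "continuous_on UNIV (\<lambda>t. Re (poly q (complex_of_real (g t))))" for q
    using g by (intro continuous_intros)
  have ev: "ceval q (fc g a) = fc (\<lambda>t. Re (poly q (complex_of_real (g t)))) a" if "realpoly q" for q
    using that
  proof (induction q)
    case 0
    then show ?case by (simp add: fc_const a)
  next
    case (pCons c q)
    then obtain r where r: "c = of_real r" by (auto simp: Reals_def)
    have "(\<lambda>t. Re (poly (pCons c q) (complex_of_real (g t)))) = (\<lambda>t. r + g t * Re (poly q (complex_of_real (g t))))"
      by (simp add: r)
    then show ?case
      using pCons by (simp add: fc_add fc_mult fc_const a g polyc r scaleR_scaleC continuous_on_mult)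
  qed
  have "(\<lambda>n. ceval (p n) (fc g a)) \<longlonglongrightarrow> fc f (fc g a)"
    by (rule tendsto_fc[OF f p sa_fc[OF g a] nS])
  moreover have "(\<lambda>n. ceval (p n) (fc g a)) \<longlonglongrightarrow> fc (\<lambda>t. f (g t)) a"
  proof (rule LIMSEQ_I)
    fix e :: real assume e: "e > 0"
    obtain N where N: "\<And>n t. n \<ge> N \<Longrightarrow> \<bar>t\<bar> \<le> S \<Longrightarrow>
        cmod (poly (p n) (complex_of_real t) - complex_of_real (f t)) < e/2"
      using papproxD[OF p half_gt_zero[OF e]] by blast
    have cf: "continuous_on UNIV (\<lambda>t. f (g t))"
      using continuous_on_compose[OF g continuous_on_subset[OF f subset_UNIV]] by (simp add: o_def)
    have "norm (ceval (p n) (fc g a) - fc (\<lambda>t. f (g t)) a) \<le> e/2" if "n \<ge> N" for n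
    proof -
      have "norm (fc (\<lambda>t. Re (poly (p n) (complex_of_real (g t))) - f (g t)) a) \<le> e/2"
      proof (rule norm_fc_le[OF _ a order_refl])
        show "continuous_on UNIV (\<lambda>t. Re (poly (p n) (complex_of_real (g t))) - f (g t))"
          by (intro continuous_on_diff polyc cf)
        fix t assume "\<bar>t\<bar> \<le> norm a"
        then have "\<bar>g t\<bar> \<le> S" using S[of t] by (auto simp: abs_le_iff)
        from N[OF that this] abs_Re_le_cmod[of "poly (p n) (complex_of_real (g t)) - complex_of_real (f (g t))"]
        show "\<bar>Re (poly (p n) (complex_of_real (g t))) - f (g t)\<bar> \<le> e/2" by simp
      qed
      then show ?thesis by (simp add: ev[OF rp] fc_diff polyc cf a)
    qed
    then show "\<exists>no. \<forall>n\<ge>no. norm (ceval (p n) (fc g a) - fc (\<lambda>t. f (g t)) a) < e"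
      using e by (intro exI[of _ N]) force
  qed
  ultimately show ?thesis by (rule LIMSEQ_unique)
qed

text \<open>An e/3 argument: a single polynomial is close to f on an interval [-R, R] that covers
  all x n and their limit, and polynomials are continuous in the element.\<close>

lemma tendsto_fc_element:
  fixes a :: "'b::{cstar_algebra,monoid_mult}"
  assumes f: "continuous_on UNIV f" and x: "\<And>n. sa (x n)" and lim: "x \<longlonglongrightarrow> a" and a: "sa a"
  shows "(\<lambda>n. fc f (x n)) \<longlonglongrightarrow> fc f a"
proof (rule LIMSEQ_I)
  fix e :: real assume e: "e > 0"
  obtain R where R: "\<And>n. norm (x n) \<le> R"
    using lim[THEN convergentI, THEN convergent_imp_Bseq] by (auto simp: Bseq_def)
  then have aR: "norm a \<le> R" using tendsto_norm[OF lim] by (intro LIMSEQ_le_const2) auto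
  obtain p where p: "realpoly p"
      "\<And>t. \<bar>t\<bar> \<le> R \<Longrightarrow> cmod (poly p (complex_of_real t) - complex_of_real (f t)) < e/3"
    using ex_realpoly_near[OF f, of "e/3" R] e by auto
  let ?q = "\<lambda>t. Re (poly p (complex_of_real t))"
  have q: "poly p (complex_of_real t) = complex_of_real (?q t)" for t
    using p(1)
  proof (induction p)
    case (pCons c p)
    then show ?case by (simp add: complex_eq_iff complex_is_Real_iff)
  qed simp
  have close: "norm (fc f b - ceval p b) \<le> e/3" if "sa b" "norm b \<le> R" for b :: 'b
  proof -
    have cq: "continuous_on UNIV ?q" by (intro continuous_intros)
    have "norm (fc (\<lambda>t. f t - ?q t) b) \<le> e/3"
    proof (rule norm_fc_le[OF _ that])
      show "continuous_on UNIV (\<lambda>t. f t - ?q t)" by (intro continuous_intros f)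
      fix t assume "\<bar>t\<bar> \<le> R"
      from p(2)[OF this] abs_Re_le_cmod[of "poly p (complex_of_real t) - complex_of_real (f t)"]
      show "\<bar>f t - ?q t\<bar> \<le> e/3" by (simp add: abs_minus_commute)
    qed
    then show ?thesis by (simp add: fc_diff f cq that fc_poly[OF that(1) p(1) q])
  qed
  obtain N where N: "\<And>n. n \<ge> N \<Longrightarrow> norm (ceval p (x n) - ceval p a) < e/3"
    using LIMSEQ_D[OF tendsto_ceval[OF lim], of "e/3"] e by auto
  show "\<exists>no. \<forall>n\<ge>no. norm (fc f (x n) - fc f a) < e"
  proof (intro exI allI impI)
    fix n assume "N \<le> n"
    have "fc f (x n) - fc f a = (fc f (x n) - ceval p (x n)) + (ceval p (x n) - ceval p a) - (fc f a - ceval p a)"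
      by simp
    also have "norm \<dots> \<le> norm (fc f (x n) - ceval p (x n)) + norm (ceval p (x n) - ceval p a) + norm (fc f a - ceval p a)"
      by (intro order_trans[OF norm_triangle_ineq4] add_right_mono norm_triangle_ineq)
    also have "\<dots> < e"
      using close[OF x R, of n] close[OF a aR] N[OF \<open>N \<le> n\<close>] by linarith
    finally show "norm (fc f (x n) - fc f a) < e" .
  qed
qed

section \<open>Positivity\<close>

text \<open>The usual proof that sums of positive elements are positive. Since (norm u)^2 - u * u
  has norm at most (norm u)^2, adding the cases of x and y shows that r - (x * x + y * y) has norm
  at most r; therefore the square root of r - t is available on its interval.\<close>

lemma ex_sqrt_sum_squares:
  fixes x y :: "'b::{cstar_algebra,monoid_mult}"
  assumes x: "sa x" and y: "sa y"
  shows "\<exists>z. sa z \<and> x * x + y * y = z * z"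
proof -
  have *: "norm ((norm u)\<^sup>2 *\<^sub>R 1 - u * u) \<le> (norm u)\<^sup>2" if u: "sa u" for u :: 'b
  proof -
    have "(norm u)\<^sup>2 *\<^sub>R 1 - u * u = fc (\<lambda>t. (norm u)\<^sup>2 - t * t) u"
      using u by (simp add: fc_diff fc_mult fc_const fc_ident continuous_on_mult)
    also have "norm \<dots> \<le> (norm u)\<^sup>2"
    proof (rule norm_fc_le[OF _ u order_refl])
      fix t assume "\<bar>t\<bar> \<le> norm u"
      then have "t * t \<le> (norm u)\<^sup>2" by (metis abs_le_square_iff abs_norm_cancel power2_eq_square)
      then show "\<bar>(norm u)\<^sup>2 - t * t\<bar> \<le> (norm u)\<^sup>2" by simp
    qed (intro continuous_intros)
    finally show ?thesis .
  qed
  define r where "r = (norm x)\<^sup>2 + (norm y)\<^sup>2"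
  define w where "w = r *\<^sub>R 1 - (x * x + y * y)"
  have w: "sa w" using x y by (simp add: w_def sa_intros sa_one)
  have "w = ((norm x)\<^sup>2 *\<^sub>R 1 - x * x) + ((norm y)\<^sup>2 *\<^sub>R 1 - y * y)"
    by (simp add: w_def r_def scaleR_add_left)
  then have nw: "norm w \<le> r"
    unfolding r_def using norm_triangle_mono[OF *[OF x] *[OF y]] by simp
  \<comment> \<open>The absolute value makes f continuous on the whole line; on |t| \<le> r it
    changes nothing.\<close>
  define f where "f t = sqrt \<bar>r - t\<bar>" for t
  have cf: "continuous_on UNIV f" unfolding f_def by (intro continuous_intros)
  have "fc f w * fc f w = fc (\<lambda>t. f t * f t) w"
    by (simp add: fc_mult cf w)
  also have "\<dots> = fc (\<lambda>t. r - t) w"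
    by (rule fc_cong) (use nw in \<open>auto simp: w f_def intro!: continuous_intros cf\<close>)
  also have "\<dots> = x * x + y * y"
    by (simp add: fc_diff fc_const fc_ident w) (simp add: w_def)
  finally show ?thesis using sa_fc[OF cf w] by metis
qed

text \<open>\<open>fc abs\<close> separates squares from their negatives: it fixes the former and
  reverses the sign of the latter, so only 0 can be both.\<close>

lemma fc_abs_square:
  fixes x :: "'b::{cstar_algebra,monoid_mult}"
  assumes "sa x"
  shows "fc abs (x * x) = x * x" "fc abs (- (x * x)) = x * x"
proof -
  have 1: "x * x = fc (\<lambda>t. t * t) x" and 2: "- (x * x) = fc (\<lambda>t. (-1) * (t * t)) x"
    using assms fc_scale[of "\<lambda>t. t * t" x "-1"] by (simp_all add: fc_mult fc_ident continuous_on_mult)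
  have "fc abs (fc (\<lambda>t. t * t) x) = fc (\<lambda>t. \<bar>t * t\<bar>) x"
    "fc abs (fc (\<lambda>t. (-1) * (t * t)) x) = fc (\<lambda>t. \<bar>(-1) * (t * t)\<bar>) x"
    by (rule fc_compose; use assms in \<open>auto intro!: continuous_intros\<close>)+
  then show "fc abs (x * x) = x * x" "fc abs (- (x * x)) = x * x"
    unfolding 2 unfolding 1 by simp_all
qed

lemma square_eq_neg_square:
  fixes x z :: "'b::{cstar_algebra,monoid_mult}"
  assumes "sa x" "sa z" "z * z + x * x = 0"
  shows "x = 0"
proof -
  have "- (x * x) = z * z" using assms(3) by (simp add: add_eq_0_iff2)
  then have "x * x = z * z" using fc_abs_square[OF assms(1)] fc_abs_square[OF assms(2)] by simp
  then have "2 *\<^sub>R (x * x) = 0" using assms(3) by (simp add: scaleR_2)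
  then show ?thesis using sa_square_eq_0[OF assms(1)] by simp
qed

lemma eq_0_if_sum_4_squares_eq_0:
  fixes x y z w :: "'b::{cstar_algebra,monoid_mult}"
  assumes "sa x" "sa y" "sa z" "sa w" "x * x + y * y + z * z + w * w = 0"
  shows "w = 0"
proof -
  obtain u where u: "sa u" "x * x + y * y = u * u" using ex_sqrt_sum_squares assms(1,2) by blast
  obtain v where v: "sa v" "u * u + z * z = v * v" using ex_sqrt_sum_squares u(1) assms(3) by blast
  show ?thesis using square_eq_neg_square[of w v] v assms(4,5) u(2) by simp
qed

text \<open>The theorem of Kelley and Vaught. With \<open>m\<close> the negative part of \<open>h = b* b\<close> and \<open>c = b m\<close>, one has
  \<open>c* c = - m^3\<close>; the spectra of \<open>c* c\<close> and \<open>c c*\<close> agree up to 0, while \<open>c* c + c c*\<close> is a sum of squares.\<close>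

lemma fc_abs_star_mult_self:
  fixes b :: "'b::{cstar_algebra,monoid_mult}"
  shows "fc abs (star b * b) = star b * b"
proof -
  define h where "h = star b * b"
  have h: "sa h" by (simp add: h_def sa_intros)
  define g :: "real \<Rightarrow> real" where "g t = max 0 (- t)" for t
  define f :: "real \<Rightarrow> real" where "f t = max 0 t" for t
  have g0: "0 \<le> g t" for t by (simp add: g_def)
  have cg: "continuous_on UNIV g" and cf: "continuous_on UNIV f"
    unfolding g_def f_def by (intro continuous_intros)+
  have cgs: "continuous_on UNIV (\<lambda>t. sqrt (g t))" by (intro continuous_intros cg)
  have cgs': "continuous_on UNIV (\<lambda>t. g t * sqrt (g t))" by (intro continuous_intros cg)
  define m where "m = fc g h"
  \<comment> \<open>This is m^(3/2), a self-adjoint root of m^3, which displays - m^3 as the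
    negative of a square.\<close>
  define k where "k = fc (\<lambda>t. g t * sqrt (g t)) h"
  define c where "c = b * m"
  have m: "sa m" and k: "sa k" unfolding m_def k_def by (intro sa_fc cg cgs' h)+
  have kk: "k * k = fc (\<lambda>t. (g t * sqrt (g t)) * (g t * sqrt (g t))) h"
    unfolding k_def by (simp only: fc_mult cgs' h)
  have mmm: "m * m * m = k * k"
  proof -
    have "m * m * m = fc (\<lambda>t. g t * g t * g t) h"
      unfolding m_def by (simp add: fc_mult cg h continuous_on_mult)
    also have "(\<lambda>t. g t * g t * g t) = (\<lambda>t. (g t * sqrt (g t)) * (g t * sqrt (g t)))"
      using g0 by (simp add: fun_eq_iff algebra_simps)
    finally show ?thesis by (simp only: kk)
  qed
  have cc: "star c * c = - (k * k)"
  proof -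
    have "star c * c = m * h * m" using m by (simp add: c_def h_def star_mult sa_star mult.assoc)
    also have "\<dots> = fc (\<lambda>t. g t * t * g t) h"
      unfolding m_def by (simp add: fc_mult fc_ident cg h continuous_on_mult)
    also have "(\<lambda>t. g t * t * g t) = (\<lambda>t. (-1) * (g t * g t * g t))"
      by (auto simp: g_def fun_eq_iff max_def)
    also have "fc \<dots> h = - (m * m * m)"
      unfolding m_def by (subst fc_scale) (simp_all add: fc_mult cg h continuous_on_mult)
    finally show ?thesis by (simp add: mmm)
  qed
  define d where "d = c * star c"
  have d: "sa d" by (simp add: d_def sa_intros)
  have "fc f (star c * c) = 0"
  proof -
    have "star c * c = fc (\<lambda>t. (-1) * (t * t)) k"
      unfolding cc using k fc_scale[of "\<lambda>t. t * t" k "-1"] by (simp add: fc_mult fc_ident continuous_on_mult)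
    also have "fc f \<dots> = fc (\<lambda>t. f ((-1) * (t * t))) k"
      by (rule fc_compose[OF cf _ k]) (intro continuous_intros)
    also have "(\<lambda>t. f ((-1) * (t * t))) = (\<lambda>t. 0)" by (simp add: f_def fun_eq_iff)
    finally show ?thesis by (simp add: fc_const k)
  qed
  \<comment> \<open>Intertwining: (c * star c) * c = c * (star c * c), so the positive part of c *
    star c kills c because that of star c * c vanishes.\<close>
  then have "fc f d * c = 0"
    using fc_intertwine[OF cf d sa_intros(7), of c c] by (simp add: d_def mult.assoc)
  then have "fc f d * d = 0" by (simp add: d_def flip: mult.assoc)
  moreover have "fc f d * fc f d = fc f d * d"
  proof -
    have "fc f d * fc f d = fc (\<lambda>t. f t * f t) d" by (simp add: fc_mult cf d)
    also have "(\<lambda>t. f t * f t) = (\<lambda>t. f t * t)" by (auto simp: f_def fun_eq_iff max_def)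
    finally show ?thesis by (simp add: fc_mult cf d fc_ident)
  qed
  ultimately have fd: "fc f d = 0" using sa_square_eq_0[OF sa_fc[OF cf d]] by simp
  define l where "l = fc (\<lambda>t. sqrt (g t)) d"
  have l: "sa l" unfolding l_def by (rule sa_fc[OF cgs d])
  have ll: "l * l = fc g d"
    unfolding l_def using fc_mult[OF cgs cgs d] g0 by simp
  have "d = fc (\<lambda>t. f t - g t) d"
    using fc_ident[OF d] by (simp add: f_def g_def max_def if_distrib cong: if_cong)
  also have "\<dots> = - (l * l)" by (simp add: fc_diff cf cg d fd ll)
  finally have dl: "d = - (l * l)" .
  \<comment> \<open>\<open>u\<close> is twice the real part of c and \<open>v\<close> minus twice
    its imaginary part; the mixed terms cancel in u * u + v * v.\<close>
  define u where "u = c + star c"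
  define v where "v = \<i> *\<^sub>C (c - star c)"
  have uv: "sa u" "sa v"
    by (simp_all add: u_def v_def sa_def star_add star_diff star_star star_scaleC add.commute
        scaleC_minus_left scaleC_diff_right)
  have "u * u + v * v = 2 *\<^sub>R (star c * c) + 2 *\<^sub>R d"
    by (simp add: u_def v_def d_def algebra_simps mult_scaleC_left mult_scaleC_right scaleC_scaleC
        scaleC_minus_left scaleC_diff_right scaleC_add_right scaleR_2)
  then have "u * u + v * v + (sqrt 2 *\<^sub>R k) * (sqrt 2 *\<^sub>R k) + (sqrt 2 *\<^sub>R l) * (sqrt 2 *\<^sub>R l) = 0"
    by (simp add: cc dl)
  then have "sqrt 2 *\<^sub>R l = 0"
    by (rule eq_0_if_sum_4_squares_eq_0[rotated -1]) (simp_all add: uv k l sa_intros)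
  then have "d = 0" by (simp add: dl)
  then have "c = 0" by (simp add: d_def mult_star_self_eq_0)
  then have "m * m * m = 0" using cc by (simp add: mmm)
  then have "(m * m) * (m * m) = 0" by (metis mult.assoc mult_zero_left)
  then have "m = 0" using m by (simp add: sa_square_eq_0 sa_intros)
  have "fc abs h = fc (\<lambda>t. t + 2 * g t) h"
    by (rule arg_cong[of _ _ "\<lambda>f. fc f h"]) (auto simp: g_def fun_eq_iff max_def)
  also have "\<dots> = h"
    using \<open>m = 0\<close> by (simp add: fc_add fc_scale fc_ident cg h continuous_on_mult m_def)
  finally show ?thesis by (simp add: h_def)
qed

section \<open>The multiplier algebra as a unitization\<close>

instantiation multiplier :: (cstar_algebra) monoid_mult
begin

lift_definition one_multiplier :: "'a multiplier" is "(id_blinfun, id_blinfun)"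
  by auto

instance
proof
  fix X :: "'a multiplier"
  have "lact (1::'a multiplier) = id_blinfun" by (simp add: lact_def one_multiplier.rep_eq)
  then show "1 * X = X" "X * 1 = X"
    by (auto intro!: lact_inject blinfun_eqI simp: lact_simps)
qed

end

lemma mult_embed_simps:
  "mult_embed (0::'a::cstar_algebra) = 0"
  "mult_embed (a + b) = mult_embed a + mult_embed b"
  "mult_embed (a - b) = mult_embed a - mult_embed b"
  "mult_embed (r *\<^sub>R a) = r *\<^sub>R mult_embed a"
  "mult_embed (a * b) = mult_embed a * mult_embed b"
  "mult_embed (star a) = star (mult_embed a)"
  "X * mult_embed a = mult_embed (lact X a)"
  "mult_embed a * X = mult_embed (ract X a)"
  by (rule lact_inject, rule blinfun_eqI,
      simp add: lact_simps lact_simps' blinfun.bilinear_simps algebra_simps star_mult star_star lact_mult ract_lact)+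

lemma norm_mult_embed [simp]: "norm (mult_embed a) = norm (a::'a::cstar_algebra)"
proof (rule antisym)
  show "norm (mult_embed a) \<le> norm a"
    unfolding norm_multiplier_def by (rule norm_blinfun_bound) (simp_all add: norm_mult_ineq)
  have "norm a * norm a = norm (lact (mult_embed a) (star a))"
    by (simp add: norm_mult_star power2_eq_square)
  also have "\<dots> \<le> norm (mult_embed a) * norm a"
    using norm_blinfun[of "lact (mult_embed a)" "star a"] by (simp add: norm_multiplier_def)
  finally show "norm a \<le> norm (mult_embed a)" by (cases "a = 0") auto
qed

lemma bounded_linear_mult_embed: "bounded_linear (mult_embed :: 'a::cstar_algebra \<Rightarrow> _)"
  by (rule bounded_linear_intro[of _ 1]) (auto simp: mult_embed_simps)

lemma mult_embed_eq_iff [simp]: "mult_embed a = mult_embed b \<longleftrightarrow> a = (b::'a::cstar_algebra)"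
  by (metis mult_embed_simps(3) norm_mult_embed norm_eq_zero right_minus_eq)

lemma sa_mult_embed [simp]: "sa (mult_embed a) \<longleftrightarrow> sa (a::'a::cstar_algebra)"
  unfolding sa_def mult_embed_simps(6)[symmetric] mult_embed_eq_iff ..

lemma closed_range_mult_embed: "closed (range (mult_embed :: 'a::cstar_algebra \<Rightarrow> _))"
  unfolding closed_sequential_limits
proof (intro allI impI, elim conjE)
  fix Y and l :: "'a multiplier" assume Y: "\<forall>n. Y n \<in> range mult_embed" and l: "Y \<longlonglongrightarrow> l"
  then have "\<forall>n. \<exists>y. Y n = mult_embed y" by blast
  then obtain y where y: "\<And>n. Y n = mult_embed (y n)" by (auto simp: choice_iff)
  have "Cauchy Y" using l by (rule LIMSEQ_imp_Cauchy)
  then have "Cauchy y" by (simp add: Cauchy_def y dist_norm flip: mult_embed_simps(3))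
  then obtain x where "y \<longlonglongrightarrow> x" by (auto simp: Cauchy_convergent_iff convergent_def)
  then have "Y \<longlonglongrightarrow> mult_embed x"
    unfolding y[abs_def] by (rule bounded_linear.tendsto[OF bounded_linear_mult_embed])
  then show "l \<in> range mult_embed" using l LIMSEQ_unique by blast
qed

lemma fc_mult_embed_in_range:
  assumes f: "continuous_on UNIV f" "f 0 = 0" and a: "sa (a::'a::cstar_algebra)"
  shows "fc f (mult_embed a) \<in> range mult_embed"
proof -
  define p where "p = approx_poly f"
  let ?A = "mult_embed a"
  have p: "papprox (norm ?A) p f" unfolding p_def by (rule papprox_approx_poly[OF f(1)])
  have "(\<lambda>n. poly (p n) 0) \<longlonglongrightarrow> 0"
    using p f(2) unfolding papprox_def
    by (auto dest!: tendsto_uniform_limitI[where x = 0])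
  then have "(\<lambda>n. norm (poly (p n) 0) * norm (1::'a multiplier)) \<longlonglongrightarrow> 0"
    by (intro tendsto_mult_left_zero tendsto_norm_zero)
  then have "(\<lambda>n. poly (p n) 0 *\<^sub>C (1::'a multiplier)) \<longlonglongrightarrow> 0"
    unfolding tendsto_norm_zero_iff[symmetric, of "\<lambda>n. poly (p n) 0 *\<^sub>C (1::'a multiplier)"] by (simp only: norm_scaleC)
  then have lim: "(\<lambda>n. ceval (p n) ?A - poly (p n) 0 *\<^sub>C 1) \<longlonglongrightarrow> fc f ?A - 0"
    using a by (intro tendsto_diff tendsto_fc[OF f(1) p]) simp_all
  have "ceval q ?A - poly q 0 *\<^sub>C 1 \<in> range mult_embed" for q
    by (cases q) (simp add: mult_embed_simps)
  then have "fc f ?A - 0 \<in> range mult_embed"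
    by (rule closed_sequentially[OF closed_range_mult_embed _ lim])
  then show ?thesis by simp
qed


text \<open>Limits of positive elements are positive because \<open>sqrt \<bar>a\<bar>\<close> depends continuously on \<open>a\<close>.\<close>

lemma closed_cpos: "closed {a::'a::cstar_algebra. cpos a}"
  unfolding closed_sequential_limits
proof (intro allI impI, elim conjE)
  fix x and a :: 'a assume x: "\<forall>n. x n \<in> {a. cpos a}" and lim: "x \<longlonglongrightarrow> a"
  have sx: "sa (x n)" for n using x sa_cpos by blast
  have "sa a"
    using tendsto_star[OF lim] lim LIMSEQ_unique sx by (fastforce simp: sa_def)
  have E: "(\<lambda>n. mult_embed (x n)) \<longlonglongrightarrow> mult_embed a"
    by (rule bounded_linear.tendsto[OF bounded_linear_mult_embed lim])
  have c: "continuous_on UNIV (abs :: real \<Rightarrow> real)" by (intro continuous_intros)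
  have "fc abs (mult_embed (x n)) = mult_embed (x n)" for n
  proof -
    obtain b where "x n = star b * b" using x by (auto simp: cpos_def)
    then show ?thesis using fc_abs_star_mult_self[of "mult_embed b"] by (simp add: mult_embed_simps(5,6))
  qed
  moreover have "(\<lambda>n. fc abs (mult_embed (x n))) \<longlonglongrightarrow> fc abs (mult_embed a)"
    by (rule tendsto_fc_element[OF c _ E]) (simp_all add: sx \<open>sa a\<close>)
  ultimately have "fc abs (mult_embed a) = mult_embed a"
    using E LIMSEQ_unique by simp
  define f where "f t = sqrt \<bar>t\<bar>" for t :: real
  have f: "continuous_on UNIV f" unfolding f_def by (intro continuous_intros)
  obtain b where b: "fc f (mult_embed a) = mult_embed b"
    using fc_mult_embed_in_range[OF f _ \<open>sa a\<close>] by (auto simp: f_def)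
  have "sa (mult_embed b)" unfolding b[symmetric] using \<open>sa a\<close> by (intro sa_fc f) simp
  then have "sa b" by simp
  have "mult_embed (b * b) = fc (\<lambda>t. f t * f t) (mult_embed a)"
    using \<open>sa a\<close> by (simp add: mult_embed_simps(5) fc_mult f flip: b)
  also have "(\<lambda>t. f t * f t) = abs" by (simp add: f_def fun_eq_iff)
  finally have "a = star b * b"
    using \<open>fc abs (mult_embed a) = mult_embed a\<close> \<open>sa b\<close> by (simp add: sa_star)
  then show "a \<in> {a. cpos a}" by (auto simp: cpos_def)
qed

text \<open>The functional calculus inside the algebra; junk unless \<open>f 0 = 0\<close>.\<close>

definition fc0 :: "(real \<Rightarrow> real) \<Rightarrow> 'a::cstar_algebra \<Rightarrow> 'a"
  where "fc0 f a = inv mult_embed (fc f (mult_embed a))"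

lemma mult_embed_fc0:
  "continuous_on UNIV f \<Longrightarrow> f 0 = 0 \<Longrightarrow> sa (a::'a::cstar_algebra) \<Longrightarrow> mult_embed (fc0 f a) = fc f (mult_embed a)"
  unfolding fc0_def by (rule f_inv_into_f[OF fc_mult_embed_in_range])

lemma sa_fc0: "continuous_on UNIV f \<Longrightarrow> f 0 = 0 \<Longrightarrow> sa (a::'a::cstar_algebra) \<Longrightarrow> sa (fc0 f a)"
  by (metis mult_embed_fc0 sa_fc sa_mult_embed)

lemma fc0_ident: "sa (a::'a::cstar_algebra) \<Longrightarrow> fc0 (\<lambda>t. t) a = a"
  by (metis (no_types) continuous_on_id fc_ident mult_embed_eq_iff mult_embed_fc0 sa_mult_embed)

lemma fc0_mult:
  "\<lbrakk>continuous_on UNIV f; f 0 = 0; continuous_on UNIV g; g 0 = 0; sa (a::'a::cstar_algebra)\<rbrakk> \<Longrightarrow>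
    fc0 (\<lambda>t. f t * g t) a = fc0 f a * fc0 g a"
  by (rule mult_embed_eq_iff[THEN iffD1])
    (simp add: mult_embed_fc0 mult_embed_simps(5) fc_mult continuous_on_mult)

lemma fc0_diff:
  "\<lbrakk>continuous_on UNIV f; f 0 = 0; continuous_on UNIV g; g 0 = 0; sa (a::'a::cstar_algebra)\<rbrakk> \<Longrightarrow>
    fc0 (\<lambda>t. f t - g t) a = fc0 f a - fc0 g a"
  by (rule mult_embed_eq_iff[THEN iffD1])
    (simp add: mult_embed_fc0 mult_embed_simps(3) fc_diff continuous_on_diff)

lemma norm_fc0_le:
  "\<lbrakk>continuous_on UNIV f; f 0 = 0; sa (a::'a::cstar_algebra); norm a \<le> R; \<And>t. \<bar>t\<bar> \<le> R \<Longrightarrow> \<bar>f t\<bar> \<le> B\<rbrakk> \<Longrightarrow>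
    norm (fc0 f a) \<le> B"
  using norm_fc_le[of f "mult_embed a" R B] by (simp add: mult_embed_fc0[symmetric])

section \<open>Elementary algebras\<close>

lemma closed_ideal_annihilator:
  "closed_ideal {z::'a::cstar_algebra. \<forall>y. a * y * z = 0}" (is "closed_ideal ?I")
proof -
  have "?I = (\<Inter>y. {z. a * y * z = 0})" by auto
  also have "closed \<dots>" by (intro closed_INT ballI closed_Collect_eq continuous_intros)
  finally have "closed ?I" .
  moreover have "a * y * (x * z) = 0" if "\<forall>y. a * y * z = 0" for x y z
    using that[rule_format, of "y * x"] by (simp add: mult.assoc)
  moreover have "a * y * (z * x) = 0" if "\<forall>y. a * y * z = 0" for x y z
    using that[rule_format, of y] by (simp flip: mult.assoc)
  ultimately show ?thesis
    by (auto simp: closed_ideal_def distrib_left mult_scaleC_right)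
qed

text \<open>The z with a y z = 0 for all y form a closed ideal. If it is everything, then y = star a
  and z = a * star a give (a * star a)^2 = 0.\<close>

lemma simple_imp_prime:
  assumes "simple_algebra TYPE('a::cstar_algebra)" and 0: "\<And>y. a * y * b = (0::'a)"
  shows "a = 0 \<or> b = 0"
proof -
  let ?I = "{z. \<forall>y. a * y * z = 0}"
  have "?I = {0} \<or> ?I = UNIV"
    using assms(1) closed_ideal_annihilator[of a] by (auto simp: simple_algebra_def)
  moreover have "b \<in> ?I" using 0 by simp
  moreover have "a = 0" if "?I = UNIV"
  proof -
    have "a * star a * (a * star a) = 0" using that by blast
    then have "a * star a = 0" by (simp add: sa_square_eq_0 sa_intros)
    then show ?thesis by (simp add: mult_star_self_eq_0)
  qed
  ultimately show ?thesis by blast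
qed

section \<open>From prime elements to minimal projections\<close>

text \<open>The model to keep in mind: among the compact operators on a Hilbert space, the nonzero
  elements of this kind are exactly those of rank one.\<close>

definition prime_element :: "'a::cstar_algebra \<Rightarrow> bool"
  where "prime_element b \<longleftrightarrow> (\<forall>x y. x * b * y = 0 \<longrightarrow> x * b = 0 \<or> b * y = 0)"

lemma fc0_zero: "sa (a::'a::cstar_algebra) \<Longrightarrow> fc0 (\<lambda>t. 0) a = 0"
  using norm_fc0_le[of "\<lambda>t. 0" a "norm a" 0] by simp

text \<open>If the product vanished, then so would the function |t| g t at h, and t^2 could be
  replaced at h by t^2 - |t| g t. That function is at most c on [-1, 1], while norm (h * h) =
  1.\<close>

lemma top_of_spectrum:
  fixes h :: "'a::cstar_algebra"
  assumes h: "sa h" "norm h = 1" and c: "0 < c" "c < 1"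
  shows "h * fc0 (\<lambda>t. \<bar>t\<bar> * max (\<bar>t\<bar> - c) 0) h \<noteq> 0"
proof
  define g where "g t = max (\<bar>t\<bar> - c) 0" for t :: real
  \<comment> \<open>A continuous function vanishing at 0 that equals 1/t for |t| \<ge> c, where g
    lives; it cancels the extra factor h.\<close>
  define m where "m t = t / max (t * t) (c * c)" for t :: real
  have cg: "continuous_on UNIV g" unfolding g_def by (intro continuous_intros)
  have pos: "max (t * t) (c * c) \<noteq> 0" for t :: real
    using c by (metis max.cobounded2 mult_pos_pos not_le)
  have cm: "continuous_on UNIV m" unfolding m_def using pos by (intro continuous_intros) auto
  have g0: "\<bar>0\<bar> * g 0 = 0" "m 0 = 0" by (simp_all add: m_def)
  assume "h * fc0 (\<lambda>t. \<bar>t\<bar> * max (\<bar>t\<bar> - c) 0) h = 0"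
  then have z: "h * fc0 (\<lambda>t. \<bar>t\<bar> * g t) h = 0" by (simp add: g_def)
  have *: "\<bar>t\<bar> * g t = t * (\<bar>t\<bar> * g t) * m t" for t
  proof (cases "\<bar>t\<bar> \<le> c")
    case False
    then have "c * c \<le> t * t" using c by (metis abs_le_square_iff abs_of_pos linear power2_eq_square)
    then have "m t = 1 / t" using False c by (auto simp: m_def max_def field_simps)
    then show ?thesis using False c by auto
  qed (simp add: g_def)
  have "fc0 (\<lambda>t. \<bar>t\<bar> * g t) h = fc0 (\<lambda>t. t * (\<bar>t\<bar> * g t) * m t) h" using * by presburger
  also have "\<dots> = fc0 (\<lambda>t. t * (\<bar>t\<bar> * g t)) h * fc0 m h"
    by (rule fc0_mult) (intro continuous_intros cg cm h g0 | simp)+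
  also have "fc0 (\<lambda>t. t * (\<bar>t\<bar> * g t)) h = fc0 (\<lambda>t. t) h * fc0 (\<lambda>t. \<bar>t\<bar> * g t) h"
    by (rule fc0_mult) (intro continuous_intros cg h g0 | simp)+
  finally have z: "fc0 (\<lambda>t. \<bar>t\<bar> * g t) h = 0" using z by (simp add: fc0_ident h)
  have "norm (h * h) = norm (fc0 (\<lambda>t. t * t) h)" using h by (simp add: fc0_mult fc0_ident)
  also have "\<dots> = norm (fc0 (\<lambda>t. t * t - \<bar>t\<bar> * g t) h)"
    using z h by (subst fc0_diff) (intro continuous_intros cg | simp)+
  also have "\<dots> \<le> c"
  proof (rule norm_fc0_le[of _ _ 1])
    fix t :: real assume t: "\<bar>t\<bar> \<le> 1"
    have "t * t - \<bar>t\<bar> * g t = \<bar>t\<bar> * (\<bar>t\<bar> - g t)" by (simp add: algebra_simps)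
    moreover have "0 \<le> \<bar>t\<bar> - g t" "\<bar>t\<bar> - g t \<le> c" using c by (auto simp: g_def)
    ultimately show "\<bar>t * t - \<bar>t\<bar> * g t\<bar> \<le> c"
      using mult_mono[OF t, of "\<bar>t\<bar> - g t" c] by (simp add: abs_mult)
  qed (use h in \<open>auto intro!: continuous_intros cg\<close>)
  finally show False using norm_sa_square[OF h(1)] h(2) c by simp
qed

text \<open>The spectrum of \<open>k\<close> outside 0 cannot be split by orthogonal functions, so the part of it away
  from \<open>\<plusminus>1\<close> is trivial.\<close>

lemma prime_element_square_idem:
  fixes k :: "'a::cstar_algebra"
  assumes Q: "prime_element k" and k: "sa k" "norm k = 1"
  shows "(k * k) * (k * k) = k * k"
proof -
  have *: "norm (fc0 (\<lambda>t. t * t - (t * t) * (t * t)) k) \<le> 2 * e" if e: "0 < e" "e < 1" for e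
  proof -
    define c where "c = 1 - e"
    define g where "g t = max (\<bar>t\<bar> - c) 0" for t :: real
    define f where "f t = max (c - \<bar>t\<bar>) 0" for t :: real
    have cg: "continuous_on UNIV g" and cf: "continuous_on UNIV f"
      unfolding g_def f_def by (intro continuous_intros)+
    have c: "0 < c" "c < 1" using e by (auto simp: c_def)
    \<comment> \<open>f is supported in |t| \<le> c and g in |t| \<ge> c, so the triple product is 0
      and primeness kills one side. The side of g survives by
      \<open>top_of_spectrum\<close>.\<close>
    have "fc0 (\<lambda>t. f t * t) k * k * fc0 (\<lambda>t. \<bar>t\<bar> * g t) k
        = fc0 (\<lambda>t. f t * t) k * fc0 (\<lambda>t. t) k * fc0 (\<lambda>t. \<bar>t\<bar> * g t) k"
      by (simp add: fc0_ident k)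
    also have "\<dots> = fc0 (\<lambda>t. (f t * t) * t) k * fc0 (\<lambda>t. \<bar>t\<bar> * g t) k"
      by (subst fc0_mult) (intro continuous_intros cf k | simp)+
    also have "\<dots> = fc0 (\<lambda>t. ((f t * t) * t) * (\<bar>t\<bar> * g t)) k"
      by (subst fc0_mult) (intro continuous_intros cf cg k | simp)+
    also have "(\<lambda>t. ((f t * t) * t) * (\<bar>t\<bar> * g t)) = (\<lambda>t. 0)"
      by (auto simp: fun_eq_iff f_def g_def max_def)
    finally have "fc0 (\<lambda>t. f t * t) k * k = 0 \<or> k * fc0 (\<lambda>t. \<bar>t\<bar> * g t) k = 0"
      using Q k by (simp add: prime_element_def fc0_zero)
    then have "fc0 (\<lambda>t. f t * t) k * k = 0"
      using top_of_spectrum[OF k c] by (simp add: g_def)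
    moreover have "fc0 (\<lambda>t. f t * t) k * k = fc0 (\<lambda>t. (f t * t) * t) k"
    proof -
      have "fc0 (\<lambda>t. (f t * t) * t) k = fc0 (\<lambda>t. f t * t) k * fc0 (\<lambda>t. t) k"
        by (rule fc0_mult) (intro continuous_intros cf k | simp)+
      then show ?thesis by (simp add: fc0_ident k)
    qed
    ultimately have F: "fc0 (\<lambda>t. (f t * t) * t) k = 0" by simp
    have "fc0 (\<lambda>t. ((f t * t) * t) * \<bar>t\<bar>) k = fc0 (\<lambda>t. (f t * t) * t) k * fc0 abs k"
      by (rule fc0_mult) (intro continuous_intros cf k | simp)+
    with F have F': "fc0 (\<lambda>t. ((f t * t) * t) * \<bar>t\<bar>) k = 0" by simp
    \<comment> \<open>Subtracting f t * t^2 * (1 + |t|), which vanishes at k, from t^2 - t^4 = t^2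
      (1 + |t|) (1 - |t|) leaves the factor 1 - |t| - f t, which lies between 0 and e on
      [-1, 1].\<close>
    have "fc0 (\<lambda>t. t * t - (t * t) * (t * t)) k
        = fc0 (\<lambda>t. (t * t - (t * t) * (t * t)) - (f t * t) * t - ((f t * t) * t) * \<bar>t\<bar>) k"
    proof -
      have "fc0 (\<lambda>t. (t * t - (t * t) * (t * t)) - (f t * t) * t - ((f t * t) * t) * \<bar>t\<bar>) k
        = fc0 (\<lambda>t. (t * t - (t * t) * (t * t)) - (f t * t) * t) k - fc0 (\<lambda>t. ((f t * t) * t) * \<bar>t\<bar>) k"
        by (rule fc0_diff) (intro continuous_intros cf k | simp)+
      also have "fc0 (\<lambda>t. (t * t - (t * t) * (t * t)) - (f t * t) * t) k
        = fc0 (\<lambda>t. t * t - (t * t) * (t * t)) k - fc0 (\<lambda>t. (f t * t) * t) k"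
        by (rule fc0_diff) (intro continuous_intros cf k | simp)+
      finally show ?thesis using F F' by simp
    qed
    also have "norm \<dots> \<le> 2 * e"
    proof (rule norm_fc0_le[of _ _ 1])
      fix t :: real assume t: "\<bar>t\<bar> \<le> 1"
      let ?r = "1 - \<bar>t\<bar> - f t"
      have "0 \<le> ?r" "?r \<le> e" using t e by (auto simp: f_def c_def)
      moreover have "\<bar>t\<bar> * \<bar>t\<bar> * (1 + \<bar>t\<bar>) \<le> 1 * 1 * 2" using t by (intro mult_mono) auto
      ultimately have "\<bar>(\<bar>t\<bar> * \<bar>t\<bar> * (1 + \<bar>t\<bar>)) * ?r\<bar> \<le> 2 * e"
        using mult_mono[of "\<bar>t\<bar> * \<bar>t\<bar> * (1 + \<bar>t\<bar>)" "2" ?r e] by (simp add: abs_mult)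
      moreover have "(t * t - (t * t) * (t * t)) - (f t * t) * t - ((f t * t) * t) * \<bar>t\<bar> = (\<bar>t\<bar> * \<bar>t\<bar> * (1 + \<bar>t\<bar>)) * ?r"
        by (cases "t \<ge> 0") (simp_all add: algebra_simps)
      ultimately show "\<bar>(t * t - (t * t) * (t * t)) - (f t * t) * t - ((f t * t) * t) * \<bar>t\<bar>\<bar> \<le> 2 * e"
        by simp
    qed (use k in \<open>auto intro!: continuous_intros cf\<close>)
    finally show ?thesis .
  qed
  have "norm (fc0 (\<lambda>t. t * t - (t * t) * (t * t)) k) \<le> 0"
  proof (rule field_le_epsilon)
    fix e :: real assume "e > 0"
    then show "norm (fc0 (\<lambda>t. t * t - (t * t) * (t * t)) k) \<le> 0 + e"
      using order_trans[OF *[of "min (e/2) (1/2)"], of e] by simp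
  qed
  moreover have "fc0 (\<lambda>t. t * t - (t * t) * (t * t)) k = k * k - (k * k) * (k * k)"
    using k by (simp add: fc0_diff fc0_mult fc0_ident continuous_on_mult)
  ultimately show ?thesis by simp
qed

lemma ex_prime_projection:
  fixes k :: "'a::cstar_algebra"
  assumes Q: "prime_element k" and k: "sa k" "k \<noteq> 0"
  obtains p :: 'a where "star p = p" "p * p = p" "p \<noteq> 0" "prime_element p"
proof
  define l where "l = (1 / norm k) *\<^sub>R k"
  have l: "sa l" "norm l = 1" using k by (auto simp: l_def sa_intros)
  have Ql: "prime_element l" using Q k by (simp add: prime_element_def l_def)
  show "l * l * (l * l) = l * l" by (rule prime_element_square_idem[OF Ql l])
  show "star (l * l) = l * l" using l by (simp add: star_mult sa_star)
  show "l * l \<noteq> 0" using l by (auto simp: sa_square_eq_0)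
  show "prime_element (l * l)"
    unfolding prime_element_def
  proof (intro allI impI)
    fix x y assume "x * (l * l) * y = 0"
    then have "(x * l) * l * y = 0" by (simp add: mult.assoc)
    then have "(x * l) * l = 0 \<or> l * y = 0" using Ql unfolding prime_element_def by blast
    then show "x * (l * l) = 0 \<or> l * l * y = 0" by (auto simp: mult.assoc)
  qed
qed

text \<open>Primeness makes the corner of \<open>p\<close> free of zero divisors. For self-adjoint y
  of norm 1 there, y^4 is a nonzero idempotent, hence equals p, and factoring y^4 - p step by step
  leaves only y = p and y = - p.\<close>

lemma prime_projection_minimal_sa:
  fixes p x :: "'a::cstar_algebra"
  assumes p: "star p = p" "p * p = p" "p \<noteq> 0" "prime_element p"
    and x: "sa x" "p * x = x" "x * p = x"
  shows "\<exists>r. x = r *\<^sub>R p"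
proof (cases "x = 0")
  case False
  have dom: "u = 0 \<or> v = 0" if "u * v = 0" "u * p = u" "p * v = v" for u v
    using p(4) that unfolding prime_element_def by metis
  define y where "y = (1 / norm x) *\<^sub>R x"
  have y: "sa y" "norm y = 1" "p * y = y" "y * p = y" using x False by (auto simp: y_def sa_intros)
  define k where "k = y * y"
  have k: "sa k" "norm k = 1" "p * k = k" "k * p = k"
    using y by (auto simp: k_def sa_intros norm_sa_square) (simp_all add: mult.assoc flip: mult.assoc[of p])
  have "prime_element k"
    unfolding prime_element_def
  proof (intro allI impI)
    fix u v assume "u * k * v = 0"
    then have "(u * y) * (y * v) = 0" by (simp add: k_def mult.assoc)
    then have "u * y = 0 \<or> y * v = 0" by (rule dom) (simp_all add: y mult.assoc flip: mult.assoc[of p])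
    then show "u * k = 0 \<or> k * v = 0" by (auto simp: k_def mult.assoc) (simp flip: mult.assoc)
  qed
  from prime_element_square_idem[OF this k(1,2)] have qq: "(k * k) * (k * k) = k * k" .
  have pkk: "p * (k * k) = k * k" "(k * k) * p = k * k" using k by (simp_all add: mult.assoc flip: mult.assoc[of p])
  have "(k * k) * (p - k * k) = 0" by (simp add: right_diff_distrib pkk qq)
  then have "k * k = 0 \<or> p - k * k = 0" by (rule dom) (simp_all add: pkk right_diff_distrib p)
  moreover have "k * k \<noteq> 0" using k by (auto simp: sa_square_eq_0)
  ultimately have kk: "k * k = p" by simp
  have "(k - p) * (k + p) = 0" by (simp add: algebra_simps k kk p)
  then have "k - p = 0 \<or> k + p = 0" by (rule dom) (simp_all add: algebra_simps k p)
  \<comment> \<open>If y * y = - p, the factorization over the imaginary unit would give y = i p or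
    y = - i p, which is not self-adjoint unless it is 0.\<close>
  moreover have "k + p \<noteq> 0"
  proof
    assume "k + p = 0"
    then have "y * y = - p" by (simp add: k_def add_eq_0_iff2)
    then have "(y - \<i> *\<^sub>C p) * (y + \<i> *\<^sub>C p) = 0"
      by (simp add: algebra_simps mult_scaleC_left mult_scaleC_right scaleC_scaleC scaleC_minus_left
          scaleC_diff_right scaleC_add_right y p)
    then have "y - \<i> *\<^sub>C p = 0 \<or> y + \<i> *\<^sub>C p = 0"
      by (rule dom) (simp_all add: algebra_simps mult_scaleC_left mult_scaleC_right y p)
    then have "star (y - \<i> *\<^sub>C p) = 0 \<and> y - \<i> *\<^sub>C p = 0 \<or> star (y + \<i> *\<^sub>C p) = 0 \<and> y + \<i> *\<^sub>C p = 0" by auto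
    then have "y + y = 0"
      using y(1) by (auto simp: star_add star_diff star_scaleC p sa_star scaleC_minus_left)
    then have "2 *\<^sub>R y = 0" by (simp add: scaleR_2)
    then show False using y(2) by auto
  qed
  ultimately have "y * y = p" by (simp add: k_def)
  then have "(y - p) * (y + p) = 0" by (simp add: algebra_simps y p)
  then have "y - p = 0 \<or> y + p = 0" by (rule dom) (simp_all add: algebra_simps y p)
  then have "y = 1 *\<^sub>R p \<or> y = (-1) *\<^sub>R p" by (auto simp: add_eq_0_iff2)
  then obtain r where "y = r *\<^sub>R p" by blast
  moreover have "x = norm x *\<^sub>R y" using False by (simp add: y_def)
  ultimately show ?thesis by (metis scaleR_scaleR)
qed (intro exI[of _ 0], simp)

lemma prime_projection_minimal:
  fixes p x :: "'a::cstar_algebra"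
  assumes p: "star p = p" "p * p = p" "p \<noteq> 0" "prime_element p"
  shows "\<exists>c. p * x * p = c *\<^sub>C p"
proof -
  define u where "u = p * x * p"
  have u: "p * u = u" "u * p = u" "p * star u = star u" "star u * p = star u"
    by (simp_all add: u_def star_mult p mult.assoc) (simp_all add: p flip: mult.assoc)
  obtain r where r: "u + star u = r *\<^sub>R p"
    using prime_projection_minimal_sa[OF p, of "u + star u"]
    by (auto simp: sa_def star_add star_star add.commute distrib_left distrib_right u)
  obtain s where s: "\<i> *\<^sub>C (u - star u) = s *\<^sub>R p"
    using prime_projection_minimal_sa[OF p, of "\<i> *\<^sub>C (u - star u)"]
    by (auto simp: sa_def star_diff star_scaleC star_star u mult_scaleC_left mult_scaleC_right
        algebra_simps scaleC_minus_left scaleC_diff_right)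
  have d: "u - star u = (- \<i> * s) *\<^sub>C p"
    using arg_cong[OF s, of "\<lambda>z. (- \<i>) *\<^sub>C z"] by (simp add: scaleC_scaleC scaleR_scaleC)
  have "2 *\<^sub>R u = (u + star u) + (u - star u)" by (simp add: scaleR_2)
  also have "\<dots> = (r - \<i> * s) *\<^sub>C p"
    unfolding r d by (simp add: scaleR_scaleC flip: scaleC_add_left)
  finally have "(1/2) *\<^sub>R (2 *\<^sub>R u) = (1/2) *\<^sub>R ((r - \<i> * s) *\<^sub>C p)" by simp
  then have "u = ((1/2) * (r - \<i> * s)) *\<^sub>C p" by (simp add: scaleR_scaleC scaleC_scaleC)
  then show ?thesis unfolding u_def by blast
qed

lemma bounded_linear_scaleC_left: "bounded_linear (\<lambda>c. c *\<^sub>C (x::'a::cstar_algebra))"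
  by (rule bounded_linear_intro[of _ "norm x"])
     (auto simp: scaleC_add_left scaleR_scaleC scaleC_scaleC norm_scaleC scaleR_conv_of_real)

lemma compact_closure_if_approximable:
  fixes S :: "'a::banach set"
  assumes "\<And>e. e > 0 \<Longrightarrow> \<exists>K. compact K \<and> (\<forall>x\<in>S. \<exists>y\<in>K. dist x y < e)"
  shows "compact (closure S)"
  unfolding compact_eq_totally_bounded
proof (intro conjI allI impI)
  show "complete (closure S)" by (simp add: complete_eq_closed)
  fix e :: real assume e: "e > 0"
  obtain K where K: "compact K" "\<forall>x\<in>S. \<exists>y\<in>K. dist x y < e/3" using assms[of "e/3"] e by auto
  then obtain k where k: "finite k" "K \<subseteq> (\<Union>x\<in>k. ball x (e/3))"
    unfolding compact_eq_totally_bounded using e by (meson divide_pos_pos zero_less_numeral)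
  \<comment> \<open>Closed balls of radius 2e/3 also cover the closure of S, and still fit into the
    open balls of radius e.\<close>
  have "S \<subseteq> (\<Union>x\<in>k. cball x (2*e/3))"
  proof
    fix x assume "x \<in> S"
    then obtain y where y: "y \<in> K" "dist x y < e/3" using K by blast
    then obtain z where z: "z \<in> k" "dist z y < e/3" using k by auto
    have "dist z x \<le> 2*e/3" using dist_triangle[of z x y] y z by (simp add: dist_commute)
    then show "x \<in> (\<Union>x\<in>k. cball x (2*e/3))" using z by auto
  qed
  then have "closure S \<subseteq> (\<Union>x\<in>k. cball x (2*e/3))"
    using k by (intro closure_minimal closed_UN) auto
  also have "\<dots> \<subseteq> (\<Union>x\<in>k. ball x e)" using e by force
  finally show "\<exists>k. finite k \<and> closure S \<subseteq> (\<Union>x\<in>k. ball x e)" using k(1) by blast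
qed

lemma simple_idealD:
  assumes "simple_algebra TYPE('a::cstar_algebra)" "closed_ideal I" "x \<in> I" "x \<noteq> (0::'a)"
  shows "y \<in> I"
  using assms unfolding simple_algebra_def by blast

section \<open>The Hilbert space A p of a minimal projection p\<close>

locale minimal_projection =
  fixes p :: "'a::cstar_algebra"
  assumes simple: "simple_algebra TYPE('a)"
    and star_p: "star p = p" and p_p: "p * p = p" and p_nonzero: "p \<noteq> 0"
    and corner: "\<exists>c. p * x * p = c *\<^sub>C p"
begin

definition H :: "'a set" where "H = {x. x * p = x}"

definition coef :: "'a \<Rightarrow> complex" where "coef z = (SOME c. z = c *\<^sub>C p)"

definition ip :: "'a \<Rightarrow> 'a \<Rightarrow> complex" where "ip x y = coef (star y * x)"

definition B :: "'a set" where "B = {x \<in> H. norm x \<le> 1}"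

lemma norm_p: "norm p = 1"
  using norm_sa_square[of p] p_nonzero by (auto simp: sa_def star_p p_p power2_eq_square)

lemma scaleC_p_inject: "c *\<^sub>C p = d *\<^sub>C p \<longleftrightarrow> c = d"
proof
  assume "c *\<^sub>C p = d *\<^sub>C p"
  then have "norm ((c - d) *\<^sub>C p) = 0"
    by (metis scaleC_add_left diff_add_cancel add_0 add_diff_cancel_right' diff_self norm_zero)
  then show "c = d" by (simp add: norm_scaleC norm_p)
qed simp

lemma coef_scaleC [simp]: "coef (c *\<^sub>C p) = c"
  unfolding coef_def by (rule some_equality) (simp_all add: scaleC_p_inject)

lemma corner_coef:
  assumes "p * z = z" "z * p = z"
  shows "z = coef z *\<^sub>C p"
proof -
  obtain c where "z = c *\<^sub>C p" using corner[of z] assms by auto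
  then show ?thesis by simp
qed

lemma H_D: "x \<in> H \<Longrightarrow> x * p = x" by (simp add: H_def)

lemma H_I [simp]: "x * p \<in> H" by (simp add: H_def mult.assoc p_p)

lemma p_star: "x \<in> H \<Longrightarrow> p * star x = star x"
  by (metis H_D star_mult star_p)

lemma H_closed [simp]:
  "0 \<in> H" "x \<in> H \<Longrightarrow> y \<in> H \<Longrightarrow> x + y \<in> H" "x \<in> H \<Longrightarrow> y \<in> H \<Longrightarrow> x - y \<in> H"
  "x \<in> H \<Longrightarrow> c *\<^sub>C x \<in> H" "x \<in> H \<Longrightarrow> r *\<^sub>R x \<in> H" "x \<in> H \<Longrightarrow> a * x \<in> H" "p \<in> H"
  by (simp_all add: H_def algebra_simps mult_scaleC_left p_p)

lemma star_mult_H: "x \<in> H \<Longrightarrow> y \<in> H \<Longrightarrow> star y * x = ip x y *\<^sub>C p"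
  unfolding ip_def
  by (rule corner_coef) (simp_all add: p_star H_D mult.assoc flip: mult.assoc[of p])

lemma ip_eqI: "x \<in> H \<Longrightarrow> y \<in> H \<Longrightarrow> star y * x = c *\<^sub>C p \<Longrightarrow> ip x y = c"
  by (simp add: ip_def)

lemma p_mult_H: "x \<in> H \<Longrightarrow> p * x = coef (p * x) *\<^sub>C p"
  by (rule corner_coef) (simp_all add: H_D mult.assoc p_p flip: mult.assoc[of p])

text \<open>The modulus comes from the C*-identity; the substance is the sign. A negative value
  would make star x * x the negative of the square of \<open>q\<close>, against the behaviour of
  \<open>fc abs\<close> on both. Consequently the Hilbert norm is the norm of the algebra, and
  completeness and compactness can be checked there.\<close>

lemma ip_self_norm: "x \<in> H \<Longrightarrow> ip x x = complex_of_real ((norm x)\<^sup>2)"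
proof -
  assume x: "x \<in> H"
  define c where "c = ip x x"
  have c: "star x * x = c *\<^sub>C p" unfolding c_def by (rule star_mult_H[OF x x])
  have nc: "cmod c = (norm x)\<^sup>2" using cstar_identity[of x] by (simp add: c norm_scaleC norm_p)
  have "star (star x * x) = star x * x" by (simp add: star_mult star_star)
  then have "cnj c *\<^sub>C p = c *\<^sub>C p" unfolding c by (simp add: star_scaleC star_p)
  then have "c \<in> \<real>" by (simp add: scaleC_p_inject Reals_cnj_iff)
  then obtain r where r: "c = of_real r" by (auto simp: Reals_def)
  show ?thesis
  proof (cases "r \<ge> 0")
    case True
    then show ?thesis using nc r by (simp add: c_def)
  next
    case False
    define q where "q = sqrt (- r) *\<^sub>R mult_embed p"
    have "sa p" by (simp add: sa_def star_p)
    then have q: "sa q" unfolding q_def by (intro sa_intros(5)) simp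
    have "mult_embed (star x * x) = - (q * q)"
      unfolding c r q_def using False
      by (simp add: mult_embed_simps(4) p_p flip: scaleR_scaleC mult_embed_simps(5))
    then have "- (q * q) = q * q"
      using fc_abs_square(2)[OF q] fc_abs_star_mult_self[of "mult_embed x"]
      by (simp add: mult_embed_simps(5,6))
    then have "2 *\<^sub>R (q * q) = 0" by (metis add.left_inverse scaleR_2)
    then have "q = 0" using sa_square_eq_0[OF q] by simp
    moreover have "norm q > 0" using False by (simp add: q_def norm_p)
    ultimately show ?thesis by simp
  qed
qed

sublocale hs: pre_hilbert_space H 0 "(+)" "(*\<^sub>C)" ip
proof
  fix x y z c d
  assume x: "x \<in> H"
  show "0 < Re (ip x x)" if "x \<noteq> 0" using ip_self_norm[OF x] that by simp
  assume y: "y \<in> H"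
  show "ip (c *\<^sub>C x) y = c * ip x y"
    using x y by (intro ip_eqI) (simp_all add: mult_scaleC_right star_mult_H scaleC_scaleC)
  show "ip y x = cnj (ip x y)"
  proof (rule ip_eqI[OF y x])
    have "star x * y = star (star y * x)" by (simp add: star_mult star_star)
    then show "star x * y = cnj (ip x y) *\<^sub>C p" by (simp add: star_mult_H x y star_scaleC star_p)
  qed
  assume z: "z \<in> H"
  show "ip (x + y) z = ip x z + ip y z"
    using x y z by (intro ip_eqI) (simp_all add: distrib_left star_mult_H scaleC_add_left)
qed (simp_all add: algebra_simps scaleC_scaleC scaleC_add_left scaleC_add_right)

lemma hnorm_eq: "x \<in> H \<Longrightarrow> hs.hnorm x = norm x"
  by (simp add: hs.hnorm_def ip_self_norm)

lemma hdist_eq: "x \<in> H \<Longrightarrow> y \<in> H \<Longrightarrow> hs.hdist x y = dist x y"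
  by (simp add: hs.hdist_def hnorm_eq dist_norm scaleC_minus_left)

lemma closed_H: "closed H"
  unfolding H_def by (intro closed_Collect_eq continuous_intros)

lemma mtopology_eq: "hs.hm.mtopology = top_of_set H"
proof -
  have mb: "hs.hm.mball x r \<subseteq> U \<longleftrightarrow> (\<forall>y\<in>H. dist y x < r \<longrightarrow> y \<in> U)" if "x \<in> H" for x r U
    using that by (auto simp: subset_iff hdist_eq dist_commute)
  have "openin hs.hm.mtopology U \<longleftrightarrow> openin (top_of_set H) U" for U
  proof (cases "U \<subseteq> H")
    case True
    then have "x \<in> H" if "x \<in> U" for x using that by blast
    then show ?thesis
      unfolding hs.hm.openin_mtopology openin_euclidean_subtopology_iff using True mb by (simp add: Ball_def)
  qed (simp add: hs.hm.openin_mtopology openin_euclidean_subtopology_iff)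
  then show ?thesis by (simp add: topology_eq)
qed

lemma hilbert: "hilbert_space H 0 (+) (*\<^sub>C) ip"
proof unfold_locales
  show "hs.hm.mcomplete"
    unfolding hs.hm.mcomplete_def
  proof (intro allI impI)
    fix s assume s: "hs.hm.MCauchy s"
    then have sH: "s n \<in> H" for n by (auto simp: hs.hm.MCauchy_def)
    have "Cauchy s"
      using s sH unfolding hs.hm.MCauchy_def Cauchy_def by (simp add: hdist_eq)
    then obtain x where x: "s \<longlonglongrightarrow> x" by (auto simp: Cauchy_convergent_iff convergent_def)
    then have "x \<in> H" using closed_sequentially[OF closed_H sH] by simp
    then have "limitin hs.hm.mtopology s x sequentially"
      unfolding mtopology_eq limitin_subtopology using x sH by simp
    then show "\<exists>x. limitin hs.hm.mtopology s x sequentially" by blast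
  qed
qed

lemma B_hnorm: "{x \<in> H. hs.hnorm x \<le> 1} = B"
  by (auto simp: B_def hnorm_eq)

lemma compact_operators_eq:
  "hs.compact_operators = {T \<in> H \<rightarrow>\<^sub>E H.
     (\<forall>x\<in>H. \<forall>y\<in>H. T (x + y) = T x + T y) \<and> (\<forall>c. \<forall>x\<in>H. T (c *\<^sub>C x) = c *\<^sub>C T x) \<and>
     compact (closure (T ` B))}"
proof -
  have "compactin hs.hm.mtopology (hs.hm.mtopology closure_of (T ` B)) \<longleftrightarrow> compact (closure (T ` B))"
    if "T \<in> H \<rightarrow>\<^sub>E H" for T
  proof -
    have sub: "T ` B \<subseteq> H" using that by (auto simp: B_def)
    then have "closure (T ` B) \<subseteq> H" using closed_H closure_minimal by blast
    with sub show ?thesis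
      unfolding mtopology_eq closure_of_subtopology compactin_subtopology
      by (simp add: Int_absorb1 Int_absorb2 euclidean_closure_of compactin_euclidean_iff)
  qed
  then show ?thesis unfolding hs.compact_operators_def B_hnorm by blast
qed

lemma faithful: "a \<noteq> 0 \<Longrightarrow> \<exists>z\<in>H. a * z \<noteq> 0"
  using simple_imp_prime[OF simple, of a p] p_nonzero by (metis H_I mult.assoc)

text \<open>This is the part of the isometry of the action on A p that is not evident. With h = star
  a * a scaled to norm 1, vectors y = G(h) z with G living near the top of the spectrum are almost
  fixed by h * h; as h * y is computed through a * y, the bound on \<open>B\<close> reaches the norm
  of a up to a factor 1 - 4e.\<close>

lemma norm_le_if_bounded_on_B:
  assumes R: "\<And>z. z \<in> B \<Longrightarrow> norm (a * z) \<le> R"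
  shows "norm a \<le> R"
proof (cases "a = 0")
  case True
  then show ?thesis using R[of 0] by (simp add: B_def)
next
  case False
  have RH: "norm (a * z) \<le> R * norm z" if "z \<in> H" for z
  proof (cases "z = 0")
    case False
    then have "norm (a * ((1 / norm z) *\<^sub>R z)) \<le> R" using that by (intro R) (simp add: B_def)
    then show ?thesis using False by (simp add: field_simps)
  qed simp
  define N where "N = norm a"
  have N: "N > 0" using False by (simp add: N_def)
  define h where "h = (1 / N\<^sup>2) *\<^sub>R (star a * a)"
  have h: "sa h" "norm h = 1" using N by (simp_all add: h_def sa_intros cstar_identity N_def)
  have key: "(1 - 4 * e) * N \<le> R" if e: "0 < e" "e < 1/4" for e
  proof -
    define c where "c = 1 - e"
    define c' where "c' = 1 - 2 * e"
    have c: "0 < c" "c < 1" using e by (auto simp: c_def)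
    \<comment> \<open>G lives on |t| > 1 - e, where k is 1, and k vanishes below 1 - 2e; the ramp of
      width e between the thresholds keeps k continuous.\<close>
    define G where "G t = \<bar>t\<bar> * max (\<bar>t\<bar> - c) 0" for t :: real
    define k where "k t = min 1 (max 0 ((\<bar>t\<bar> - c') / e))" for t :: real
    have cG: "continuous_on UNIV G" and ck: "continuous_on UNIV k"
      unfolding G_def k_def using e by (auto intro!: continuous_intros)
    have G0: "G 0 = 0" and k0: "k 0 = 0" using e by (auto simp: G_def k_def c'_def max_def field_simps)
    have kG: "k t * G t = G t" for t
      using e by (auto simp: k_def G_def c_def c'_def min_def max_def field_simps)
    have "fc0 G h \<noteq> 0" using top_of_spectrum[OF h c] by (auto simp: G_def[abs_def])
    then obtain z where z: "z \<in> H" "fc0 G h * z \<noteq> 0" using faithful by blast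
    define y where "y = fc0 G h * z"
    have yH: "y \<in> H" and y0: "y \<noteq> 0" using z by (simp_all add: y_def)
    have "fc0 k h * fc0 G h = fc0 G h"
      using fc0_mult[OF ck k0 cG G0 h(1)] kG by simp
    then have ky: "fc0 k h * y = y" by (simp add: y_def flip: mult.assoc)
    \<comment> \<open>The comparison uses h * h and not h, because the functions on the interval do
      not see that h is positive, and near t = -1 only t * t is close to 1.\<close>
    have "fc0 (\<lambda>t. k t - (t * t) * k t) h = fc0 k h - fc0 (\<lambda>t. (t * t) * k t) h"
      by (rule fc0_diff) (intro continuous_intros ck h | simp add: k0)+
    also have "fc0 (\<lambda>t. (t * t) * k t) h = fc0 (\<lambda>t. t * t) h * fc0 k h"
      by (rule fc0_mult) (intro continuous_intros ck h | simp add: k0)+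
    also have "fc0 (\<lambda>t. t * t) h = h * h" using h by (simp add: fc0_mult fc0_ident)
    finally have id: "fc0 (\<lambda>t. k t - (t * t) * k t) h * y = y - h * (h * y)"
      by (simp add: left_diff_distrib ky mult.assoc)
    have "norm (fc0 (\<lambda>t. k t - (t * t) * k t) h) \<le> 4 * e"
    proof (rule norm_fc0_le[of _ _ 1])
      fix t :: real assume t: "\<bar>t\<bar> \<le> 1"
      show "\<bar>k t - (t * t) * k t\<bar> \<le> 4 * e"
      proof (cases "\<bar>t\<bar> \<le> c'")
        case True
        then have "(\<bar>t\<bar> - c') / e \<le> 0" using e by (simp add: divide_le_0_iff)
        then have "k t = 0" by (simp add: k_def max_def)
        then show ?thesis using e by simp
      next
        case False
        have "c' * c' \<le> \<bar>t\<bar> * \<bar>t\<bar>" using False e by (intro mult_mono) (auto simp: c'_def)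
        moreover have "c' * c' = 1 - 4 * e + 4 * (e * e)" by (simp add: c'_def algebra_simps)
        moreover have "0 \<le> e * e" "\<bar>t\<bar> * \<bar>t\<bar> = t * t" by simp_all
        ultimately have "1 - t * t \<le> 4 * e" by linarith
        moreover have "0 \<le> 1 - t * t" using t abs_square_le_1[of t] by (simp add: power2_eq_square)
        moreover have "0 \<le> k t" "k t \<le> 1" by (auto simp: k_def)
        ultimately have "\<bar>k t * (1 - t * t)\<bar> \<le> 4 * e"
          using mult_mono[of "k t" 1 "1 - t * t" "4 * e"] by (simp add: abs_mult)
        then show ?thesis by (simp add: algebra_simps)
      qed
    qed (use h ck k0 in \<open>auto intro!: continuous_intros\<close>)
    then have "norm (fc0 (\<lambda>t. k t - (t * t) * k t) h * y) \<le> 4 * e * norm y"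
      by (rule order_trans[OF norm_mult_ineq mult_right_mono]) simp
    then have "norm (y - h * (h * y)) \<le> 4 * e * norm y" by (simp only: id)
    moreover have "norm (h * (h * y)) \<le> norm (h * y)" using norm_mult_ineq[of h "h * y"] h(2) by simp
    moreover have "norm y \<le> norm (y - h * (h * y)) + norm (h * (h * y))"
      using norm_triangle_sub[of y "h * (h * y)"] by simp
    ultimately have 1: "(1 - 4 * e) * norm y \<le> norm (h * y)" by (simp add: algebra_simps)
    have "norm (h * y) = norm (star a * (a * y)) / N\<^sup>2" by (simp add: h_def mult.assoc)
    also have "norm (star a * (a * y)) \<le> N * (R * norm y)"
      using norm_mult_ineq[of "star a" "a * y"] mult_left_mono[OF RH[OF yH], of N]
      by (simp add: N_def)
    finally have "(1 - 4 * e) * norm y \<le> N * (R * norm y) / N\<^sup>2"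
      using 1 N by (auto simp: divide_right_mono)
    also have "\<dots> = R * norm y / N" using N by (simp add: power2_eq_square)
    finally have "(1 - 4 * e) * N * norm y \<le> R * norm y" using N by (simp add: field_simps)
    then show ?thesis using y0 by simp
  qed
  show ?thesis
  proof (rule field_le_epsilon)
    fix d :: real assume d: "d > 0"
    define e where "e = min (1/5) (d / (4 * N))"
    have e: "0 < e" "e < 1/4" "4 * e * N \<le> d"
      using d N by (auto simp: e_def min_def field_simps)
    show "norm a \<le> R + d" using key[OF e(1,2)] e(3) by (simp add: N_def algebra_simps)
  qed
qed

end

section \<open>Left multiplications on A p are exactly the compact operators\<close>

context minimal_projection
begin

lemma B_scale: "z \<in> H \<Longrightarrow> norm z \<le> s \<Longrightarrow> s > 0 \<Longrightarrow> (1 / s) *\<^sub>R z \<in> B"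
  by (simp add: B_def)

text \<open>The elements that map the unit ball \<open>B\<close> into a compact set form a closed
  ideal. It contains p, since p B lies in a disc of multiples of p, so by simplicity it is
  everything.\<close>

lemma compact_left_mult: "compact (closure ((*) a ` B))"
proof -
  define J where "J = {a::'a. \<exists>K. compact K \<and> (\<forall>z\<in>B. a * z \<in> K)}"
  have "a \<in> J"
  proof (rule simple_idealD[OF simple _ _ p_nonzero])
    show "p \<in> J"
    proof -
      have "p * z \<in> (\<lambda>c. c *\<^sub>C p) ` cball 0 1" if "z \<in> B" for z
      proof -
        have z: "z \<in> H" "norm z \<le> 1" using that by (auto simp: B_def)
        have "norm (p * z) \<le> 1" using norm_mult_ineq[of p z] z norm_p by simp
        moreover have "p * z = coef (p * z) *\<^sub>C p" by (rule p_mult_H[OF z(1)])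
        ultimately have "cmod (coef (p * z)) \<le> 1" by (metis norm_scaleC norm_p mult.right_neutral)
        then show ?thesis using \<open>p * z = coef (p * z) *\<^sub>C p\<close> by auto
      qed
      moreover have "compact ((\<lambda>c. c *\<^sub>C p) ` cball 0 1)"
        by (intro compact_continuous_image linear_continuous_on bounded_linear_scaleC_left compact_cball)
      ultimately show ?thesis unfolding J_def by blast
    qed
    have "closed J"
      unfolding closed_sequential_limits
    proof (intro allI impI, elim conjE)
      fix x and a :: 'a assume x: "\<forall>n. x n \<in> J" and lim: "x \<longlonglongrightarrow> a"
      have "compact (closure ((*) a ` B))"
      proof (rule compact_closure_if_approximable)
        fix e :: real assume "e > 0"
        then obtain n where n: "norm (x n - a) < e" using LIMSEQ_D[OF lim] by blast
        obtain K where K: "compact K" "\<forall>z\<in>B. x n * z \<in> K" using x by (auto simp: J_def)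
        have "dist (a * z) (x n * z) < e" if "z \<in> B" for z
        proof -
          have "norm (a * z - x n * z) \<le> norm (a - x n) * norm z"
            using norm_mult_ineq[of "a - x n" z] by (simp add: left_diff_distrib)
          also have "\<dots> \<le> norm (a - x n) * 1" using that by (intro mult_left_mono) (auto simp: B_def)
          finally show ?thesis using n by (simp add: dist_norm norm_minus_commute)
        qed
        then show "\<exists>K. compact K \<and> (\<forall>u\<in>(*) a ` B. \<exists>y\<in>K. dist u y < e)"
          using K by blast
      qed
      moreover have "a * z \<in> closure ((*) a ` B)" if "z \<in> B" for z
        using that closure_subset[of "(*) a ` B"] by blast
      ultimately show "a \<in> J" unfolding J_def by blast
    qed
    moreover have "0 \<in> J" unfolding J_def by (auto intro!: exI[of _ "{0}"])
    moreover have "a + b \<in> J" if ab: "a \<in> J" "b \<in> J" for a b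
    proof -
      obtain K where K: "compact K" "\<forall>z\<in>B. a * z \<in> K" using ab(1) by (auto simp: J_def)
      obtain L where L: "compact L" "\<forall>z\<in>B. b * z \<in> L" using ab(2) by (auto simp: J_def)
      have "compact {x + y | x y. x \<in> K \<and> y \<in> L}" by (intro compact_sums K L)
      moreover have "\<forall>z\<in>B. (a + b) * z \<in> {x + y | x y. x \<in> K \<and> y \<in> L}"
        using K(2) L(2) by (simp add: distrib_right) blast
      ultimately show ?thesis unfolding J_def by blast
    qed
    moreover have "c *\<^sub>C a \<in> J" "b * a \<in> J" "a * b \<in> J" if a: "a \<in> J" for a b c
    proof -
      obtain K where K: "compact K" "\<forall>z\<in>B. a * z \<in> K" using a by (auto simp: J_def)
      have "compact ((\<lambda>x. c *\<^sub>C x) ` K)"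
        by (intro compact_continuous_image linear_continuous_on bounded_linear_scaleC K)
      moreover have "\<forall>z\<in>B. c *\<^sub>C a * z \<in> (\<lambda>x. c *\<^sub>C x) ` K" using K by (auto simp: mult_scaleC_left)
      ultimately show "c *\<^sub>C a \<in> J" unfolding J_def by blast
      have "compact ((*) b ` K)"
        by (intro compact_continuous_image K continuous_intros)
      moreover have "\<forall>z\<in>B. b * a * z \<in> (*) b ` K" using K by (auto simp: mult.assoc)
      ultimately show "b * a \<in> J" unfolding J_def by blast
      \<comment> \<open>b maps \<open>B\<close> into s times \<open>B\<close>; the summand 1 allows
        division by s when b = 0.\<close>
      define s where "s = norm b + 1"
      have s: "s > 0" by (simp add: s_def add_nonneg_pos)
      have "compact ((*\<^sub>R) s ` K)"
        by (intro compact_scaling K)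
      moreover have "a * b * z \<in> (*\<^sub>R) s ` K" if z: "z \<in> B" for z
      proof -
        have "norm (b * z) \<le> norm b * 1"
          using z by (intro order_trans[OF norm_mult_ineq] mult_left_mono) (auto simp: B_def)
        then have "(1 / s) *\<^sub>R (b * z) \<in> B" using z s by (intro B_scale) (auto simp: B_def s_def)
        then have "a * ((1 / s) *\<^sub>R (b * z)) \<in> K" using K by blast
        moreover have "a * b * z = s *\<^sub>R (a * ((1 / s) *\<^sub>R (b * z)))" using s by (simp add: mult.assoc)
        ultimately show ?thesis by blast
      qed
      ultimately show "a * b \<in> J" unfolding J_def by blast
    qed
    ultimately show "closed_ideal J" unfolding closed_ideal_def by simp
  qed
  then obtain K where K: "compact K" "\<forall>z\<in>B. a * z \<in> K" by (auto simp: J_def)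
  then have "closure ((*) a ` B) \<subseteq> K" by (intro closure_minimal compact_imp_closed) auto
  then have "closure ((*) a ` B) = K \<inter> closure ((*) a ` B)" by blast
  also have "compact \<dots>" by (intro compact_Int_closed K closed_closure)
  finally show ?thesis .
qed

text \<open>Values off \<open>H\<close> are left free, so composing with a left multiplication stays
  inside the notion without restricting functions again.\<close>

definition bounded_operator :: "('a \<Rightarrow> 'a) \<Rightarrow> bool"
  where "bounded_operator T \<longleftrightarrow> (\<forall>x\<in>H. T x \<in> H) \<and> (\<forall>x\<in>H. \<forall>y\<in>H. T (x + y) = T x + T y) \<and>
    (\<forall>c. \<forall>x\<in>H. T (c *\<^sub>C x) = c *\<^sub>C T x) \<and> (\<exists>M. \<forall>x\<in>H. norm (T x) \<le> M * norm x)"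

lemma bounded_operatorD:
  assumes "bounded_operator T"
  shows "x \<in> H \<Longrightarrow> T x \<in> H" "x \<in> H \<Longrightarrow> y \<in> H \<Longrightarrow> T (x + y) = T x + T y"
    "x \<in> H \<Longrightarrow> T (c *\<^sub>C x) = c *\<^sub>C T x" "x \<in> H \<Longrightarrow> y \<in> H \<Longrightarrow> T (x - y) = T x - T y"
proof -
  show add: "x \<in> H \<Longrightarrow> y \<in> H \<Longrightarrow> T (x + y) = T x + T y"
    and sc: "x \<in> H \<Longrightarrow> T (c *\<^sub>C x) = c *\<^sub>C T x" and "x \<in> H \<Longrightarrow> T x \<in> H" for x y c
    using assms by (auto simp: bounded_operator_def)
  assume x: "x \<in> H" and y: "y \<in> H"
  have "T (x + (-1) *\<^sub>C y) = T x + (-1) *\<^sub>C T y" using x y by (simp add: add sc)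
  then show "T (x - y) = T x - T y" by (simp add: scaleC_minus_left)
qed

lemma bounded_operator_tendsto:
  assumes T: "bounded_operator T" and z: "\<And>n. z n \<in> H" "z \<longlonglongrightarrow> x"
  shows "(\<lambda>n. T (z n)) \<longlonglongrightarrow> T x"
proof -
  have x: "x \<in> H" using closed_sequentially[OF closed_H z] .
  obtain M where M: "\<And>x. x \<in> H \<Longrightarrow> norm (T x) \<le> M * norm x"
    using T unfolding bounded_operator_def by blast
  have "(\<lambda>n. M * norm (z n - x)) \<longlonglongrightarrow> M * 0"
    by (intro tendsto_intros tendsto_norm_zero) (use z(2) in \<open>simp add: LIM_zero\<close>)
  then have "(\<lambda>n. M * norm (z n - x)) \<longlonglongrightarrow> 0" by simp
  then have "(\<lambda>n. T (z n) - T x) \<longlonglongrightarrow> 0"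
    by (rule Lim_null_comparison[rotated])
       (use M z(1) x in \<open>auto simp flip: bounded_operatorD(4)[OF T]\<close>)
  then show ?thesis by (rule LIM_zero_cancel)
qed

text \<open>The Riesz representation of \<open>z \<mapsto> p (T z)\<close>, by the vector of least norm where it takes the value \<open>p\<close>.\<close>

lemma riesz:
  assumes T: "bounded_operator T"
  shows "\<exists>w. \<forall>z\<in>H. w * z = p * T z"
proof (cases "\<forall>z\<in>H. p * T z = 0")
  case True
  then show ?thesis by (intro exI[of _ 0]) simp
next
  case False
  note TD = bounded_operatorD[OF T]
  define \<phi> where "\<phi> z = coef (p * T z)" for z
  have \<phi>: "p * T z = \<phi> z *\<^sub>C p" if "z \<in> H" for z
    unfolding \<phi>_def by (rule p_mult_H) (simp add: TD that)
  define K where "K = {z \<in> H. p * T z = p}"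
  obtain u where u: "u \<in> H" "p * T u \<noteq> 0" using False by blast
  then have "\<phi> u \<noteq> 0" using \<phi>[OF u(1)] by auto
  then have "(1 / \<phi> u) *\<^sub>C u \<in> K"
    using u \<phi>[OF u(1)] by (simp add: K_def TD mult_scaleC_right scaleC_scaleC)
  then have K: "K \<noteq> {}" by blast
  define d where "d = Inf (norm ` K)"
  have dle: "d \<le> norm z" if "z \<in> K" for z
    unfolding d_def using that by (intro cInf_lower bdd_belowI[of _ 0]) auto
  have "\<exists>z. z \<in> K \<and> norm z < d + inverse (real (Suc n))" for n
    using cInf_lessD[of "norm ` K" "d + inverse (real (Suc n))"] K by (auto simp: d_def)
  from choice[OF allI[OF this]] obtain z where "\<forall>n. z n \<in> K \<and> norm (z n) < d + inverse (real (Suc n))" ..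
  then have z: "z n \<in> K" "norm (z n) < d + inverse (real (Suc n))" for n by simp_all
  have zH: "z n \<in> H" for n using z(1) by (simp add: K_def)
  have d0: "d \<ge> 0" unfolding d_def using K by (intro cInf_greatest) auto
  \<comment> \<open>\<open>K\<close> is convex, so midpoints of its points have norm at least d.
    With the parallelogram law \<open>par\<close> this makes the minimizing sequence Cauchy.\<close>
  have mid: "4 * d\<^sup>2 \<le> (norm (x + y))\<^sup>2" if "x \<in> K" "y \<in> K" for x y
  proof -
    have xy: "x \<in> H" "y \<in> H" "p * T x = p" "p * T y = p" using that by (simp_all add: K_def)
    have "p * T ((1/2) *\<^sub>C (x + y)) = (1/2) *\<^sub>C (p + p)"
      by (simp add: xy TD mult_scaleC_right distrib_left)
    also have "\<dots> = (1/2) *\<^sub>C (2 *\<^sub>C p)" using scaleC_add_left[of 1 1 p] by simp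
    also have "\<dots> = p" by (simp add: scaleC_scaleC del: scaleC_add_left)
    finally have "(1/2) *\<^sub>C (x + y) \<in> K" using xy by (simp add: K_def)
    from dle[OF this] have "2 * d \<le> norm (x + y)" by (simp add: norm_scaleC)
    then have "(2 * d)\<^sup>2 \<le> (norm (x + y))\<^sup>2" using d0 by (intro power_mono) auto
    then show ?thesis by simp
  qed
  have par: "(norm (x - y))\<^sup>2 = 2 * (norm x)\<^sup>2 + 2 * (norm y)\<^sup>2 - (norm (x + y))\<^sup>2" if "x \<in> H" "y \<in> H" for x y
    using hs.hnorm_add_sq[of x y] hs.hnorm_add_sq[of x "(-1) *\<^sub>C y"] that
    by (simp add: hnorm_eq hs.ip_scale_right) (simp add: scaleC_minus_left hnorm_eq)
  have "Cauchy z"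
  proof (rule metric_CauchyI)
    fix e :: real assume e: "e > 0"
    have "(\<lambda>n. 4 * (d + inverse (real (Suc n)))\<^sup>2 - 4 * d\<^sup>2) \<longlonglongrightarrow> 4 * (d + 0)\<^sup>2 - 4 * d\<^sup>2"
      by (intro tendsto_intros LIMSEQ_inverse_real_of_nat)
    then have "\<forall>\<^sub>F n in sequentially. 4 * (d + inverse (real (Suc n)))\<^sup>2 - 4 * d\<^sup>2 < e\<^sup>2"
      using order_tendstoD(2)[of _ 0 sequentially "e\<^sup>2"] e by simp
    then obtain N where N: "4 * (d + inverse (real (Suc N)))\<^sup>2 - 4 * d\<^sup>2 < e\<^sup>2"
      by (auto simp: eventually_sequentially)
    have bd: "(norm (z n))\<^sup>2 \<le> (d + inverse (real (Suc N)))\<^sup>2" if "n \<ge> N" for n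
    proof (rule power_mono)
      have "inverse (real (Suc n)) \<le> inverse (real (Suc N))" using that by (intro le_imp_inverse_le) auto
      then show "norm (z n) \<le> d + inverse (real (Suc N))" using z(2)[of n] by linarith
    qed simp
    have "dist (z m) (z n) < e" if "m \<ge> N" "n \<ge> N" for m n
    proof -
      have "(norm (z m - z n))\<^sup>2 < e\<^sup>2"
        unfolding par[OF zH zH] using mid[OF z(1) z(1), of m n] bd[OF that(1)] bd[OF that(2)] N by linarith
      then show ?thesis using e power2_less_imp_less[of "norm (z m - z n)" e] by (simp add: dist_norm)
    qed
    then show "\<exists>M. \<forall>m\<ge>M. \<forall>n\<ge>M. dist (z m) (z n) < e" by blast
  qed
  then obtain x where x: "z \<longlonglongrightarrow> x" by (auto simp: Cauchy_convergent_iff convergent_def)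
  have xH: "x \<in> H" using closed_sequentially[OF closed_H zH x] .
  have "(\<lambda>n. p * T (z n)) \<longlonglongrightarrow> p * T x"
    by (intro tendsto_mult tendsto_const bounded_operator_tendsto[OF T zH x])
  then have px: "p * T x = p" using z(1) by (simp add: K_def LIMSEQ_const_iff)
  have "(\<lambda>n. d + inverse (real (Suc n))) \<longlonglongrightarrow> d + 0"
    by (intro tendsto_intros LIMSEQ_inverse_real_of_nat)
  then have "norm x \<le> d"
    using tendsto_norm[OF x] z(2) by (intro LIMSEQ_le[of _ _ _ d]) (auto intro: less_imp_le)
  then have nx: "norm x \<le> norm y" if "y \<in> K" for y using dle[OF that] by simp
  have orth: "ip x v = 0" if v: "v \<in> H" "p * T v = 0" for v
  proof (cases "v = 0")
    case False
    \<comment> \<open>The coefficient that minimizes the norm of x + c v; unless ip x v = 0 it would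
      make this vector of \<open>K\<close> shorter than x.\<close>
    define c where "c = - ip x v / complex_of_real ((norm v)\<^sup>2)"
    have "x + c *\<^sub>C v \<in> K"
      using v xH px by (simp add: K_def TD distrib_left mult_scaleC_right)
    from nx[OF this] have "(norm x)\<^sup>2 \<le> (norm (x + c *\<^sub>C v))\<^sup>2" by (intro power_mono) auto
    also have "\<dots> = (norm x)\<^sup>2 + (cmod c * norm v)\<^sup>2 + 2 * Re (cnj c * ip x v)"
      using hs.hnorm_add_sq[of x "c *\<^sub>C v"] xH v by (simp add: hnorm_eq hs.ip_scale_right norm_scaleC)
    also have "cnj c * ip x v = complex_of_real (- (cmod (ip x v))\<^sup>2 / (norm v)\<^sup>2)"
      by (simp add: c_def complex_norm_square mult.commute del: of_real_power)
    also have "(cmod c * norm v)\<^sup>2 = (cmod (ip x v))\<^sup>2 / (norm v)\<^sup>2"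
      using False by (simp add: c_def norm_divide power_mult_distrib power_divide norm_power field_simps norm_mult power2_eq_square)
    finally have "(cmod (ip x v))\<^sup>2 / (norm v)\<^sup>2 \<le> 0" by simp
    then show ?thesis using False by (simp add: divide_le_0_iff)
  qed (simp add: hs.ip_zero xH)
  have x0: "x \<noteq> 0"
  proof
    assume "x = 0"
    moreover have "T 0 = 0" using TD(3)[of 0 0] by simp
    ultimately show False using px p_nonzero by simp
  qed
  define w where "w = (1 / (norm x)\<^sup>2) *\<^sub>R star x"
  have "w * y = p * T y" if y: "y \<in> H" for y
  proof -
    have "p * T (y - \<phi> y *\<^sub>C x) = 0"
      using y xH px \<phi>[OF y] by (simp add: TD right_diff_distrib mult_scaleC_right)
    then have "ip x (y - \<phi> y *\<^sub>C x) = 0" using y xH by (intro orth) simp_all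
    then have "ip (y - \<phi> y *\<^sub>C x) x = 0" using hs.ip_cnj[of x "y - \<phi> y *\<^sub>C x"] y xH by simp
    then have "star x * (y - \<phi> y *\<^sub>C x) = 0" using star_mult_H[of "y - \<phi> y *\<^sub>C x" x] y xH by simp
    then have "star x * y = \<phi> y *\<^sub>C (star x * x)" by (simp add: right_diff_distrib mult_scaleC_right)
    also have "star x * x = (norm x)\<^sup>2 *\<^sub>R p" using star_mult_H[OF xH xH] xH by (simp add: ip_self_norm scaleR_scaleC)
    finally show ?thesis
      using x0 by (simp add: w_def \<phi>[OF y] scaleR_scaleC scaleC_scaleC mult_scaleC_left)
  qed
  then show ?thesis by blast
qed

text \<open>The b for which b T is a left multiplication for every T form a closed ideal, and p
  belongs to it by Riesz representation. Quantifying over all T inside makes it a right ideal,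
  because c T is again a bounded operator; closedness uses the isometry of the action.\<close>

lemma left_mult_operator:
  assumes T: "bounded_operator T"
  shows "\<exists>a. \<forall>z\<in>H. a * z = b * T z"
proof -
  define J where "J = {b. \<forall>T. bounded_operator T \<longrightarrow> (\<exists>a. \<forall>z\<in>H. a * z = b * T z)}"
  have "b \<in> J"
  proof (rule simple_idealD[OF simple _ _ p_nonzero])
    show "p \<in> J" using riesz by (simp add: J_def)
    have "closed J"
      unfolding closed_sequential_limits
    proof (intro allI impI, elim conjE)
      fix x and b :: 'a assume x: "\<forall>n. x n \<in> J" and lim: "x \<longlonglongrightarrow> b"
      have "\<exists>a. \<forall>z\<in>H. a * z = b * T z" if T: "bounded_operator T" for T
      proof -
        have "\<forall>n. \<exists>a. \<forall>z\<in>H. a * z = x n * T z" using x T by (simp add: J_def)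
        from choice[OF this] obtain a where "\<forall>n. \<forall>z\<in>H. a n * z = x n * T z" ..
        then have a: "a n * z = x n * T z" if "z \<in> H" for n z using that by simp
        obtain M where M: "\<And>x. x \<in> H \<Longrightarrow> norm (T x) \<le> M * norm x"
          using T unfolding bounded_operator_def by blast
        define L where "L = max M 1"
        have L: "L > 0" by (simp add: L_def)
        have na: "norm (a m - a n) \<le> norm (x m - x n) * L" for m n
        proof (rule norm_le_if_bounded_on_B)
          fix z assume "z \<in> B"
          then have z: "z \<in> H" "norm z \<le> 1" by (auto simp: B_def)
          have "norm (T z) \<le> L * 1"
            by (rule order_trans[OF M[OF z(1)] mult_mono]) (use z in \<open>auto simp: L_def\<close>)
          have "norm ((a m - a n) * z) = norm ((x m - x n) * T z)" using z by (simp add: a left_diff_distrib)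
          also have "\<dots> \<le> norm (x m - x n) * norm (T z)" by (rule norm_mult_ineq)
          also have "\<dots> \<le> norm (x m - x n) * L" using \<open>norm (T z) \<le> L * 1\<close> by (intro mult_left_mono) auto
          finally show "norm ((a m - a n) * z) \<le> norm (x m - x n) * L" .
        qed
        have "Cauchy x" using lim by (rule LIMSEQ_imp_Cauchy)
        have "Cauchy a"
        proof (rule metric_CauchyI)
          fix e :: real assume "e > 0"
          then obtain N where N: "\<forall>m\<ge>N. \<forall>n\<ge>N. dist (x m) (x n) < e / L"
            using metric_CauchyD[OF \<open>Cauchy x\<close>, of "e / L"] L by auto
          have "dist (a m) (a n) < e" if "m \<ge> N" "n \<ge> N" for m n
          proof -
            have "norm (x m - x n) * L < e" using N that L by (simp add: dist_norm field_simps)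
            then show ?thesis using na[of m n] by (simp add: dist_norm)
          qed
          then show "\<exists>M. \<forall>m\<ge>M. \<forall>n\<ge>M. dist (a m) (a n) < e" by blast
        qed
        then obtain \<alpha> where \<alpha>: "a \<longlonglongrightarrow> \<alpha>" by (auto simp: Cauchy_convergent_iff convergent_def)
        have "\<alpha> * z = b * T z" if z: "z \<in> H" for z
          using tendsto_mult[OF \<alpha> tendsto_const[of z]] tendsto_mult[OF lim tendsto_const[of "T z"]]
          unfolding a[OF z] by (rule LIMSEQ_unique)
        then show ?thesis by blast
      qed
      then show "b \<in> J" by (simp add: J_def)
    qed
    moreover have "0 \<in> J" by (auto simp: J_def intro!: exI[of _ 0])
    moreover have "b + c \<in> J" if b: "b \<in> J" and c: "c \<in> J" for b c
      unfolding J_def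
    proof (intro CollectI allI impI)
      fix T assume T: "bounded_operator T"
      obtain u where u: "\<forall>z\<in>H. u * z = b * T z" using b T by (auto simp: J_def)
      obtain v where v: "\<forall>z\<in>H. v * z = c * T z" using c T by (auto simp: J_def)
      show "\<exists>a. \<forall>z\<in>H. a * z = (b + c) * T z"
        by (rule exI[of _ "u + v"]) (simp add: distrib_right u v)
    qed
    moreover have "k *\<^sub>C b \<in> J" "c * b \<in> J" "b * c \<in> J" if b: "b \<in> J" for b c k
    proof -
      show "k *\<^sub>C b \<in> J" "c * b \<in> J"
        unfolding J_def
      proof safe
        fix T assume T: "bounded_operator T"
        obtain u where u: "\<forall>z\<in>H. u * z = b * T z" using b T by (auto simp: J_def)
        show "\<exists>a. \<forall>z\<in>H. a * z = k *\<^sub>C b * T z"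
          by (rule exI[of _ "k *\<^sub>C u"]) (simp add: mult_scaleC_left u)
        show "\<exists>a. \<forall>z\<in>H. a * z = c * b * T z"
          by (rule exI[of _ "c * u"]) (simp add: mult.assoc u)
      qed
      show "b * c \<in> J"
        unfolding J_def
      proof safe
        fix T assume T: "bounded_operator T"
        then obtain M where M: "\<And>x. x \<in> H \<Longrightarrow> norm (T x) \<le> M * norm x"
          unfolding bounded_operator_def by blast
        have "norm (c * T x) \<le> (norm c * M) * norm x" if "x \<in> H" for x
          using norm_mult_ineq[of c "T x"] mult_left_mono[OF M[OF that], of "norm c"] by simp
        then have "bounded_operator (\<lambda>z. c * T z)"
          using T unfolding bounded_operator_def by (auto simp: distrib_left mult_scaleC_right)
        then obtain u where "\<forall>z\<in>H. u * z = b * (c * T z)" using b by (auto simp: J_def)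
        then show "\<exists>a. \<forall>z\<in>H. a * z = b * c * T z" by (auto simp: mult.assoc)
      qed
    qed
    ultimately show "closed_ideal J" unfolding closed_ideal_def by simp
  qed
  then show ?thesis using T by (simp add: J_def)
qed

text \<open>Each e n T is a left multiplication by some a n. As T maps \<open>B\<close> into a
  relatively compact set, e n T tends to T uniformly on \<open>B\<close>, so the a n form a Cauchy
  sequence by the isometry of the action.\<close>

lemma compact_operator_left_mult:
  fixes e :: "nat \<Rightarrow> 'a"
  assumes e: "\<And>n. norm (e n) \<le> 1" "\<And>a. (\<lambda>n. e n * a) \<longlonglongrightarrow> a"
    and T: "bounded_operator T" and cpt: "compact (closure (T ` B))"
  shows "\<exists>a. \<forall>z\<in>H. a * z = T z"
proof -
  have "\<exists>a. \<forall>z\<in>H. a * z = e n * T z" for n by (rule left_mult_operator[OF T])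
  from choice[OF allI[OF this]] obtain a where "\<forall>n. \<forall>z\<in>H. a n * z = e n * T z" ..
  then have a: "a n * z = e n * T z" if "z \<in> H" for n z using that by simp
  have unif: "\<exists>N. \<forall>n\<ge>N. \<forall>z\<in>B. norm (e n * T z - T z) < d" if d: "d > 0" for d
  proof -
    obtain k where k: "finite k" "closure (T ` B) \<subseteq> (\<Union>x\<in>k. ball x (d/4))"
      using cpt d unfolding compact_eq_totally_bounded by (meson divide_pos_pos zero_less_numeral)
    have "\<forall>\<^sub>F n in sequentially. norm (e n * x - x) < d/4" for x
      using tendstoD[OF e(2)[of x], of "d/4"] d by (simp add: dist_norm)
    then have "\<forall>\<^sub>F n in sequentially. \<forall>x\<in>k. norm (e n * x - x) < d/4"
      using k(1) by (simp add: eventually_ball_finite)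
    then obtain N where N: "\<And>n x. n \<ge> N \<Longrightarrow> x \<in> k \<Longrightarrow> norm (e n * x - x) < d/4"
      by (auto simp: eventually_sequentially)
    have "norm (e n * T z - T z) < d" if n: "n \<ge> N" and z: "z \<in> B" for n z
    proof -
      have "T z \<in> closure (T ` B)" using z closure_subset[of "T ` B"] by blast
      then obtain x where x: "x \<in> k" "norm (x - T z) < d/4" using k(2) by (auto simp: dist_norm)
      have "e n * T z - T z = e n * (T z - x) + (e n * x - x) + (x - T z)"
        by (simp add: right_diff_distrib)
      then have "norm (e n * T z - T z) \<le> norm (e n * (T z - x)) + norm (e n * x - x) + norm (x - T z)"
        by (metis norm_triangle_ineq norm_triangle_le order_trans add_right_mono)
      moreover have "norm (e n * (T z - x)) \<le> norm (x - T z)"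
        using norm_mult_ineq[of "e n" "T z - x"] mult_right_mono[OF e(1), of "norm (T z - x)" n]
        by (simp add: norm_minus_commute)
      ultimately show ?thesis using x(2) N[OF n x(1)] d by linarith
    qed
    then show ?thesis by blast
  qed
  have "Cauchy a"
  proof (rule metric_CauchyI)
    fix d :: real assume d: "d > 0"
    obtain N where N: "\<And>n z. n \<ge> N \<Longrightarrow> z \<in> B \<Longrightarrow> norm (e n * T z - T z) < d/3"
      using unif[of "d/3"] d by auto
    have "dist (a m) (a n) < d" if "m \<ge> N" "n \<ge> N" for m n
    proof -
      have "norm (a m - a n) \<le> 2 * (d/3)"
      proof (rule norm_le_if_bounded_on_B)
        fix z assume z: "z \<in> B"
        then have "(a m - a n) * z = (e m * T z - T z) - (e n * T z - T z)"
          by (simp add: a B_def left_diff_distrib)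
        then show "norm ((a m - a n) * z) \<le> 2 * (d/3)"
          using norm_triangle_ineq4[of "e m * T z - T z" "e n * T z - T z"] N[OF that(1) z] N[OF that(2) z]
          by simp
      qed
      then show ?thesis using d by (simp add: dist_norm)
    qed
    then show "\<exists>M. \<forall>m\<ge>M. \<forall>n\<ge>M. dist (a m) (a n) < d" by blast
  qed
  then obtain \<alpha> where \<alpha>: "a \<longlonglongrightarrow> \<alpha>" by (auto simp: Cauchy_convergent_iff convergent_def)
  have "\<alpha> * z = T z" if z: "z \<in> H" for z
    using tendsto_mult[OF \<alpha> tendsto_const[of z]] e(2)[of "T z"]
    unfolding a[OF z] by (rule LIMSEQ_unique)
  then show ?thesis by blast
qed

lemma elementary:
  fixes e :: "nat \<Rightarrow> 'a"
  assumes e: "\<And>n. norm (e n) \<le> 1" "\<And>a. (\<lambda>n. e n * a) \<longlonglongrightarrow> a"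
  shows "elementary TYPE('a)"
proof (rule elementaryI[OF hilbert])
  define \<pi> where "\<pi> a = restrict ((*) a) H" for a
  have "inj \<pi>"
  proof (rule injI, rule ccontr)
    fix a b assume "\<pi> a = \<pi> b" "a \<noteq> b"
    then obtain z where "z \<in> H" "(a - b) * z \<noteq> 0" using faithful[of "a - b"] by auto
    then show False using fun_cong[OF \<open>\<pi> a = \<pi> b\<close>, of z] by (simp add: \<pi>_def left_diff_distrib)
  qed
  moreover have "\<pi> a \<in> hs.compact_operators" for a
  proof -
    have "\<pi> a ` B = (*) a ` B" by (auto simp: \<pi>_def B_def)
    then show ?thesis
      using compact_left_mult[of a]
      by (auto simp: compact_operators_eq \<pi>_def distrib_left mult_scaleC_right)
  qed
  moreover have "T \<in> range \<pi>" if T: "T \<in> hs.compact_operators" for T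
  proof -
    have T': "T \<in> H \<rightarrow>\<^sub>E H" "compact (closure (T ` B))"
      "\<forall>x\<in>H. \<forall>y\<in>H. T (x + y) = T x + T y" "\<forall>c. \<forall>x\<in>H. T (c *\<^sub>C x) = c *\<^sub>C T x"
      using T unfolding compact_operators_eq by blast+
    have "bounded (T ` B)" by (rule bounded_subset[OF compact_imp_bounded[OF T'(2)] closure_subset])
    then obtain M where M: "\<And>z. z \<in> B \<Longrightarrow> norm (T z) \<le> M" unfolding bounded_iff by blast
    have "norm (T x) \<le> M * norm x" if x: "x \<in> H" for x
    proof (cases "x = 0")
      case True
      have "T 0 = 0" using T'(4)[rule_format, of 0 0] by simp
      then show ?thesis using True by simp
    next
      case False
      then have "(1 / norm x) *\<^sub>R x \<in> B" using x by (intro B_scale) auto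
      then have "norm (T ((1 / norm x) *\<^sub>R x)) \<le> M" by (rule M)
      also have "T ((1 / norm x) *\<^sub>R x) = (1 / norm x) *\<^sub>R T x"
        unfolding scaleR_scaleC using T'(4) x by blast
      finally show ?thesis using False by (simp add: field_simps)
    qed
    then have "bounded_operator T" using T' unfolding bounded_operator_def by (auto simp: PiE_iff)
    then obtain a where a: "\<forall>z\<in>H. a * z = T z"
      using compact_operator_left_mult[OF e _ T'(2)] by blast
    have "\<pi> a = T" using T'(1) a by (auto simp: \<pi>_def fun_eq_iff restrict_def PiE_def extensional_def)
    then show ?thesis by blast
  qed
  ultimately have "bij_betw \<pi> UNIV hs.compact_operators" by (auto simp: bij_betw_def)
  moreover have "ip (\<pi> a x) y = ip x (\<pi> (star a) y)" if "x \<in> H" "y \<in> H" for a x y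
    using that by (simp add: \<pi>_def ip_def star_mult star_star mult.assoc)
  ultimately show "hs.iso_to_compact_operators \<pi>"
    unfolding hs.iso_to_compact_operators_def
    by (simp add: \<pi>_def distrib_right mult_scaleC_left mult.assoc)
qed

end

lemma elementary_if_prime_element:
  fixes k :: "'a::cstar_algebra" and e :: "nat \<Rightarrow> 'a"
  assumes "simple_algebra TYPE('a)" "approximate_identity e"
    and k: "prime_element k" "sa k" "k \<noteq> 0"
  shows "elementary TYPE('a)"
proof -
  obtain p :: 'a where p: "star p = p" "p * p = p" "p \<noteq> 0" "prime_element p"
    using ex_prime_projection[OF k] .
  interpret minimal_projection p
    by unfold_locales (use assms p prime_projection_minimal[OF p] in auto)
  show ?thesis
    by (rule elementary[of e]) (use assms(2) in \<open>auto simp: approximate_identity_def\<close>)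
qed

section \<open>Cuntz subequivalence\<close>

lemma cuntz_le_iff: "a \<preceq> b \<longleftrightarrow> (\<forall>\<epsilon>>0. \<exists>x. norm (x * b * star x - a) < \<epsilon>)"
proof
  assume "a \<preceq> b"
  then obtain x where x: "(\<lambda>n::nat. norm (x n * b * star (x n) - a)) \<longlonglongrightarrow> 0" by (auto simp: cuntz_le_def)
  show "\<forall>\<epsilon>>0. \<exists>x. norm (x * b * star x - a) < \<epsilon>"
  proof (intro allI impI)
    fix \<epsilon> :: real assume "\<epsilon> > 0"
    from order_tendstoD(2)[OF x this] obtain n where "norm (x n * b * star (x n) - a) < \<epsilon>"
      by (auto simp: eventually_sequentially)
    then show "\<exists>x. norm (x * b * star x - a) < \<epsilon>" by blast
  qed
next
  assume R: "\<forall>\<epsilon>>0. \<exists>x. norm (x * b * star x - a) < \<epsilon>"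
  have "\<forall>n. \<exists>x. norm (x * b * star x - a) < inverse (real (Suc n))" using R by simp
  from choice[OF this] obtain x where x: "\<forall>n. norm (x n * b * star (x n) - a) < inverse (real (Suc n))" ..
  have "(\<lambda>n. norm (x n * b * star (x n) - a)) \<longlonglongrightarrow> 0"
    by (rule tendsto_sandwich[OF _ _ tendsto_const LIMSEQ_inverse_real_of_nat])
      (use x in \<open>auto intro!: always_eventually less_imp_le\<close>)
  then show "a \<preceq> b" unfolding cuntz_le_def by blast
qed

lemma cuntz_leI: "a = x * b * star x \<Longrightarrow> a \<preceq> b"
  unfolding cuntz_le_def by (intro exI[of _ "\<lambda>_. x"]) simp

lemma cuntz_le_0: "0 \<preceq> b"
  by (rule cuntz_leI[of _ 0]) simp

lemma cuntz_le_trans: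
  assumes "a \<preceq> b" "b \<preceq> c"
  shows "a \<preceq> c"
  unfolding cuntz_le_iff
proof (intro allI impI)
  fix \<epsilon> :: real assume e: "\<epsilon> > 0"
  obtain x where x: "norm (x * b * star x - a) < \<epsilon>/2"
    using assms(1) e unfolding cuntz_le_iff by (meson half_gt_zero)
  define s where "s = norm x * norm x + 1"
  have s: "s > 0" by (simp add: s_def add_nonneg_pos)
  have "\<epsilon> / (2 * s) > 0" using e s by simp
  then obtain y where y: "norm (y * c * star y - b) < \<epsilon> / (2 * s)"
    using assms(2) unfolding cuntz_le_iff by blast
  let ?r = "y * c * star y - b"
  have "norm (x * ?r * star x) \<le> norm x * norm ?r * norm x"
    using norm_mult_ineq[of "x * ?r" "star x"] mult_right_mono[OF norm_mult_ineq[of x ?r], of "norm x"] by simp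
  also have "\<dots> \<le> s * norm ?r" by (simp add: s_def algebra_simps)
  also have "\<dots> < \<epsilon> / 2" using y s by (simp add: field_simps)
  finally have r: "norm (x * ?r * star x) < \<epsilon> / 2" .
  have eq: "(x * y) * c * star (x * y) - a = x * ?r * star x + (x * b * star x - a)"
    by (simp add: star_mult algebra_simps)
  have "norm ((x * y) * c * star (x * y) - a) \<le> norm (x * ?r * star x) + norm (x * b * star x - a)"
    unfolding eq by (rule norm_triangle_ineq)
  then have "norm ((x * y) * c * star (x * y) - a) < \<epsilon>" using x r by linarith
  then show "\<exists>x. norm (x * c * star x - a) < \<epsilon>" by blast
qed

text \<open>\<open>q\<close> is the square root of s. The square of a positive element thus lies
  below the element exactly, not merely in the limit.\<close>

lemma square_eq_sandwich:
  assumes "cpos (s::'a::cstar_algebra)"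
  shows "\<exists>q. s * s = q * s * star q"
proof -
  obtain b where b: "s = star b * b" using assms by (auto simp: cpos_def)
  have s: "sa s" using assms by (rule sa_cpos)
  define f where "f t = sqrt \<bar>t\<bar>" for t :: real
  have f: "continuous_on UNIV f" "f 0 = 0" unfolding f_def by (auto intro!: continuous_intros)
  have "mult_embed (fc0 f s * s * fc0 f s) = fc f (mult_embed s) * mult_embed s * fc f (mult_embed s)"
    by (simp only: mult_embed_simps(5) mult_embed_fc0[OF f s])
  also have "\<dots> = fc (\<lambda>t. f t * t * f t) (mult_embed s)"
    using s f by (simp add: fc_mult fc_ident continuous_on_mult)
  also have "(\<lambda>t. f t * t * f t) = (\<lambda>t. \<bar>t\<bar> * t)" by (simp add: f_def fun_eq_iff)
  also have "fc (\<lambda>t. \<bar>t\<bar> * t) (mult_embed s) = fc abs (mult_embed s) * fc (\<lambda>t. t) (mult_embed s)"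
    using s by (intro fc_mult continuous_intros) simp_all
  also have "fc abs (mult_embed s) = mult_embed s"
    using fc_abs_star_mult_self[of "mult_embed b"] by (simp add: mult_embed_simps(5,6) b)
  also have "mult_embed s * fc (\<lambda>t. t) (mult_embed s) = mult_embed (s * s)"
    using s by (simp add: fc_ident mult_embed_simps(5))
  finally show ?thesis
    using sa_fc0[OF f s] by (intro exI[of _ "fc0 f s"]) (simp add: sa_star)
qed

section \<open>Common lower bounds and halving\<close>

text \<open>Primeness supplies x = \<alpha> * y * star \<beta> \<noteq> 0. Then x * star x contains
  star \<beta> * \<beta> = b in its middle and star x * x contains star \<alpha> * \<alpha> = a; the
  square of x * star x has the second product in its middle and is a sandwich of the first, so it
  lies below both a and b.\<close>

lemma ex_common_cuntz_lower_bound: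
  assumes simple: "simple_algebra TYPE('a::cstar_algebra)"
    and a: "cpos (a::'a)" "a \<noteq> 0" and b: "cpos b" "b \<noteq> 0"
  obtains c z w where "cpos c" "c \<noteq> 0" "c = z * a * star z" "c = w * b * star w"
proof -
  obtain \<alpha> where \<alpha>: "a = star \<alpha> * \<alpha>" using a by (auto simp: cpos_def)
  obtain \<beta> where \<beta>: "b = star \<beta> * \<beta>" using b by (auto simp: cpos_def)
  have "star \<beta> \<noteq> 0" "\<alpha> \<noteq> 0" using a b \<alpha> \<beta> by auto
  then obtain y where y: "\<alpha> * y * star \<beta> \<noteq> 0" using simple_imp_prime[OF simple, of \<alpha> "star \<beta>"] by blast
  define x where "x = \<alpha> * y * star \<beta>"
  define s where "s = x * star x"
  have "cpos s" unfolding s_def cpos_def by (rule exI[of _ "star x"]) (simp add: star_star)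
  then obtain q where q: "s * s = q * s * star q" using square_eq_sandwich by blast
  have s: "sa s" by (simp add: s_def sa_intros)
  show thesis
  proof
    show "cpos (s * s)" unfolding cpos_def using s by (intro exI[of _ s]) (simp add: sa_star)
    show "s * s \<noteq> 0" unfolding sa_square_eq_0[OF s] unfolding s_def mult_star_self_eq_0 x_def by (rule y)
    show "s * s = (x * \<beta> * star y) * a * star (x * \<beta> * star y)"
      by (simp add: s_def x_def \<alpha> star_mult star_star mult.assoc)
    show "s * s = (q * \<alpha> * y) * b * star (q * \<alpha> * y)"
      unfolding q by (simp add: s_def x_def \<beta> star_mult star_star mult.assoc)
  qed
qed

text \<open>x b y = 0 makes x * b * star x and star y * b * y fit side by side under b: in the
  sandwich of b by a sum of left multiples of x and of star y the mixed terms vanish. A common lower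
  bound c of the two can therefore be used twice.\<close>

lemma cuntz_halving:
  assumes simple: "simple_algebra TYPE('a::cstar_algebra)"
    and b: "cpos (b::'a)" and np: "\<not> prime_element b"
  obtains c where "cpos c" "c \<noteq> 0" "c \<preceq> b" "\<forall>d d'. d \<preceq> c \<longrightarrow> d' \<preceq> c \<longrightarrow> d + d' \<preceq> b"
proof -
  obtain \<beta> where \<beta>: "b = star \<beta> * \<beta>" using b by (auto simp: cpos_def)
  obtain x y where xy: "x * b * y = 0" "x * b \<noteq> 0" "b * y \<noteq> 0"
    using np unfolding prime_element_def by blast
  have yx: "star y * b * star x = 0"
    using arg_cong[OF xy(1), of star] sa_cpos[OF b] by (simp add: star_mult sa_star mult.assoc)
  have "x * b * star x = star (\<beta> * star x) * (\<beta> * star x)"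
    "star y * b * y = star (\<beta> * y) * (\<beta> * y)"
    by (simp_all add: \<beta> star_mult star_star mult.assoc)
  moreover have "\<beta> * star x \<noteq> 0"
  proof
    assume "\<beta> * star x = 0"
    then have "b * star x = 0" by (simp add: \<beta> mult.assoc)
    then have "star (b * star x) = 0" by simp
    then show False using xy(2) sa_cpos[OF b] by (simp add: star_mult star_star sa_star)
  qed
  moreover have "\<beta> * y \<noteq> 0" using xy(3) by (auto simp: \<beta> mult.assoc)
  ultimately have pos: "cpos (x * b * star x)" "x * b * star x \<noteq> 0" "cpos (star y * b * y)" "star y * b * y \<noteq> 0"
    by (auto simp: cpos_def star_mult_self_eq_0)
  obtain c z w where c: "cpos c" "c \<noteq> 0" "c = z * (x * b * star x) * star z" "c = w * (star y * b * y) * star w"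
    using ex_common_cuntz_lower_bound[OF simple pos] .
  show thesis
  proof
    show "cpos c" "c \<noteq> 0" using c by simp_all
    show "c \<preceq> b" by (rule cuntz_leI[of _ "z * x"]) (simp add: c(3) star_mult mult.assoc)
    show "\<forall>d d'. d \<preceq> c \<longrightarrow> d' \<preceq> c \<longrightarrow> d + d' \<preceq> b"
    proof (intro allI impI, subst cuntz_le_iff, intro allI impI)
      fix d d' assume d: "d \<preceq> c" and d': "d' \<preceq> c"
      fix \<epsilon> :: real assume "\<epsilon> > 0"
      then have e: "\<epsilon>/2 > 0" by simp
      obtain u where u: "norm (u * c * star u - d) < \<epsilon>/2" using d e unfolding cuntz_le_iff by blast
      obtain v where v: "norm (v * c * star v - d') < \<epsilon>/2" using d' e unfolding cuntz_le_iff by blast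
      define t where "t = u * z * x + v * w * star y"
      have "t * b * star t = u * z * (x * b * star x) * star z * star u + v * w * (star y * b * y) * star w * star v
          + u * z * (x * b * y) * star w * star v + v * w * (star y * b * star x) * star z * star u"
        by (simp add: t_def star_add star_mult star_star algebra_simps)
      also have "\<dots> = u * c * star u + v * c * star v"
      proof -
        have "u * c * star u = u * z * (x * b * star x) * star z * star u" by (simp add: c(3) mult.assoc)
        moreover have "v * c * star v = v * w * (star y * b * y) * star w * star v" by (simp add: c(4) mult.assoc)
        ultimately show ?thesis unfolding xy(1) yx by simp
      qed
      finally have eq: "t * b * star t - (d + d') = (u * c * star u - d) + (v * c * star v - d')" by simp
      have "norm (t * b * star t - (d + d')) \<le> norm (u * c * star u - d) + norm (v * c * star v - d')"
        unfolding eq by (rule norm_triangle_ineq)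
      then have "norm (t * b * star t - (d + d')) < \<epsilon>" using u v by linarith
      then show "\<exists>x. norm (x * b * star x - (d + d')) < \<epsilon>" by blast
    qed
  qed
qed

text \<open>By dependent choice: c (n+1) halves a common lower bound of c n and s (n+1). The earlier
  s i then follow by transitivity through c n.\<close>

lemma ex_halving_sequence:
  fixes s :: "nat \<Rightarrow> 'a::cstar_algebra"
  assumes simple: "simple_algebra TYPE('a)"
    and no_prime: "\<forall>b::'a. cpos b \<and> b \<noteq> 0 \<longrightarrow> \<not> prime_element b"
    and s: "\<forall>n. cpos (s n) \<and> s n \<noteq> 0"
  shows "\<exists>c. \<forall>n. (cpos (c n) \<and> c n \<noteq> 0 \<and> (\<forall>i\<le>n. c n \<preceq> s i)) \<and>
    (\<forall>d d'. d \<preceq> c (Suc n) \<longrightarrow> d' \<preceq> c (Suc n) \<longrightarrow> d + d' \<preceq> c n)"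
proof -
  have np: "\<not> prime_element b" if "cpos b" "b \<noteq> 0" for b :: 'a using no_prime that by blast
  show ?thesis
  proof (rule dependent_nat_choice)
    have s0: "cpos (s 0)" "s 0 \<noteq> 0" using s by simp_all
    obtain c where "cpos c" "c \<noteq> 0" "c \<preceq> s 0" "\<forall>d d'. d \<preceq> c \<longrightarrow> d' \<preceq> c \<longrightarrow> d + d' \<preceq> s 0"
      using cuntz_halving[OF simple s0(1) np[OF s0]] .
    then show "\<exists>x. cpos x \<and> x \<noteq> 0 \<and> (\<forall>i\<le>0. x \<preceq> s i)" by auto
  next
    fix c n assume c: "cpos c \<and> c \<noteq> 0 \<and> (\<forall>i\<le>n. c \<preceq> s i)"
    have c': "cpos c" "c \<noteq> 0" "cpos (s (Suc n))" "s (Suc n) \<noteq> 0" using c s by simp_all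
    obtain k z w where k: "cpos k" "k \<noteq> 0" "k = z * c * star z" "k = w * s (Suc n) * star w"
      using ex_common_cuntz_lower_bound[OF simple c'] .
    obtain x where x: "cpos x" "x \<noteq> 0" "x \<preceq> k" "\<forall>d d'. d \<preceq> x \<longrightarrow> d' \<preceq> x \<longrightarrow> d + d' \<preceq> k"
      using cuntz_halving[OF simple k(1) np[OF k(1,2)]] .
    have kc: "k \<preceq> c" and ks: "k \<preceq> s (Suc n)" using cuntz_leI[OF k(3)] cuntz_leI[OF k(4)] .
    have "x \<preceq> s i" if "i \<le> Suc n" for i
    proof (cases "i \<le> n")
      case True
      then have "c \<preceq> s i" using c by blast
      then show ?thesis by (rule cuntz_le_trans[OF cuntz_le_trans[OF x(3) kc]])
    next
      case False
      then have "i = Suc n" using that by simp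
      then show ?thesis using cuntz_le_trans[OF x(3) ks] by simp
    qed
    then show "\<exists>y. (cpos y \<and> y \<noteq> 0 \<and> (\<forall>i\<le>Suc n. y \<preceq> s i)) \<and>
        (\<forall>d d'. d \<preceq> y \<longrightarrow> d' \<preceq> y \<longrightarrow> d + d' \<preceq> c)"
      using x cuntz_le_trans[OF _ kc] by blast
  qed
qed

text \<open>The analogue of a tail of the series of 2^(-j): both d n and the sum of the later terms
  lie below c (n+1), which fits twice into c n.\<close>

lemma sum_cuntz_le_halving:
  assumes c: "\<And>n d d'. d \<preceq> c (Suc n) \<Longrightarrow> d' \<preceq> c (Suc n) \<Longrightarrow> d + d' \<preceq> c n"
    and d: "\<And>n. d n \<preceq> c (Suc n)"
  shows "(\<Sum>j=n..n+k. d j) \<preceq> c n"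
proof (induction k arbitrary: n)
  case 0
  show ?case using c[OF d[of n] cuntz_le_0] by simp
next
  case (Suc k)
  have eq: "(\<Sum>j=n..n + Suc k. d j) = d n + (\<Sum>j=Suc n..Suc n + k. d j)"
    by (simp add: sum.atLeast_Suc_atMost)
  show ?case unfolding eq by (rule c[OF d Suc.IH])
qed

section \<open>Strictly convergent orthogonal series\<close>

text \<open>Powers of an orthogonal sum are sums of powers, so the power of order 2^k has norm at
  most the number of terms, independently of k; taking roots removes that number. The multiplier
  algebra is used because powers need a unit.\<close>

lemma norm_orthogonal_sum_le:
  fixes r :: "nat \<Rightarrow> 'a::cstar_algebra"
  assumes r: "\<And>j. sa (r j)" "\<And>j. norm (r j) \<le> 1" "\<And>i j. i \<noteq> j \<Longrightarrow> r i * r j = 0"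
  shows "norm (\<Sum>j\<in>{m..<n}. r j) \<le> 1"
proof -
  define R where "R j = mult_embed (r j)" for j
  have RR: "R i * R j = 0" if "i \<noteq> j" for i j
    using r(3)[OF that] by (simp add: R_def mult_embed_simps(1) flip: mult_embed_simps(5))
  have pow: "(\<Sum>j\<in>{m..<n}. R j) ^ Suc k = (\<Sum>j\<in>{m..<n}. R j ^ Suc k)" for k
  proof (induction k)
    case (Suc k)
    have "(\<Sum>j\<in>{m..<n}. R j) ^ Suc (Suc k) = (\<Sum>i\<in>{m..<n}. \<Sum>j\<in>{m..<n}. R i * R j ^ Suc k)"
      by (subst power_Suc) (simp only: Suc.IH sum_product)
    also have "\<dots> = (\<Sum>i\<in>{m..<n}. \<Sum>j\<in>{m..<n}. if j = i then R i ^ Suc (Suc k) else 0)"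
      by (intro sum.cong refl) (use RR in \<open>auto simp flip: mult.assoc\<close>)
    finally show ?case by simp
  qed simp
  have S: "mult_embed (\<Sum>j\<in>{m..<n}. r j) = (\<Sum>j\<in>{m..<n}. R j)"
    unfolding R_def by (rule linear_sum[OF bounded_linear.linear[OF bounded_linear_mult_embed]])
  have "sa (\<Sum>j\<in>{m..<n}. r j)" using r(1) by (simp add: sa_def star_sum)
  then have sa: "sa (\<Sum>j\<in>{m..<n}. R j)" by (simp flip: S)
  have "norm (\<Sum>j\<in>{m..<n}. R j) \<le> 1"
  proof (rule bounded_root_growth[of _ "real n"])
    fix k
    obtain l where l: "(2::nat) ^ k = Suc l" by (metis not0_implies_Suc power_not_zero zero_neq_numeral)
    have "norm (\<Sum>j\<in>{m..<n}. R j) ^ (2 ^ k) = norm (\<Sum>j\<in>{m..<n}. R j ^ Suc l)"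
      using norm_sa_power[OF sa, of k] by (simp only: l pow)
    also have "\<dots> \<le> (\<Sum>j\<in>{m..<n}. 1)"
      by (rule sum_norm_le) (use r(2) in \<open>simp add: R_def norm_power_le del: power_Suc\<close>)
    also have "\<dots> \<le> real n * 2 ^ k + 1"
    proof -
      have "real n * 1 \<le> real n * 2 ^ k" by (intro mult_left_mono) simp_all
      then show ?thesis by simp
    qed
    finally show "norm (\<Sum>j\<in>{m..<n}. R j) ^ (2 ^ k) \<le> real n * 2 ^ k + 1" .
  qed simp
  then show ?thesis by (simp flip: S)
qed

text \<open>The partial sums are contractions and become constant on each e k * a, as r j kills e k
  for j > k. Approximating a by e k * a gives convergence on every a.\<close>

lemma ex_multiplier_orthogonal_sum:
  fixes r :: "nat \<Rightarrow> 'a::cstar_algebra" and e :: "nat \<Rightarrow> 'a"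
  assumes r: "\<And>j. sa (r j)" "\<And>j. norm (r j) \<le> 1" "\<And>i j. i \<noteq> j \<Longrightarrow> r i * r j = 0"
    and e: "\<And>a. (\<lambda>n. e n * a) \<longlonglongrightarrow> a" and re: "\<And>j k. k < j \<Longrightarrow> r j * e k = 0"
  shows "\<exists>Y. star Y = Y \<and> (\<forall>a. (\<lambda>n. (\<Sum>j<n. r j) * a) \<longlonglongrightarrow> lact Y a) \<and>
    (\<forall>a. (\<lambda>n. a * (\<Sum>j<n. r j)) \<longlonglongrightarrow> ract Y a)"
proof -
  define S where "S n = (\<Sum>j<n. r j)" for n
  have saS: "star (S n) = S n" for n using r(1) by (simp add: S_def star_sum sa_star)
  have nS: "norm (S n) \<le> 1" for n
    unfolding S_def lessThan_atLeast0 by (rule norm_orthogonal_sum_le[OF r])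
  have diff: "S n - S m = (\<Sum>j\<in>{m..<n}. r j)" if "m \<le> n" for m n
    using that unfolding S_def lessThan_atLeast0 by (simp add: sum_diff_nat_ivl)
  have conv: "convergent (\<lambda>n. S n * a)" for a
  proof (rule Cauchy_convergent, rule CauchyI')
    fix \<epsilon> :: real assume "\<epsilon> > 0"
    then obtain k where k: "norm (e k * a - a) < \<epsilon>" using LIMSEQ_D[OF e] by blast
    have "norm (S m * a - S n * a) < \<epsilon>" if "m \<ge> Suc k" "n > m" for m n
    proof -
      let ?d = "\<Sum>j\<in>{m..<n}. r j"
      have "?d * e k = 0" using that by (simp add: sum_distrib_right re)
      then have "S n * a - S m * a = ?d * (a - e k * a)"
        using diff[of m n] that by (simp add: right_diff_distrib flip: left_diff_distrib mult.assoc)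
      then have "norm (S n * a - S m * a) \<le> norm ?d * norm (a - e k * a)" by (simp add: norm_mult_ineq)
      also have "\<dots> \<le> 1 * norm (a - e k * a)"
        by (rule mult_right_mono[OF norm_orthogonal_sum_le[OF r] norm_ge_zero])
      finally show ?thesis using k by (simp add: norm_minus_commute)
    qed
    then show "\<exists>M. \<forall>m\<ge>M. \<forall>n>m. dist (S m * a) (S n * a) < \<epsilon>" by (auto simp: dist_norm)
  qed
  define L where "L a = lim (\<lambda>n. S n * a)" for a
  \<comment> \<open>The partial sums are self-adjoint, so the right action is the left one
    conjugated by the involution.\<close>
  define R where "R a = star (L (star a))" for a
  have L: "(\<lambda>n. S n * a) \<longlonglongrightarrow> L a" for a
    using conv[of a] by (simp add: L_def convergent_LIMSEQ_iff)
  have R: "(\<lambda>n. a * S n) \<longlonglongrightarrow> R a" for a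
    using tendsto_star[OF L[of "star a"]] by (simp add: R_def star_mult star_star saS)
  have nL: "norm (L a) \<le> norm a * 1" and nR: "norm (R a) \<le> norm a * 1" for a
  proof -
    have "norm (S n * a) \<le> norm a" "norm (a * S n) \<le> norm a" for n
      using norm_mult_ineq[of "S n" a] norm_mult_ineq[of a "S n"]
        mult_right_mono[OF nS[of n], of "norm a"] by (simp_all add: mult.commute)
    then show "norm (L a) \<le> norm a * 1" "norm (R a) \<le> norm a * 1"
      using tendsto_norm[OF L[of a]] tendsto_norm[OF R[of a]] by (auto intro: LIMSEQ_le_const2)
  qed
  note [intro] = LIMSEQ_unique
  have lin: "L (a + b) = L a + L b" "L (c *\<^sub>C a) = c *\<^sub>C L a" "L (a * b) = L a * b"
    "R (a + b) = R a + R b" "R (c *\<^sub>C a) = c *\<^sub>C R a" "R (a * b) = a * R b" "R a * b = a * L b" for a b c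
    using L[of "a + b"] tendsto_add[OF L[of a] L[of b]] L[of "c *\<^sub>C a"] tendsto_scaleC[OF L[of a], of c]
      L[of "a * b"] tendsto_mult[OF L[of a] tendsto_const[of b]]
      R[of "a + b"] tendsto_add[OF R[of a] R[of b]] R[of "c *\<^sub>C a"] tendsto_scaleC[OF R[of a], of c]
      R[of "a * b"] tendsto_mult[OF tendsto_const[of a] R[of b]]
      tendsto_mult[OF R[of a] tendsto_const[of b]] tendsto_mult[OF tendsto_const[of a] L[of b]]
    by (auto simp: distrib_left distrib_right mult_scaleC_left mult_scaleC_right mult.assoc)
  have bl: "bounded_linear L" "bounded_linear R"
    by (rule bounded_linear_intro[of _ 1]; simp add: lin scaleR_scaleC nL[simplified] nR[simplified])+
  define Y where "Y = Abs_multiplier (Blinfun L, Blinfun R)"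
  have "lact Y = Blinfun L" "ract Y = Blinfun R"
    unfolding Y_def lact_def ract_def
    by (subst Abs_multiplier_inverse; simp add: bounded_linear_Blinfun_apply bl lin)+
  then have Y: "lact Y a = L a" "ract Y a = R a" for a
    by (simp_all add: bounded_linear_Blinfun_apply bl)
  show ?thesis
  proof (intro exI conjI allI)
    show "star Y = Y"
      by (rule lact_inject, rule blinfun_eqI) (simp add: lact_simps' Y R_def star_star)
    show "(\<lambda>n. (\<Sum>j<n. r j) * a) \<longlonglongrightarrow> lact Y a" "(\<lambda>n. a * (\<Sum>j<n. r j)) \<longlonglongrightarrow> ract Y a" for a
      using L[of a] R[of a] by (simp_all add: Y S_def)
  qed
qed

text \<open>S n * (S n * a) differs from S n * (Y a) by at most the norm of S n * a - Y a, because
  the S n are contractions.\<close>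

lemma tendsto_lact_square:
  assumes S: "\<And>n. norm (S n) \<le> 1" "\<And>a. (\<lambda>n. S n * a) \<longlonglongrightarrow> lact Y a" "\<And>a. (\<lambda>n. a * S n) \<longlonglongrightarrow> ract Y a"
  shows "(\<lambda>n. (S n * S n) * a) \<longlonglongrightarrow> lact (Y * Y) a" "(\<lambda>n. a * (S n * S n)) \<longlonglongrightarrow> ract (Y * Y) a"
proof -
  have z: "(\<lambda>n. norm (S n * a - lact Y a)) \<longlonglongrightarrow> 0" "(\<lambda>n. norm (a * S n - ract Y a)) \<longlonglongrightarrow> 0"
    using S(2,3)[of a] by (simp_all add: LIM_zero tendsto_norm_zero)
  have le: "norm (S n * (S n * a - lact Y a)) \<le> norm (S n * a - lact Y a)"
    "norm ((a * S n - ract Y a) * S n) \<le> norm (a * S n - ract Y a)" for n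
    using norm_mult_ineq[of "S n" "S n * a - lact Y a"] norm_mult_ineq[of "a * S n - ract Y a" "S n"]
      mult_right_mono[OF S(1)[of n], of "norm (S n * a - lact Y a)"]
      mult_left_mono[OF S(1)[of n], of "norm (a * S n - ract Y a)"] by simp_all
  have l1: "(\<lambda>n. S n * (S n * a - lact Y a)) \<longlonglongrightarrow> 0"
    by (rule Lim_null_comparison[OF always_eventually z(1)]) (use le in blast)
  have l2: "(\<lambda>n. (a * S n - ract Y a) * S n) \<longlonglongrightarrow> 0"
    by (rule Lim_null_comparison[OF always_eventually z(2)]) (use le in blast)
  show "(\<lambda>n. (S n * S n) * a) \<longlonglongrightarrow> lact (Y * Y) a" "(\<lambda>n. a * (S n * S n)) \<longlonglongrightarrow> ract (Y * Y) a"
    using tendsto_add[OF l1 S(2)[of "lact Y a"]] tendsto_add[OF l2 S(3)[of "ract Y a"]]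
    by (simp_all add: lact_simps ract_simps right_diff_distrib left_diff_distrib mult.assoc)
qed

lemma approximate_identityD:
  assumes "approximate_identity e"
  shows "sa (e n)" "norm (e n) \<le> 1" "e n \<noteq> e (Suc n)" "(\<lambda>n. e n * a) \<longlonglongrightarrow> a" "(\<lambda>n. a * e n) \<longlonglongrightarrow> a"
    "l < k \<Longrightarrow> e k * e l = e l" "l < k \<Longrightarrow> e l * e k = e l"
proof -
  show sa: "sa (e n)" for n using assms sa_cpos by (auto simp: approximate_identity_def)
  show "norm (e n) \<le> 1" "e n \<noteq> e (Suc n)" "(\<lambda>n. e n * a) \<longlonglongrightarrow> a" "(\<lambda>n. a * e n) \<longlonglongrightarrow> a"
    using assms by (auto simp: approximate_identity_def)
  have e: "e (Suc n) * e n = e n" for n using assms by (auto simp: approximate_identity_def)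
  show *: "e k * e l = e l" if "l < k" for k l
    using that
  proof (induction k)
    case (Suc k)
    show ?case
    proof (cases "l = k")
      case False
      then have "e k * e l = e l" using Suc by simp
      then show ?thesis using e[of k] by (metis mult.assoc)
    qed (simp add: e)
  qed simp
  show "l < k \<Longrightarrow> e l * e k = e l" using arg_cong[OF *, of l k star] sa by (simp add: star_mult sa_star)
qed

section \<open>The equivalence\<close>

text \<open>The elements e k * a * e k tend to a and are annihilated by e m - e n as soon as m > n >
  k.\<close>

lemma mult_embed_cpos_in_closure_K\<^sub>o:
  fixes e :: "nat \<Rightarrow> 'a::cstar_algebra"
  assumes e: "approximate_identity e" and a: "cpos a"
  shows "mult_embed a \<in> closure (K\<^sub>o e)"
proof -
  note eD = approximate_identityD[OF e]
  obtain b where b: "a = star b * b" using a by (auto simp: cpos_def)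
  have K: "mult_embed (e k * a * e k) \<in> K\<^sub>o e" for k
  proof -
    have "mult_embed (e k * a * e k) = star (mult_embed (b * e k)) * mult_embed (b * e k)"
      using sa_star[OF eD(1)[of k]] by (simp add: b star_mult mult.assoc flip: mult_embed_simps(5,6))
    then have "cpos (mult_embed (e k * a * e k))" unfolding cpos_def by blast
    moreover have "(e m - e n) * lact (mult_embed (e k * a * e k)) (e m - e n) \<preceq> c" if "m > n" "n \<ge> Suc k" for m n and c :: 'a
    proof -
      have "e k * (e m - e n) = 0" using that by (simp add: right_diff_distrib eD)
      then have "lact (mult_embed (e k * a * e k)) (e m - e n) = 0" by (simp add: mult.assoc)
      then show ?thesis by (simp add: cuntz_le_0)
    qed
    ultimately show ?thesis unfolding K\<^sub>o_def by blast
  qed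
  have "(\<lambda>k. e k * a * e k - a * e k) \<longlonglongrightarrow> 0"
  proof (rule Lim_null_comparison[OF always_eventually])
    show "(\<lambda>k. norm (e k * a - a)) \<longlonglongrightarrow> 0" using eD(4)[of a] by (simp add: LIM_zero tendsto_norm_zero)
    show "\<forall>k. norm (e k * a * e k - a * e k) \<le> norm (e k * a - a)"
    proof
      fix k
      have "norm ((e k * a - a) * e k) \<le> norm (e k * a - a) * 1"
        by (rule order_trans[OF norm_mult_ineq mult_left_mono[OF eD(2) norm_ge_zero]])
      then show "norm (e k * a * e k - a * e k) \<le> norm (e k * a - a)" by (simp add: left_diff_distrib)
    qed
  qed
  from tendsto_add[OF this eD(5)[of a]] have "(\<lambda>k. e k * a * e k) \<longlonglongrightarrow> a" by simp
  then have "(\<lambda>k. mult_embed (e k * a * e k)) \<longlonglongrightarrow> mult_embed a"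
    by (rule bounded_linear.tendsto[OF bounded_linear_mult_embed])
  then show ?thesis
    unfolding closure_sequential using K
    by (intro exI[of _ "\<lambda>k. mult_embed (e k * a * e k)"] conjI allI)
qed

lemma closed_mult_embed_cpos: "closed (mult_embed ` {a::'a::cstar_algebra. cpos a})"
  unfolding closed_sequential_limits
proof (intro allI impI, elim conjE)
  fix Y and l :: "'a multiplier" assume Y: "\<forall>n. Y n \<in> mult_embed ` {a. cpos a}" and l: "Y \<longlonglongrightarrow> l"
  have "\<forall>n. \<exists>y. cpos y \<and> Y n = mult_embed y" using Y by blast
  from choice[OF this] obtain y where y: "\<forall>n. cpos (y n) \<and> Y n = mult_embed (y n)" ..
  have "l \<in> range mult_embed" by (rule closed_sequentially[OF closed_range_mult_embed _ l]) (use y in blast)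
  then obtain x where x: "l = mult_embed x" by blast
  have "(\<lambda>n. norm (mult_embed (y n) - mult_embed x)) \<longlonglongrightarrow> 0"
  proof (rule tendsto_norm_zero[OF LIM_zero])
    have "Y = (\<lambda>n. mult_embed (y n))" using y by (simp add: fun_eq_iff)
    then show "(\<lambda>n. mult_embed (y n)) \<longlonglongrightarrow> mult_embed x" using l x by simp
  qed
  then have "(\<lambda>n. norm (y n - x)) \<longlonglongrightarrow> 0" by (simp flip: mult_embed_simps(3))
  then have "(\<lambda>n. y n - x) \<longlonglongrightarrow> 0" by (rule tendsto_norm_zero_cancel)
  then have lim: "y \<longlonglongrightarrow> x" by (rule LIM_zero_cancel)
  have "x \<in> {a. cpos a}" by (rule closed_sequentially[OF closed_cpos _ lim]) (use y in simp)
  then show "l \<in> mult_embed ` {a. cpos a}" using x by blast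
qed

lemma ex_order_dense_if_K\<^sub>o:
  fixes e :: "nat \<Rightarrow> 'a::cstar_algebra"
  assumes e: "approximate_identity e" and X: "X \<in> K\<^sub>o e" "X \<notin> mult_embed ` {a. cpos a}"
  shows "\<exists>s :: nat \<Rightarrow> 'a. order_dense s"
proof -
  note eD = approximate_identityD[OF e]
  obtain Z where Z: "X = star Z * Z" using X(1) by (auto simp: K\<^sub>o_def cpos_def)
  have sand: "g * lact X g = star (lact Z g) * lact Z g" if "sa g" for g
  proof -
    have "star (lact Z g) = ract (star Z) g" using that by (simp add: ract_simps' sa_star)
    then show ?thesis by (simp add: Z lact_simps ract_lact)
  qed
  have sag: "sa (e m - e n)" for m n by (intro sa_intros eD(1))
  have "\<exists>m n. m > n \<and> n \<ge> N \<and> (e m - e n) * lact X (e m - e n) \<noteq> 0" for N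
  proof (rule ccontr)
    assume "\<not> ?thesis"
    then have "(e m - e N) * lact X (e m - e N) = 0" if "m > N" for m using that by blast
    then have "lact Z (e m - e N) = 0" if "m > N" for m
      using that sand[OF sag] by (simp add: star_mult_self_eq_0)
    then have c: "lact Z (e m) = lact Z (e N)" if "m > N" for m
      using that by (simp add: blinfun.diff_right)
    have za: "lact Z a = lact Z (e N) * a" for a
    proof (rule LIMSEQ_unique)
      show "(\<lambda>m. lact Z (e m * a)) \<longlonglongrightarrow> lact Z a" by (intro blinfun.tendsto tendsto_const eD(4))
      have "\<forall>\<^sub>F m in sequentially. lact Z (e N) * a = lact Z (e m * a)"
        using eventually_gt_at_top[of N] by (rule eventually_mono) (simp add: lact_mult c)
      then show "(\<lambda>m. lact Z (e m * a)) \<longlonglongrightarrow> lact Z (e N) * a"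
        by (rule Lim_transform_eventually[OF tendsto_const])
    qed
    have ZN: "Z = mult_embed (lact Z (e N))"
      by (rule lact_inject, rule blinfun_eqI) (simp only: mult_embed_apply, rule za)
    have "X = mult_embed (star (lact Z (e N)) * lact Z (e N))"
      unfolding mult_embed_simps(5,6) ZN[symmetric] by (rule Z)
    moreover have "cpos (star (lact Z (e N)) * lact Z (e N))" unfolding cpos_def by blast
    ultimately show False using X(2) by blast
  qed
  \<comment> \<open>The pair chosen for N lies beyond N, so an element with threshold N in the
    definition of \<open>K\<^sub>o\<close> dominates s N itself.\<close>
  then have "\<forall>N. \<exists>q. fst q > snd q \<and> snd q \<ge> N \<and> (e (fst q) - e (snd q)) * lact X (e (fst q) - e (snd q)) \<noteq> 0"
    unfolding split_paired_Ex fst_conv snd_conv by blast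
  from choice[OF this] obtain q where q: "\<forall>N. fst (q N) > snd (q N) \<and> snd (q N) \<ge> N \<and>
      (e (fst (q N)) - e (snd (q N))) * lact X (e (fst (q N)) - e (snd (q N))) \<noteq> 0" ..
  define s where "s N = (e (fst (q N)) - e (snd (q N))) * lact X (e (fst (q N)) - e (snd (q N)))" for N
  have "cpos (s N)" for N unfolding s_def sand[OF sag] cpos_def by blast
  moreover have "s N \<noteq> 0" for N using q by (simp add: s_def)
  moreover have "\<exists>n. s n \<preceq> a" if a: "cpos a" "a \<noteq> 0" for a
  proof -
    obtain N where "\<forall>m n. m > n \<and> n \<ge> N \<longrightarrow> (e m - e n) * lact X (e m - e n) \<preceq> a"
      using X(1) a unfolding K\<^sub>o_def by blast
    then have "s N \<preceq> a" using q unfolding s_def by blast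
    then show ?thesis ..
  qed
  ultimately show ?thesis unfolding order_dense_def by blast
qed

lemma order_dense_if_thin:
  assumes t: "thin (t :: nat \<Rightarrow> 'a::cstar_algebra)"
  shows "order_dense t"
  unfolding order_dense_def
proof (intro conjI allI impI)
  show "cpos (t i)" "t i \<noteq> 0" for i using t by (simp_all add: thin_def)
  fix a :: 'a assume "cpos a \<and> a \<noteq> 0"
  then obtain N where "\<forall>m n. n \<le> m \<and> N \<le> n \<longrightarrow> sum t {n..m} \<preceq> a" using t unfolding thin_def by blast
  then have "sum t {N..N} \<preceq> a" by blast
  then show "\<exists>n. t n \<preceq> a" by auto
qed

lemma ex_thin_if_order_dense:
  fixes e :: "nat \<Rightarrow> 'a::cstar_algebra"
  assumes simple: "simple_algebra TYPE('a)" and non_elem: "\<not> elementary TYPE('a)"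
    and e: "approximate_identity e" and s: "order_dense (s :: nat \<Rightarrow> 'a)"
  shows "\<exists>(d :: nat \<Rightarrow> 'a) D. thin d \<and>
    limitin strict_topology (\<lambda>n. \<Sum>j<n. mult_embed (d j)) D sequentially \<and> D \<in> K\<^sub>o e - range mult_embed"
proof -
  note eD = approximate_identityD[OF e]
  have es: "star (e n) = e n" for n using eD(1) by (rule sa_star)
  have np: "\<forall>b::'a. cpos b \<and> b \<noteq> 0 \<longrightarrow> \<not> prime_element b"
    using elementary_if_prime_element[OF simple e] non_elem sa_cpos by blast
  have s0: "\<forall>n. cpos (s n) \<and> s n \<noteq> 0" using s by (simp add: order_dense_def)
  from ex_halving_sequence[OF simple np s0] obtain c where c': "\<forall>n. (cpos (c n) \<and> c n \<noteq> 0 \<and> (\<forall>i\<le>n. c n \<preceq> s i)) \<and>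
      (\<forall>d d'. d \<preceq> c (Suc n) \<longrightarrow> d' \<preceq> c (Suc n) \<longrightarrow> d + d' \<preceq> c n)" ..
  have c: "cpos (c n)" "c n \<noteq> 0" "i \<le> n \<Longrightarrow> c n \<preceq> s i"
    "d \<preceq> c (Suc n) \<Longrightarrow> d' \<preceq> c (Suc n) \<Longrightarrow> d + d' \<preceq> c n" for n i d d'
    using c' by simp_all
  \<comment> \<open>Every other increment is skipped since neighbouring ones overlap: (e (n+1) - e
    n) * (e (n+2) - e (n+1)) is e (n+1) - e (n+1)^2, which need not vanish.\<close>
  define f where "f j = e (2 * j + 1) - e (2 * j)" for j
  have f0: "f j \<noteq> 0" for j using eD(3)[of "2 * j", symmetric] by (simp add: f_def)
  have saf: "sa (f j)" for j unfolding f_def by (intro sa_intros eD(1))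
  have fe: "f j * e k = 0" if "k < 2 * j" for j k
    using that by (simp add: f_def left_diff_distrib eD)
  have fe': "f j * e k = f j" if "2 * j + 1 < k" for j k
    using that by (simp add: f_def left_diff_distrib eD)
  have ff: "f i * f j = 0" if "i \<noteq> j" for i j
  proof -
    have *: "f i * f j = 0" if "j < i" for i j
    proof -
      have "f i * e (2 * j + 1) = 0" "f i * e (2 * j) = 0" using that by (auto intro!: fe)
      then show ?thesis by (subst (2) f_def) (simp add: right_diff_distrib)
    qed
    show ?thesis
    proof (cases "j < i")
      case False
      then have "star (f j * f i) = 0" using that by (simp add: *)
      then show ?thesis using saf by (simp add: star_mult sa_star)
    qed (rule *)
  qed
  have "\<exists>y. norm (f j * y * c (Suc j) * star y * f j) = 1" for j
  proof -
    obtain g where g: "c (Suc j) = star g * g" using c(1)[of "Suc j"] by (auto simp: cpos_def)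
    then have "star g \<noteq> 0" using c(2)[of "Suc j"] by auto
    then obtain y where y: "f j * y * star g \<noteq> 0" using simple_imp_prime[OF simple, of "f j" "star g"] f0 by blast
    define N where "N = norm (f j * y * star g)"
    have N: "N > 0" using y by (simp add: N_def)
    have "f j * y * c (Suc j) * star y * f j = (f j * y * star g) * star (f j * y * star g)"
      using saf by (simp add: g star_mult star_star sa_star mult.assoc)
    then have "norm (f j * y * c (Suc j) * star y * f j) = N\<^sup>2" by (simp only: norm_mult_star N_def)
    then have "norm (f j * ((1/N) *\<^sub>R y) * c (Suc j) * star ((1/N) *\<^sub>R y) * f j) = 1"
      using N by (simp add: star_scaleR power2_eq_square)
    then show ?thesis by blast
  qed
  from choice[OF allI[OF this]] obtain y where y: "\<forall>j. norm (f j * y j * c (Suc j) * star (y j) * f j) = 1" ..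
  define r where "r j = f j * y j * c (Suc j) * star (y j) * f j" for j
  have nr: "norm (r j) = 1" for j using y by (simp add: r_def)
  have cposr: "cpos (r j)" for j
  proof -
    obtain g where g: "c (Suc j) = star g * g" using c(1)[of "Suc j"] by (auto simp: cpos_def)
    have "r j = star (g * star (y j) * f j) * (g * star (y j) * f j)"
      using saf by (simp add: r_def g star_mult star_star sa_star mult.assoc)
    then show ?thesis unfolding cpos_def by blast
  qed
  then have sar: "sa (r j)" for j by (rule sa_cpos)
  have rr: "r i * r j = 0" if "i \<noteq> j" for i j
  proof -
    have "r i * r j = f i * y i * c (Suc i) * star (y i) * (f i * f j) * y j * c (Suc j) * star (y j) * f j"
      by (simp add: r_def mult.assoc)
    then show ?thesis by (simp add: ff[OF that])
  qed
  have re: "r j * e k = 0" if "k < 2 * j" for j k by (simp add: r_def fe[OF that] mult.assoc)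
  have re': "r j * e k = r j" if "2 * j + 1 < k" for j k by (simp add: r_def fe'[OF that] mult.assoc)
  \<comment> \<open>With squares, the strict sum of the d j is Y * Y for the self-adjoint strict sum
    Y of the r j, hence positive; and each d j stays below r j by an exact sandwich.\<close>
  define d where "d j = r j * r j" for j
  have sad: "sa (d j)" for j unfolding d_def by (intro sa_intros sar)
  have de: "d j * e k = 0" if "k < 2 * j" for j k by (simp add: d_def re[OF that] mult.assoc)
  have de': "d j * e k = d j" if "2 * j + 1 < k" for j k by (simp add: d_def re'[OF that] mult.assoc)
  have ed: "e k * d j = star (d j * e k)" for j k by (simp add: star_mult es sa_star[OF sad])
  have dd: "d i * d j = 0" if "i \<noteq> j" for i j
  proof -
    have "d i * d j = r i * (r i * r j) * r j" by (simp add: d_def mult.assoc)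
    then show ?thesis by (simp add: rr[OF that])
  qed
  have nd: "norm (d j) = 1" for j by (simp add: d_def norm_sa_square sar nr)
  have dc: "d j \<preceq> c (Suc j)" for j
  proof -
    obtain q where q: "r j * r j = q * r j * star q" using square_eq_sandwich[OF cposr] by blast
    show ?thesis
      by (rule cuntz_leI[of _ "q * f j * y j"])
         (simp only: d_def q, simp add: r_def star_mult sa_star[OF saf] mult.assoc)
  qed
  have "thin d"
    unfolding thin_def
  proof (intro conjI allI impI)
    show "cpos (d j)" for j unfolding cpos_def d_def using sar by (metis sa_star)
    show "d j \<noteq> 0" for j using nd[of j] by auto
    show "d i * d j = 0" if "i \<noteq> j" for i j by (rule dd[OF that])
    fix a :: 'a assume "cpos a \<and> a \<noteq> 0"
    then obtain i where i: "s i \<preceq> a" using s unfolding order_dense_def by blast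
    have "(\<Sum>j=n..m. d j) \<preceq> a" if "m \<ge> n" "n \<ge> i" for m n
    proof -
      have "(\<Sum>j=n..n + (m - n). d j) \<preceq> c n" by (rule sum_cuntz_le_halving[of c d, OF c(4) dc])
      then have "(\<Sum>j=n..m. d j) \<preceq> c n" using that by simp
      then show ?thesis using cuntz_le_trans[OF cuntz_le_trans[OF _ c(3)[OF that(2)]] i] by blast
    qed
    then show "\<exists>N. \<forall>m n. m \<ge> n \<and> n \<ge> N \<longrightarrow> (\<Sum>j=n..m. d j) \<preceq> a" by blast
  qed
  define S where "S n = (\<Sum>j<n. r j)" for n
  have nr': "norm (r j) \<le> 1" for j by (simp add: nr)
  have re2: "r j * e k = 0" if "k < j" for j k by (rule re) (use that in simp)
  from ex_multiplier_orthogonal_sum[of r e, OF sar nr' rr eD(4) re2]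
  obtain Y where Y': "star Y = Y \<and> (\<forall>a. (\<lambda>n. S n * a) \<longlonglongrightarrow> lact Y a) \<and> (\<forall>a. (\<lambda>n. a * S n) \<longlonglongrightarrow> ract Y a)"
    unfolding S_def ..
  then have Y: "star Y = Y" "(\<lambda>n. S n * a) \<longlonglongrightarrow> lact Y a" "(\<lambda>n. a * S n) \<longlonglongrightarrow> ract Y a" for a
    by simp_all
  have nS: "norm (S n) \<le> 1" for n
    unfolding S_def lessThan_atLeast0 by (rule norm_orthogonal_sum_le[OF sar nr' rr])
  have SS: "S n * S n = (\<Sum>j<n. d j)" for n
  proof -
    have "S n * S n = (\<Sum>i<n. \<Sum>j<n. if j = i then d i else 0)"
      unfolding S_def sum_product by (intro sum.cong refl) (auto simp: d_def rr)
    then show ?thesis by simp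
  qed
  define D where "D = Y * Y"
  have lD: "(\<lambda>n. (\<Sum>j<n. d j) * a) \<longlonglongrightarrow> lact D a" and rD: "(\<lambda>n. a * (\<Sum>j<n. d j)) \<longlonglongrightarrow> ract D a" for a
    using tendsto_lact_square[OF nS Y(2,3), of a] by (simp_all add: SS D_def)
  have strict: "limitin strict_topology (\<lambda>n. \<Sum>j<n. mult_embed (d j)) D sequentially"
  proof -
    have "(\<Sum>j<n. mult_embed (d j)) = mult_embed (\<Sum>j<n. d j)" for n
      by (rule linear_sum[OF bounded_linear.linear[OF bounded_linear_mult_embed], symmetric])
    then show ?thesis using lD rD by (simp add: limitin_strict_topology)
  qed
  have lD_finite: "lact D a = (\<Sum>j<K. d j) * a" if "\<And>j. j \<ge> K \<Longrightarrow> d j * a = 0" for K a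
  proof (rule LIMSEQ_unique[OF lD])
    have "(\<Sum>j<K. d j) * a = (\<Sum>j<n. d j) * a" if "n \<ge> K" for n
      unfolding sum_distrib_right using that \<open>\<And>j. j \<ge> K \<Longrightarrow> d j * a = 0\<close>
      by (intro sum.mono_neutral_left) auto
    then have "\<forall>\<^sub>F n in sequentially. (\<Sum>j<K. d j) * a = (\<Sum>j<n. d j) * a"
      by (rule eventually_mono[OF eventually_ge_at_top])
    then show "(\<lambda>n. (\<Sum>j<n. d j) * a) \<longlonglongrightarrow> (\<Sum>j<K. d j) * a"
      by (rule Lim_transform_eventually[OF tendsto_const])
  qed
  have "D \<in> K\<^sub>o e"
    unfolding K\<^sub>o_def
  proof (intro CollectI conjI allI impI)
    show "cpos D" unfolding cpos_def D_def using Y(1) by metis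
    fix a :: 'a assume "cpos a \<and> a \<noteq> 0"
    then obtain N where N: "\<forall>m n. m \<ge> n \<and> n \<ge> N \<longrightarrow> (\<Sum>j=n..m. d j) \<preceq> a"
      using \<open>thin d\<close> unfolding thin_def by blast
    \<comment> \<open>The compression kills every d j with 2j + 1 < n, in particular all j < n div
      2. Thus n \<ge> 2N leaves only indices from N on, where thinness applies.\<close>
    have "(e m - e n) * lact D (e m - e n) \<preceq> a" if mn: "m > n" "n \<ge> 2 * N" for m n
    proof -
      let ?g = "e m - e n"
      have "lact D ?g = (\<Sum>j<Suc m. d j) * ?g"
        by (rule lD_finite) (use mn in \<open>simp add: right_diff_distrib de\<close>)
      also have "?g * \<dots> = (\<Sum>j<Suc m. ?g * d j * ?g)"
        by (simp only: sum_distrib_left sum_distrib_right mult.assoc)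
      also have "\<dots> = (\<Sum>j=n div 2..m. ?g * d j * ?g)"
      proof (rule sum.mono_neutral_right)
        have "?g * d j = 0" if "j < n div 2" for j
        proof -
          have "2 * j + 1 < n" "2 * j + 1 < m" using that mn by auto
          then show ?thesis by (simp add: left_diff_distrib ed de')
        qed
        then show "\<forall>j\<in>{..<Suc m} - {n div 2..m}. ?g * d j * ?g = 0" by auto
      qed auto
      also have "\<dots> = ?g * (\<Sum>j=n div 2..m. d j) * star ?g"
        by (simp add: sum_distrib_left sum_distrib_right star_diff es)
      finally have "?g * lact D ?g \<preceq> (\<Sum>j=n div 2..m. d j)" by (rule cuntz_leI)
      moreover have "(\<Sum>j=n div 2..m. d j) \<preceq> a" using mn by (intro N[rule_format]) auto
      ultimately show ?thesis by (rule cuntz_le_trans)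
    qed
    then show "\<exists>N. \<forall>m n. m > n \<and> n \<ge> N \<longrightarrow> (e m - e n) * lact D (e m - e n) \<preceq> a" by blast
  qed
  moreover have "D \<notin> range mult_embed"
  proof
    assume "D \<in> range mult_embed"
    then obtain a where a: "D = mult_embed a" by blast
    \<comment> \<open>An element a of the algebra is within distance 1 of a * e k. Multiplication by
      d (k+1), which e k annihilates, would then give norm below 1, whereas \<open>D\<close> sends d
      (k+1) to its square, of norm 1.\<close>
    obtain k where k: "norm (a * e k - a) < 1" using LIMSEQ_D[OF eD(5)[of a], of 1] by auto
    let ?d = "d (Suc k)"
    have "a * ?d = (\<Sum>j<Suc (Suc k). d j) * ?d"
      using lD_finite[of "Suc (Suc k)" ?d] dd by (simp add: a)
    also have "\<dots> = (\<Sum>j<Suc (Suc k). if j = Suc k then ?d * ?d else 0)"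
      unfolding sum_distrib_right by (intro sum.cong refl) (auto simp: dd)
    finally have "a * ?d = ?d * ?d" by simp
    then have "norm (a * ?d) = 1" using norm_sa_square[OF sad] nd by simp
    moreover have "a * ?d = (a - a * e k) * ?d"
      by (simp add: left_diff_distrib mult.assoc ed de)
    then have "norm (a * ?d) \<le> norm (a - a * e k) * 1"
      using norm_mult_ineq[of "a - a * e k" ?d] nd by simp
    ultimately show False using k by (simp add: norm_minus_commute)
  qed
  ultimately show ?thesis using \<open>thin d\<close> strict by blast
qed

theorem theorem3p14:
  fixes e :: "nat \<Rightarrow> 'a::cstar_algebra"
  assumes "simple_algebra TYPE('a)"
    and "sigma_unital TYPE('a)"
    and "\<not> unital TYPE('a)"
    and "\<not> elementary TYPE('a)"
    and "approximate_identity e"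
  shows "(mult_embed ` {a. cpos a} \<noteq> closure (K\<^sub>o e)
           \<longleftrightarrow> (\<exists>s :: nat \<Rightarrow> 'a. order_dense s))
       \<and> ((\<exists>s :: nat \<Rightarrow> 'a. order_dense s)
           \<longleftrightarrow> (\<exists>t :: nat \<Rightarrow> 'a. thin t))
       \<and> ((\<exists>t :: nat \<Rightarrow> 'a. thin t)
           \<longleftrightarrow> (\<exists>(d :: nat \<Rightarrow> 'a) D. thin d \<and>
                 limitin strict_topology (\<lambda>n. \<Sum>j<n. mult_embed (d j)) D sequentially \<and>
                 D \<in> K\<^sub>o e - range mult_embed))"
    (is "(?i \<longleftrightarrow> ?ii) \<and> (?ii \<longleftrightarrow> ?iii) \<and> (?iii \<longleftrightarrow> ?iv)")
proof -
  have "?ii" if "?i"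
  proof (rule ccontr)
    assume "\<not> ?ii"
    then have "K\<^sub>o e \<subseteq> mult_embed ` {a. cpos a}" using ex_order_dense_if_K\<^sub>o[OF assms(5)] by blast
    then have "closure (K\<^sub>o e) \<subseteq> mult_embed ` {a. cpos a}"
      by (rule closure_minimal[OF _ closed_mult_embed_cpos])
    moreover have "mult_embed ` {a. cpos a} \<subseteq> closure (K\<^sub>o e)"
      using mult_embed_cpos_in_closure_K\<^sub>o[OF assms(5)] by blast
    ultimately show False using that by blast
  qed
  moreover have "?iv" if "?ii" using that ex_thin_if_order_dense[OF assms(1,4,5)] by blast
  moreover have "?iii" if "?iv" using that by blast
  moreover have "?ii" if "?iii" using that order_dense_if_thin by blast
  moreover have "?i" if iv: "?iv"
  proof -
    obtain D where "D \<in> K\<^sub>o e" "D \<notin> range mult_embed" using iv by blast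
    then have "D \<in> closure (K\<^sub>o e)" "D \<notin> mult_embed ` {a. cpos a}" using closure_subset[of "K\<^sub>o e"] by blast+
    then show ?thesis by blast
  qed
  ultimately show ?thesis by blast
qed

end
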